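(* Let $L$ be a (non-empty) unary relational language and $\kappa$ an infinite cardinal. Consider the relations $\sim_0,\dots,\sim_{11}$ on $\operatorname{Int}_L(\kappa)$ (equivalently, on $\operatorname{Mod}_L(\kappa)$) defined in the context. Then: (a) For all $\mathbb X,\mathbb Y\in\operatorname{Mod}_L(\kappa)$, $\mathbb X\rightleftarrows\mathbb Y$ implies $\mathbb X\cong\mathbb Y$ (that is, $\operatorname{Mod}_L(\kappa)$ is a Cantor-Schröder-Bernstein class). (b) The hierarchy of the relations $\sim_k$, $k\ne 8,10$, is the following: $\sim_1=\sim_2$; $\sim_3=\sim_5=\sim_7=\sim_9$; $\sim_0\subsetneq\sim_1$; $\sim_1\subsetneq\sim_3$; $\sim_1\subsetneq\sim_4$; $\sim_3\subsetneq\sim_6$; $\sim_4\subsetneq\sim_6$; $\sim_6\subsetneq\sim_{11}$; and $\sim_3$ and $\sim_4$ are incomparable under inclusion. In addition, $\sim_8\ne\sim_{11}$. (c) If $\kappa$ is a regular cardinal and $2^\kappa=\kappa^+$, then $\sim_8\ne\sim_{10}$.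
   Context: A relational language is $L=\langle R_i:i\in I\rangle$, where $R_i$ is a relational symbol of arity $n_i\ge 1$; it is unary iff $n_i=1$ for all $i\in I$. For a non-empty set $X$, $\operatorname{Int}_L(X)$ is the set of all sequences $\rho=\langle\rho_i:i\in I\rangle$ with $\rho_i\subset X^{n_i}$ (so $\rho_i\subset X$ in the unary case); $\operatorname{Mod}_L(X)$ is the set of $L$-structures $\langle X,\rho\rangle$, $\rho\in\operatorname{Int}_L(X)$. An embedding $f:\langle X,\rho\rangle\hookrightarrow\langle Y,\sigma\rangle$ is an injection $f:X\to Y$ such that $\langle x_1,\dots,x_{n_i}\rangle\in\rho_i\Leftrightarrow\langle f(x_1),\dots,f(x_{n_i})\rangle\in\sigma_i$ for all $i\in I$ and all $x_1,\dots,x_{n_i}\in X$. An isomorphism ($\cong$) is a surjective embedding. Two $L$-structures are equimorphic ($\rightleftarrows$) iff each embeds in the other. $\mathbb P(\mathbb X)=\{f[X]: f:\mathbb X\hookrightarrow\mathbb X\}$, regarded as the poset $\langle \mathbb P(\mathbb X),\subset\rangle$ when isomorphism, separative quotient or forcing equivalence is mentioned. Write $\mathbb P(\rho)=\mathbb P(\langle X,\rho\rangle)$, and $\rho\cong\sigma$, $\rho\rightleftarrows\sigma$ for the corresponding relations between $\langle X,\rho\rangle$ and $\langle X,\sigma\rangle$. For a partial order $\langle P,\le\rangle$ let $p\le^* q$ iff $\forall r\le p\,\exists s\le r\; s\le q$, and $p=^*q$ iff $p\le^*q$ and $q\le^*p$. The separative quotient $\operatorname{sq}\mathbb P$ is $P/{=^*}$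 ordered by $[p]\trianglelefteq[q]\Leftrightarrow p\le^*q$. Two pre-orders are forcing equivalent ($\mathbb P\equiv\mathbb Q$) iff $\operatorname{ge}(\mathbb P)=\operatorname{ge}(\mathbb Q)$, where $\operatorname{ge}(\mathbb P)=\{V_{\mathbb P}[G]: G \text{ is a } \mathbb P\text{-generic filter over the ground model } V\}$. The relations on $\operatorname{Int}_L(\kappa)$: $\rho\sim_0\sigma\Leftrightarrow\rho=\sigma$; $\rho\sim_1\sigma\Leftrightarrow\mathbb P(\rho)=\mathbb P(\sigma)\wedge\rho\cong\sigma$; $\rho\sim_2\sigma\Leftrightarrow\mathbb P(\rho)=\mathbb P(\sigma)\wedge\rho\rightleftarrows\sigma$; $\rho\sim_3\sigma\Leftrightarrow\rho\cong\sigma$; $\rho\sim_4\sigma\Leftrightarrow\mathbb P(\rho)=\mathbb P(\sigma)$; $\rho\sim_5\sigma\Leftrightarrow\mathbb P(\rho)\cong\mathbb P(\sigma)\wedge\rho\rightleftarrows\sigma$; $\rho\sim_6\sigma\Leftrightarrow\mathbb P(\rho)\cong\mathbb P(\sigma)$; $\rho\sim_7\sigma\Leftrightarrow\operatorname{sq}\mathbb P(\rho)\cong\operatorname{sq}\mathbb P(\sigma)\wedge\rho\rightleftarrows\sigma$; $\rho\sim_8\sigma\Leftrightarrow\operatorname{sq}\mathbb P(\rho)\cong\operatorname{sq}\mathbb P(\sigma)$; $\rho\sim_9\sigma\Leftrightarrow\rho\rightleftarrows\sigma$; $\rho\sim_{10}\sigma\Leftrightarrow\mathbb P(\rho)\equiv\mathbb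 P(\sigma)$; $\rho\sim_{11}\sigma$ always (the full relation). *)

theory Defs
  imports Main
begin

unbundle cardinal_syntax

section \<open>Relational structures\<close>

text \<open>A relational language is an index set together with the arities of its symbols (the values
  of the arity function outside the index set are irrelevant). Tuples are lists.\<close>

type_synonym 'i language = "'i set \<times> ('i \<Rightarrow> nat)"

abbreviation symbols :: "'i language \<Rightarrow> 'i set" where
  "symbols L \<equiv> fst L"

abbreviation arity :: "'i language \<Rightarrow> 'i \<Rightarrow> nat" where
  "arity L \<equiv> snd L"

definition relational_language :: "'i language \<Rightarrow> bool" where
  "relational_language L \<longleftrightarrow> symbols L \<noteq> {} \<and> (\<forall>i\<in>symbols L. arity L i \<ge> 1)"

definition unary :: "'i language \<Rightarrow> bool" where
  "unary L \<longleftrightarrow> (\<forall>i\<in>symbols L. arity L i = 1)"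

text \<open>A sequence indexed by the symbols is a function with value \<open>{}\<close> at every other index, so
  that equality of functions is equality of sequences.\<close>

type_synonym ('i, 'a) interp = "'i \<Rightarrow> 'a list set"

definition Int_L :: "'i language \<Rightarrow> 'a set \<Rightarrow> ('i, 'a) interp set" where
  "Int_L L X = {\<rho>. (\<forall>i\<in>symbols L. \<rho> i \<subseteq> {xs. length xs = arity L i \<and> set xs \<subseteq> X}) \<and>
                   (\<forall>i. i \<notin> symbols L \<longrightarrow> \<rho> i = {})}"

type_synonym ('i, 'a) struct = "'a set \<times> ('i, 'a) interp"

definition Mod_L :: "'i language \<Rightarrow> 'a set \<Rightarrow> ('i, 'a) struct set" where
  "Mod_L L X = {(X, \<rho>) | \<rho>. \<rho> \<in> Int_L L X}"

definition embedding :: "'i language \<Rightarrow> ('i, 'a) struct \<Rightarrow> ('i, 'b) struct \<Rightarrow> ('a \<Rightarrow> 'b) \<Rightarrow> bool"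
  where "embedding L A B f \<longleftrightarrow>
    f ` fst A \<subseteq> fst B \<and> inj_on f (fst A) \<and>
    (\<forall>i\<in>symbols L. \<forall>xs. length xs = arity L i \<and> set xs \<subseteq> fst A \<longrightarrow>
      (xs \<in> snd A i \<longleftrightarrow> map f xs \<in> snd B i))"

definition isomorphic :: "'i language \<Rightarrow> ('i, 'a) struct \<Rightarrow> ('i, 'b) struct \<Rightarrow> bool" where
  "isomorphic L A B \<longleftrightarrow> (\<exists>f. embedding L A B f \<and> f ` fst A = fst B)"

definition equimorphic :: "'i language \<Rightarrow> ('i, 'a) struct \<Rightarrow> ('i, 'b) struct \<Rightarrow> bool" where
  "equimorphic L A B \<longleftrightarrow> (\<exists>f. embedding L A B f) \<and> (\<exists>g. embedding L B A g)"

definition copies :: "'i language \<Rightarrow> ('i, 'a) struct \<Rightarrow> 'a set set" where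
  "copies L A = {f ` fst A | f. embedding L A A f}"


section \<open>Posets\<close>

text \<open>A poset, or more generally a preorder, is a reflexive transitive relation \<open>P\<close> on \<open>Field P\<close>;
  \<open>(q, p) \<in> P\<close> means \<open>q \<le> p\<close>. For such relations \<^const>\<open>iso\<close> is the usual notion of
  order isomorphism, see \<open>iso_iff2\<close>.\<close>

definition copies_poset :: "'i language \<Rightarrow> ('i, 'a) struct \<Rightarrow> 'a set rel" where
  "copies_poset L A = {(B, C). B \<in> copies L A \<and> C \<in> copies L A \<and> B \<subseteq> C}"

definition order_isomorphic :: "'p rel \<Rightarrow> 'q rel \<Rightarrow> bool" where
  "order_isomorphic P Q \<longleftrightarrow> (\<exists>f. iso P Q f)"

definition sep_le :: "'p rel \<Rightarrow> 'p rel" where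
  "sep_le P = {(p, q). p \<in> Field P \<and> q \<in> Field P \<and>
                       (\<forall>r. (r, p) \<in> P \<longrightarrow> (\<exists>s. (s, r) \<in> P \<and> (s, q) \<in> P))}"

definition sep_eq :: "'p rel \<Rightarrow> 'p rel" where
  "sep_eq P = {(p, q). (p, q) \<in> sep_le P \<and> (q, p) \<in> sep_le P}"

definition sq :: "'p rel \<Rightarrow> 'p set rel" where
  "sq P = {(sep_eq P `` {p}, sep_eq P `` {q}) | p q. (p, q) \<in> sep_le P}"


section \<open>Forcing equivalence\<close>

text \<open>The ground model \<open>V\<close> is the universe of HOL, over which a generic filter need not exist, so
  statements about the generic extensions of \<open>V\<close> are expressed by the forcing relation.

  A name for a subset of a ground model set is a set \<open>\<tau>\<close> of pairs (element, condition), with value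
  \<open>{x. \<exists>t\<in>G. (x, t) \<in> \<tau>}\<close> at a generic filter \<open>G\<close>; every subset in \<open>V[G]\<close> of a ground model set is
  such a value. For an existential statement, \<open>p\<close> forces it iff below \<open>p\<close> the conditions having
  a witness are dense; for an implication, \<open>p\<close> forces \<open>\<phi> \<longrightarrow> \<psi>\<close> iff every \<open>r \<le> p\<close> forcing \<open>\<phi>\<close>
  forces \<open>\<psi>\<close>; conjunctions and quantifiers \<open>\<forall>x\<in>X\<close> over ground model sets commute with forcing.\<close>

definition dense :: "'p rel \<Rightarrow> 'p set \<Rightarrow> bool" where
  "dense P D \<longleftrightarrow> D \<subseteq> Field P \<and> (\<forall>p\<in>Field P. \<exists>d\<in>D. (d, p) \<in> P)"

definition forces_ex :: "'p rel \<Rightarrow> 'p \<Rightarrow> ('p \<Rightarrow> 'x \<Rightarrow> bool) \<Rightarrow> bool" where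
  "forces_ex P p \<phi> \<longleftrightarrow> (\<forall>q. (q, p) \<in> P \<longrightarrow> (\<exists>s x. (s, q) \<in> P \<and> \<phi> s x))"

text \<open>\<open>p\<close> forces \<open>x \<in> \<tau>[G]\<close>.\<close>

definition forces_mem :: "'p rel \<Rightarrow> 'p \<Rightarrow> 'x \<Rightarrow> ('x \<times> 'p) set \<Rightarrow> bool" where
  "forces_mem P p x \<tau> \<longleftrightarrow> forces_ex P p (\<lambda>s t. (x, t) \<in> \<tau> \<and> (s, t) \<in> P)"

text \<open>\<open>p\<close> forces that \<open>\<tau>[G]\<close> is a \<open>Q\<close>-generic filter over \<open>V\<close>: it is upward closed and directed,
  and meets every dense subset of \<open>Q\<close> lying in \<open>V\<close> (in particular \<open>Field Q\<close>, so it is non-empty).\<close>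

definition forces_generic :: "'p rel \<Rightarrow> 'p \<Rightarrow> 'q rel \<Rightarrow> ('q \<times> 'p) set \<Rightarrow> bool" where
  "forces_generic P p Q \<tau> \<longleftrightarrow>
    (\<forall>x y. (x, y) \<in> Q \<longrightarrow>
      (\<forall>r. (r, p) \<in> P \<longrightarrow> forces_mem P r x \<tau> \<longrightarrow> forces_mem P r y \<tau>)) \<and>
    (\<forall>x\<in>Field Q. \<forall>y\<in>Field Q.
      (\<forall>r. (r, p) \<in> P \<longrightarrow> forces_mem P r x \<tau> \<and> forces_mem P r y \<tau> \<longrightarrow>
        forces_ex P r (\<lambda>s z. (z, x) \<in> Q \<and> (z, y) \<in> Q \<and> forces_mem P s z \<tau>))) \<and>
    (\<forall>D. dense Q D \<longrightarrow> forces_ex P p (\<lambda>s x. x \<in> D \<and> forces_mem P s x \<tau>))"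

text \<open>\<open>p\<close> forces \<open>\<pi>[H] = G\<close>, where \<open>H = \<tau>[G]\<close> and \<open>\<pi>\<close> is a \<open>Q\<close>-name for a subset of \<open>P\<close>, so that
  \<open>\<pi>[H] = {x. \<exists>y\<in>H. (x, y) \<in> \<pi>}\<close>. The identity is the canonical \<open>P\<close>-name of \<open>G\<close>.\<close>

definition forces_recovers ::
  "'p rel \<Rightarrow> 'p \<Rightarrow> 'q rel \<Rightarrow> ('q \<times> 'p) set \<Rightarrow> ('p \<times> 'q) set \<Rightarrow> bool" where
  "forces_recovers P p Q \<tau> \<pi> \<longleftrightarrow>
    (\<forall>x\<in>Field P. \<forall>r. (r, p) \<in> P \<longrightarrow>
      (forces_ex P r (\<lambda>s y. (x, y) \<in> \<pi> \<and> forces_mem P s y \<tau>) \<longleftrightarrow>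
       forces_mem P r x (Id_on (Field P))))"

text \<open>Every \<open>P\<close>-generic extension is a \<open>Q\<close>-generic extension: every condition of \<open>P\<close> forces that some
  \<open>Q\<close>-generic filter \<open>H = \<tau>[G]\<close> over \<open>V\<close> satisfies \<open>V[H] = V[G]\<close>. By minimality of generic
  extensions \<open>V[H] = V[G]\<close> means \<open>H \<in> V[G]\<close>, which the name \<open>\<tau>\<close> provides, and \<open>G \<in> V[H]\<close>, which is
  to say \<open>G = \<pi>[H]\<close> for some \<open>Q\<close>-name \<open>\<pi>\<close>.\<close>

definition ge_subset :: "'p rel \<Rightarrow> 'q rel \<Rightarrow> bool" where
  "ge_subset P Q \<longleftrightarrow>
    (\<forall>p\<in>Field P. forces_ex P p (\<lambda>s (\<tau>, \<pi>).
      \<tau> \<subseteq> Field Q \<times> Field P \<and> \<pi> \<subseteq> Field P \<times> Field Q \<and>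
      forces_generic P s Q \<tau> \<and> forces_recovers P s Q \<tau> \<pi>))"

definition forcing_equivalent :: "'p rel \<Rightarrow> 'q rel \<Rightarrow> bool" where
  "forcing_equivalent P Q \<longleftrightarrow> ge_subset P Q \<and> ge_subset Q P"


section \<open>The similarity relations on \<open>Int_L L X\<close>\<close>

definition on_Int :: "'i language \<Rightarrow> 'a set \<Rightarrow> (('i, 'a) struct \<Rightarrow> ('i, 'a) struct \<Rightarrow> bool)
    \<Rightarrow> ('i, 'a) interp rel" where
  "on_Int L X S = {(\<rho>, \<sigma>). \<rho> \<in> Int_L L X \<and> \<sigma> \<in> Int_L L X \<and> S (X, \<rho>) (X, \<sigma>)}"

definition sim0 :: "'i language \<Rightarrow> 'a set \<Rightarrow> ('i, 'a) interp rel" where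
  "sim0 L X = on_Int L X (\<lambda>A B. A = B)"

definition sim1 :: "'i language \<Rightarrow> 'a set \<Rightarrow> ('i, 'a) interp rel" where
  "sim1 L X = on_Int L X (\<lambda>A B. copies L A = copies L B \<and> isomorphic L A B)"

definition sim2 :: "'i language \<Rightarrow> 'a set \<Rightarrow> ('i, 'a) interp rel" where
  "sim2 L X = on_Int L X (\<lambda>A B. copies L A = copies L B \<and> equimorphic L A B)"

definition sim3 :: "'i language \<Rightarrow> 'a set \<Rightarrow> ('i, 'a) interp rel" where
  "sim3 L X = on_Int L X (\<lambda>A B. isomorphic L A B)"

definition sim4 :: "'i language \<Rightarrow> 'a set \<Rightarrow> ('i, 'a) interp rel" where
  "sim4 L X = on_Int L X (\<lambda>A B. copies L A = copies L B)"

definition sim5 :: "'i language \<Rightarrow> 'a set \<Rightarrow> ('i, 'a) interp rel" where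
  "sim5 L X = on_Int L X (\<lambda>A B.
    order_isomorphic (copies_poset L A) (copies_poset L B) \<and> equimorphic L A B)"

definition sim6 :: "'i language \<Rightarrow> 'a set \<Rightarrow> ('i, 'a) interp rel" where
  "sim6 L X = on_Int L X (\<lambda>A B. order_isomorphic (copies_poset L A) (copies_poset L B))"

definition sim7 :: "'i language \<Rightarrow> 'a set \<Rightarrow> ('i, 'a) interp rel" where
  "sim7 L X = on_Int L X (\<lambda>A B.
    order_isomorphic (sq (copies_poset L A)) (sq (copies_poset L B)) \<and> equimorphic L A B)"

definition sim8 :: "'i language \<Rightarrow> 'a set \<Rightarrow> ('i, 'a) interp rel" where
  "sim8 L X = on_Int L X (\<lambda>A B.
    order_isomorphic (sq (copies_poset L A)) (sq (copies_poset L B)))"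

definition sim9 :: "'i language \<Rightarrow> 'a set \<Rightarrow> ('i, 'a) interp rel" where
  "sim9 L X = on_Int L X (\<lambda>A B. equimorphic L A B)"

definition sim10 :: "'i language \<Rightarrow> 'a set \<Rightarrow> ('i, 'a) interp rel" where
  "sim10 L X = on_Int L X (\<lambda>A B. forcing_equivalent (copies_poset L A) (copies_poset L B))"

definition sim11 :: "'i language \<Rightarrow> 'a set \<Rightarrow> ('i, 'a) interp rel" where
  "sim11 L X = on_Int L X (\<lambda>A B. True)"

end

theory Submission
  imports Defs
begin

text \<open>A self-embedding of a unary structure is an injection that preserves the set of symbols
  holding at a point. So a structure is determined up to isomorphism by the cardinalities of the
  classes of points with the same set of symbols, which gives (a) by the Schroeder-Bernstein theorem
  applied to each class, and the copies are the sets meeting every class in a set of full size.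

  For \<open>sim8\<close> and \<open>sim10\<close>, compare a structure having one class with a structure having two classes
  of size \<open>\<kappa>\<close>. For these, \<open>A \<le>\<^sup>* B\<close> says that \<open>A - B\<close> is smaller than \<open>\<kappa>\<close> in each class. With one class
  the conditions incompatible with \<open>p\<close> have a greatest element, the complement of \<open>p\<close>; with two
  classes they need not, so the separative quotients differ.

  If \<open>\<kappa>\<close> is regular and \<open>2\<^sup>\<kappa> = \<kappa>\<^sup>+\<close>, both posets have a dense subset isomorphic to the tree of
  sequences in \<open>\<kappa>\<^sup>+\<close> of successor length below \<open>\<theta>\<close>, where \<open>\<theta> = \<kappa>\<^sup>+\<close> if \<open>\<kappa>\<close> is countable and \<open>\<theta> = \<omega>\<close>
  otherwise, and are therefore forcing equivalent. The tree is built from an enumeration of a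
  maximal antichain below every branch; it is dense if \<open>\<theta>\<close> many maximal antichains with dense union
  are refined along the way. For countable \<open>\<kappa>\<close> such antichains come from an enumeration of the poset,
  and branches of countable length have lower bounds by diagonalisation. For uncountable \<open>\<kappa>\<close> they
  come from countably many almost disjoint families such that every set of size \<open>\<kappa>\<close> meets \<open>\<kappa>\<^sup>+\<close> members
  of one of them in a set of size \<open>\<kappa>\<close>.\<close>

section \<open>Common dense embeddings and forcing equivalence\<close>

definition compatible :: "'p rel \<Rightarrow> 'p \<Rightarrow> 'p \<Rightarrow> bool" where
  "compatible R p q \<longleftrightarrow> (\<exists>r. (r, p) \<in> R \<and> (r, q) \<in> R)"

text \<open>Incompatibility is preserved in place of the order being reflected; reflection in the
  separative sense is recovered in \<open>i_le_imp_j_le\<close>.\<close>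

definition dense_embedding :: "'t rel \<Rightarrow> 'p rel \<Rightarrow> ('t \<Rightarrow> 'p) \<Rightarrow> bool" where
  "dense_embedding T R i \<longleftrightarrow>
    i ` Field T \<subseteq> Field R \<and>
    (\<forall>s t. (s, t) \<in> T \<longrightarrow> (i s, i t) \<in> R) \<and>
    (\<forall>s\<in>Field T. \<forall>t\<in>Field T. compatible R (i s) (i t) \<longrightarrow> compatible T s t) \<and>
    (\<forall>p\<in>Field R. \<exists>t\<in>Field T. (i t, p) \<in> R)"

lemma dense_embeddingD:
  assumes "dense_embedding T R i"
  shows "t \<in> Field T \<Longrightarrow> i t \<in> Field R"
    and "(s, t) \<in> T \<Longrightarrow> (i s, i t) \<in> R"
    and "(p, i s) \<in> R \<Longrightarrow> (p, i t) \<in> R \<Longrightarrow> s \<in> Field T \<Longrightarrow> t \<in> Field T \<Longrightarrow> \<exists>u. (u, s) \<in> T \<and> (u, t) \<in> T"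
    and "p \<in> Field R \<Longrightarrow> \<exists>t\<in>Field T. (i t, p) \<in> R"
  using assms unfolding dense_embedding_def compatible_def image_subset_iff by simp_all blast

section \<open>Preorders and their separative order\<close>

lemma Preorder_refl: "Preorder R \<Longrightarrow> p \<in> Field R \<Longrightarrow> (p, p) \<in> R"
  by (auto simp: order_on_defs refl_on_def)

lemma Preorder_trans: "Preorder R \<Longrightarrow> (p, q) \<in> R \<Longrightarrow> (q, r) \<in> R \<Longrightarrow> (p, r) \<in> R"
  by (auto simp: order_on_defs dest: transD)

lemma sep_leI:
  assumes P: "Preorder P" and pq: "(p, q) \<in> P"
  shows "(p, q) \<in> sep_le P"
proof -
  have "(r, r) \<in> P \<and> (r, q) \<in> P" if "(r, p) \<in> P" for r
    using that pq P by (meson FieldI1 Preorder_refl Preorder_trans)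
  then show ?thesis unfolding sep_le_def using pq by (blast intro: FieldI1 FieldI2)
qed

lemma sep_leD: "(p, q) \<in> sep_le P \<Longrightarrow> p \<in> Field P" "(p, q) \<in> sep_le P \<Longrightarrow> q \<in> Field P"
  unfolding sep_le_def by blast+

lemma Field_sep_le:
  assumes P: "Preorder P"
  shows "Field (sep_le P) = Field P"
proof (intro equalityI subsetI)
  fix p assume "p \<in> Field (sep_le P)"
  then show "p \<in> Field P" by (metis DomainE FieldI1 FieldI2 Field_def RangeE Un_iff sep_leD)
next
  fix p assume "p \<in> Field P"
  then show "p \<in> Field (sep_le P)" using sep_leI[OF P Preorder_refl[OF P]] by (blast intro: FieldI1)
qed

lemma sep_le_common:
  assumes "Preorder P" "(p, q) \<in> sep_le P"
  obtains r where "(r, p) \<in> P" "(r, q) \<in> P"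
  using assms Preorder_refl[of P p] unfolding sep_le_def by blast

lemma sep_le_trans:
  assumes "Preorder P" and pq: "(p, q) \<in> sep_le P" and qr: "(q, r) \<in> sep_le P"
  shows "(p, r) \<in> sep_le P"
proof -
  have "\<exists>s. (s, x) \<in> P \<and> (s, r) \<in> P" if x: "(x, p) \<in> P" for x
  proof -
    obtain s where "(s, x) \<in> P" "(s, q) \<in> P" using pq x unfolding sep_le_def by blast
    moreover then obtain s' where "(s', s) \<in> P" "(s', r) \<in> P" using qr unfolding sep_le_def by blast
    ultimately show ?thesis using Preorder_trans[OF assms(1)] by blast
  qed
  then show ?thesis using pq qr unfolding sep_le_def by blast
qed

lemma Preorder_sep_le:
  assumes P: "Preorder P"
  shows "Preorder (sep_le P)"
  unfolding order_on_defs refl_on_def Field_sep_le[OF P]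
proof (intro conjI ballI)
  show "sep_le P \<subseteq> Field P \<times> Field P" using sep_leD by fast
  show "(x, x) \<in> sep_le P" if "x \<in> Field P" for x
    using sep_leI[OF P Preorder_refl[OF P that]] .
  show "trans (sep_le P)" using sep_le_trans[OF P] by (rule transI)
qed

text \<open>Passing to the separative order twice adds nothing: a witness \<open>y\<close> in
  \<open>sep_le P\<close> can be replaced by a common lower bound of \<open>y\<close> and
  \<open>x\<close> in \<open>P\<close>, and below that by one that is also under
  \<open>q\<close>.\<close>

lemma sep_le_dense:
  assumes P: "Preorder P" and "p \<in> Field P" "q \<in> Field P"
    and *: "\<And>x. (x, p) \<in> P \<Longrightarrow> \<exists>y. (y, x) \<in> sep_le P \<and> (y, q) \<in> sep_le P"
  shows "(p, q) \<in> sep_le P"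
proof -
  have "\<exists>s. (s, x) \<in> P \<and> (s, q) \<in> P" if x: "(x, p) \<in> P" for x
  proof -
    obtain y where y: "(y, x) \<in> sep_le P" "(y, q) \<in> sep_le P" using *[OF x] by blast
    obtain z where z: "(z, y) \<in> P" "(z, x) \<in> P" using sep_le_common[OF P y(1)] .
    then obtain s where "(s, z) \<in> P" "(s, q) \<in> P" using y(2) unfolding sep_le_def by blast
    then show ?thesis using z Preorder_trans[OF P] by blast
  qed
  then show ?thesis using assms(2,3) unfolding sep_le_def by blast
qed

text \<open>The dense embeddings go into the separative orders because the trees constructed below
  embed only there; the conclusion is nevertheless about \<open>P\<close> and \<open>Q\<close>
  themselves.\<close>

locale common_dense =
  fixes P :: "'p rel" and Q :: "'q rel" and T :: "'t rel"
    and i :: "'t \<Rightarrow> 'p" and j :: "'t \<Rightarrow> 'q"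
  assumes P: "Preorder P" and Q: "Preorder Q" and T: "Preorder T"
    and i: "dense_embedding T (sep_le P) i" and j: "dense_embedding T (sep_le Q) j"
begin

text \<open>The order of this list fixes the numbering below: \<open>tr(1)\<close> to
  \<open>tr(4)\<close> belong to \<open>P\<close>, \<open>Q\<close>, \<open>sep_le P\<close> and
  \<open>sep_le Q\<close>, and \<open>le_sep(1)\<close>, \<open>le_sep(2)\<close> start from
  \<open>P\<close> and \<open>Q\<close>.\<close>

lemmas preorders = P Q Preorder_sep_le[OF P] Preorder_sep_le[OF Q]
lemmas tr = preorders[THEN Preorder_trans]
lemmas le_sep = sep_leI[OF P] sep_leI[OF Q]

lemmas i_mono = dense_embeddingD(2)[OF i] and j_mono = dense_embeddingD(2)[OF j]
lemmas i_comp = dense_embeddingD(3)[OF i] and j_comp = dense_embeddingD(3)[OF j]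
lemmas i_Field = dense_embeddingD(1)[OF i, unfolded Field_sep_le[OF P]]
  and j_Field = dense_embeddingD(1)[OF j, unfolded Field_sep_le[OF Q]]
lemmas i_dense = dense_embeddingD(4)[OF i, unfolded Field_sep_le[OF P]]
  and j_dense = dense_embeddingD(4)[OF j, unfolded Field_sep_le[OF Q]]

text \<open>Density of the image of \<open>j\<close> and reflection of compatibility let the
  elements of \<open>T\<close> below \<open>t\<close> stand for all conditions below
  \<open>j t\<close>, so the separative order only has to be tested on \<open>T\<close>.\<close>

lemma j_leI:
  assumes t: "t \<in> Field T" and y: "y \<in> Field Q"
    and *: "\<And>b. (b, t) \<in> T \<Longrightarrow> \<exists>c. (c, b) \<in> T \<and> (j c, y) \<in> sep_le Q"
  shows "(j t, y) \<in> sep_le Q"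
proof (rule sep_le_dense[OF Q j_Field[OF t] y])
  fix z assume z: "(z, j t) \<in> Q"
  then have "z \<in> Field Q" by (auto intro: FieldI1)
  then obtain a where a: "a \<in> Field T" "(j a, z) \<in> sep_le Q" using j_dense by blast
  then have "(j a, j t) \<in> sep_le Q" using tr(4)[OF a(2) le_sep(2)[OF z]] by blast
  then obtain b where b: "(b, a) \<in> T" "(b, t) \<in> T"
    using j_comp[OF j_mono[OF Preorder_refl[OF T a(1)]] _ a(1) t] by blast
  then obtain c where c: "(c, b) \<in> T" "(j c, y) \<in> sep_le Q" using * by blast
  show "\<exists>x. (x, z) \<in> sep_le Q \<and> (x, y) \<in> sep_le Q"
    using tr(4)[OF j_mono[OF c(1)] tr(4)[OF j_mono[OF b(1)] a(2)]] c(2) by blast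
qed

text \<open>If \<open>i v\<close> is below \<open>i u\<close>, every \<open>b\<close> under
  \<open>v\<close> is compatible with \<open>u\<close> in \<open>T\<close>. This speaks of
  \<open>T\<close> alone, so it yields the same comparison on the side of \<open>j\<close>.\<close>

lemma i_le_imp_j_le:
  assumes v: "v \<in> Field T" and u: "u \<in> Field T" and vu: "(i v, i u) \<in> sep_le P"
  shows "(j v, j u) \<in> sep_le Q"
proof (rule j_leI[OF v j_Field[OF u]])
  fix b assume b: "(b, v) \<in> T"
  then have "(i b, i u) \<in> sep_le P" using tr(3)[OF i_mono vu] by blast
  moreover have "b \<in> Field T" using b by (auto intro: FieldI1)
  moreover have "(i b, i b) \<in> sep_le P"
    using i_mono Preorder_refl[OF T] calculation by blast
  ultimately obtain c where "(c, b) \<in> T" "(c, u) \<in> T" using i_comp u by blast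
  then show "\<exists>c. (c, b) \<in> T \<and> (j c, j u) \<in> sep_le Q" using j_mono by blast
qed

section \<open>Names that translate one generic filter into the other\<close>

text \<open>The witnesses for \<open>\<tau>\<close> and \<open>\<pi>\<close> in \<^const>\<open>ge_subset\<close>: both generic filters are determined by
  the same filter on the tree.\<close>

definition H_name :: "('q \<times> 'p) set" where
  "H_name = {(y, i t) | y t. t \<in> Field T \<and> y \<in> Field Q \<and> (j t, y) \<in> sep_le Q}"

text \<open>This eliminates forcing from all later arguments. Forwards, a condition below
  \<open>p\<close> and \<open>i b\<close> that settles a witness \<open>t'\<close> shows that
  \<open>b\<close> and \<open>t'\<close> are compatible, so \<open>j_leI\<close> applies; backwards,
  the conditions \<open>i t\<close> are dense below \<open>p\<close>.\<close>

lemma forces_mem_H_name: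
  assumes p: "p \<in> Field P" and y: "y \<in> Field Q"
  shows "forces_mem P p y H_name \<longleftrightarrow>
    (\<forall>t\<in>Field T. (i t, p) \<in> sep_le P \<longrightarrow> (j t, y) \<in> sep_le Q)"
proof
  assume F: "forces_mem P p y H_name"
  show "\<forall>t\<in>Field T. (i t, p) \<in> sep_le P \<longrightarrow> (j t, y) \<in> sep_le Q"
  proof (intro ballI impI)
    fix t assume t: "t \<in> Field T" "(i t, p) \<in> sep_le P"
    show "(j t, y) \<in> sep_le Q"
    proof (rule j_leI[OF t(1) y])
      fix b assume b: "(b, t) \<in> T"
      then have "(i b, p) \<in> sep_le P" using tr(3)[OF i_mono t(2)] by blast
      then obtain q where q: "(q, i b) \<in> P" "(q, p) \<in> P" using sep_le_common[OF P] by blast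
      then obtain s t' where s: "(s, q) \<in> P" "t' \<in> Field T" "(j t', y) \<in> sep_le Q" "(s, i t') \<in> P"
        using F unfolding forces_mem_def forces_ex_def H_name_def by blast
      have "(s, i b) \<in> sep_le P" "(s, i t') \<in> sep_le P"
        using tr(1)[OF s(1) q(1)] s(4) le_sep(1) by blast+
      then obtain c where "(c, b) \<in> T" "(c, t') \<in> T"
        using i_comp s(2) b by (metis FieldI1)
      then show "\<exists>c. (c, b) \<in> T \<and> (j c, y) \<in> sep_le Q"
        using tr(4)[OF j_mono s(3)] by blast
    qed
  qed
next
  assume *: "\<forall>t\<in>Field T. (i t, p) \<in> sep_le P \<longrightarrow> (j t, y) \<in> sep_le Q"
  show "forces_mem P p y H_name"
    unfolding forces_mem_def forces_ex_def
  proof (intro allI impI)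
    fix q assume q: "(q, p) \<in> P"
    then obtain t where t: "t \<in> Field T" "(i t, q) \<in> sep_le P" using i_dense by (metis FieldI1)
    then have "(j t, y) \<in> sep_le Q" using * tr(3)[OF t(2) le_sep(1)[OF q]] by blast
    moreover obtain s where "(s, i t) \<in> P" "(s, q) \<in> P" using sep_le_common[OF P t(2)] .
    ultimately show "\<exists>s x. (s, q) \<in> P \<and> (y, x) \<in> H_name \<and> (s, x) \<in> P"
      using t y unfolding H_name_def by blast
  qed
qed

lemma forces_mem_up:
  assumes s: "s \<in> Field P" and xy: "(x, y) \<in> sep_le Q" and F: "forces_mem P s x H_name"
  shows "forces_mem P s y H_name"
proof -
  have "(j t, y) \<in> sep_le Q" if "t \<in> Field T" "(i t, s) \<in> sep_le P" for t
    using F that tr(4)[OF _ xy] forces_mem_H_name[OF s sep_leD(1)[OF xy]] by blast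
  then show ?thesis using forces_mem_H_name[OF s sep_leD(2)[OF xy]] by blast
qed

lemma forces_mem_j:
  assumes s: "(s, i w) \<in> sep_le P" and u: "u \<in> Field T" and wu: "(w, u) \<in> T"
  shows "forces_mem P s (j u) H_name"
proof -
  have su: "(s, i u) \<in> sep_le P" using tr(3)[OF s i_mono[OF wu]] .
  then have sF: "s \<in> Field P" by (rule sep_leD)
  show ?thesis
    unfolding forces_mem_H_name[OF sF j_Field[OF u]]
    using i_le_imp_j_le[OF _ u] tr(3)[OF _ su] by blast
qed

text \<open>The common density step for directedness and for meeting dense sets: an element
  \<open>u\<close> of \<open>T\<close> with \<open>j u\<close> below \<open>z\<close> is compatible
  with \<open>t\<close>, and a common extension in \<open>T\<close> leads back to a condition below
  \<open>q\<close>.\<close>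

lemma forces_member_below:
  assumes t: "t \<in> Field T" "(i t, q) \<in> sep_le P" and z: "(z, j t) \<in> sep_le Q"
  obtains s u where "(s, q) \<in> P" "u \<in> Field T" "(j u, z) \<in> sep_le Q" "(s, i u) \<in> sep_le P"
proof -
  have "z \<in> Field Q" using sep_leD(1)[OF z] .
  then obtain u where u: "u \<in> Field T" "(j u, z) \<in> sep_le Q" using j_dense by blast
  have "(j u, j u) \<in> sep_le Q" using j_mono Preorder_refl[OF T u(1)] by blast
  moreover have "(j u, j t) \<in> sep_le Q" using tr(4)[OF u(2) z] .
  ultimately obtain w where w: "(w, u) \<in> T" "(w, t) \<in> T" using j_comp u t by blast
  have "(i w, q) \<in> sep_le P" using tr(3)[OF i_mono[OF w(2)] t(2)] .
  then obtain s where s: "(s, i w) \<in> P" "(s, q) \<in> P" using sep_le_common[OF P] by blast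
  show thesis using that[OF s(2) u tr(3)[OF le_sep(1)[OF s(1)] i_mono[OF w(1)]]] .
qed

lemma forces_generic_H_name:
  assumes p: "p \<in> Field P"
  shows "forces_generic P p Q H_name"
  unfolding forces_generic_def
proof (intro conjI allI impI ballI)
  fix x y r assume xy: "(x, y) \<in> Q" and r: "(r, p) \<in> P" and "forces_mem P r x H_name"
  then show "forces_mem P r y H_name" using forces_mem_up[OF _ le_sep(2)[OF xy]] FieldI1[OF r] by blast
next
  fix x y r assume xy: "x \<in> Field Q" "y \<in> Field Q" and r: "(r, p) \<in> P"
    and F: "forces_mem P r x H_name \<and> forces_mem P r y H_name"
  have rF: "r \<in> Field P" using r by (auto intro: FieldI1)
  show "forces_ex P r (\<lambda>s z. (z, x) \<in> Q \<and> (z, y) \<in> Q \<and> forces_mem P s z H_name)"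
    unfolding forces_ex_def
  proof (intro allI impI)
    fix q assume q: "(q, r) \<in> P"
    then obtain t where t: "t \<in> Field T" "(i t, q) \<in> sep_le P" using i_dense by (metis FieldI1)
    then have "(j t, x) \<in> sep_le Q" "(j t, y) \<in> sep_le Q"
      using F tr(3)[OF t(2) le_sep(1)[OF q]] forces_mem_H_name[OF rF] xy by blast+
    \<comment> \<open>Directedness asks for a lower bound in \<open>Q\<close> itself, so the
      separative inequalities are converted one after the other: \<open>z1\<close> is below
      \<open>j t\<close> and \<open>x\<close>, then \<open>z2\<close> is also below
      \<open>y\<close>.\<close>
    then obtain z1 where z1: "(z1, j t) \<in> Q" "(z1, x) \<in> Q" using sep_le_common[OF Q] by blast
    then obtain z2 where z2: "(z2, z1) \<in> Q" "(z2, y) \<in> Q"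
      using \<open>(j t, y) \<in> sep_le Q\<close> unfolding sep_le_def by blast
    have "(z2, j t) \<in> sep_le Q" using tr(2)[OF z2(1) z1(1)] le_sep(2) by blast
    then obtain s u where u: "(s, q) \<in> P" "u \<in> Field T" "(j u, z2) \<in> sep_le Q" "(s, i u) \<in> sep_le P"
      using forces_member_below[OF t] by blast
    have "forces_mem P s z2 H_name"
      using forces_mem_up[OF FieldI1[OF u(1)] u(3) forces_mem_j[OF u(4,2) Preorder_refl[OF T u(2)]]] .
    then show "\<exists>s z. (s, q) \<in> P \<and> (z, x) \<in> Q \<and> (z, y) \<in> Q \<and> forces_mem P s z H_name"
      using u(1) tr(2)[OF z2(1) z1(2)] z2(2) by blast
  qed
next
  fix D assume D: "dense Q D"
  show "forces_ex P p (\<lambda>s x. x \<in> D \<and> forces_mem P s x H_name)"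
    unfolding forces_ex_def
  proof (intro allI impI)
    fix q assume q: "(q, p) \<in> P"
    then obtain t where t: "t \<in> Field T" "(i t, q) \<in> sep_le P" using i_dense by (metis FieldI1)
    obtain d where d: "d \<in> D" "(d, j t) \<in> Q" using D j_Field[OF t(1)] unfolding dense_def by blast
    then obtain s u where u: "(s, q) \<in> P" "u \<in> Field T" "(j u, d) \<in> sep_le Q" "(s, i u) \<in> sep_le P"
      using forces_member_below[OF t le_sep(2)[OF d(2)]] by blast
    have "forces_mem P s d H_name"
      using forces_mem_up[OF FieldI1[OF u(1)] u(3) forces_mem_j[OF u(4,2) Preorder_refl[OF T u(2)]]] .
    then show "\<exists>s x. (s, q) \<in> P \<and> x \<in> D \<and> forces_mem P s x H_name" using u d by blast
  qed
qed

lemma swap: "common_dense Q P T j i"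
  using P Q T i j by unfold_locales

text \<open>This is \<open>H_name\<close> of the swapped locale.\<close>

definition G_name :: "('p \<times> 'q) set" where
  "G_name = {(x, j t) | x t. t \<in> Field T \<and> x \<in> Field P \<and> (i t, x) \<in> sep_le P}"

lemma i_le_iff_j_le:
  "v \<in> Field T \<Longrightarrow> u \<in> Field T \<Longrightarrow> (i v, i u) \<in> sep_le P \<longleftrightarrow> (j v, j u) \<in> sep_le Q"
  using i_le_imp_j_le common_dense.i_le_imp_j_le[OF swap] by blast

text \<open>On the image of \<open>T\<close> the filter named by \<open>H_name\<close> carries
  exactly the information of the generic filter of \<open>P\<close>, because \<open>i\<close> and
  \<open>j\<close> induce the same order on \<open>T\<close>. This makes the original filter
  recoverable.\<close>

lemma forces_mem_j_iff:
  assumes s: "s \<in> Field P" and t: "t \<in> Field T"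
  shows "forces_mem P s (j t) H_name \<longleftrightarrow> (s, i t) \<in> sep_le P"
proof
  assume "(s, i t) \<in> sep_le P"
  then show "forces_mem P s (j t) H_name" using forces_mem_j t Preorder_refl[OF T t] by blast
next
  assume "forces_mem P s (j t) H_name"
  then have *: "(i v, i t) \<in> sep_le P" if "v \<in> Field T" "(i v, s) \<in> sep_le P" for v
    using that t i_le_iff_j_le unfolding forces_mem_H_name[OF s j_Field[OF t]] by blast
  show "(s, i t) \<in> sep_le P"
  proof (rule sep_le_dense[OF P s i_Field[OF t]])
    fix x assume x: "(x, s) \<in> P"
    then obtain v where "v \<in> Field T" "(i v, x) \<in> sep_le P" using i_dense by (metis FieldI1)
    then show "\<exists>y. (y, x) \<in> sep_le P \<and> (y, i t) \<in> sep_le P"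
      using *[of v] tr(3)[OF _ le_sep(1)[OF x]] by blast
  qed
qed

text \<open>Both sides of the required equivalence reduce to \<open>(r, x) \<in> sep_le P\<close>:
  the left through the conditions \<open>i t\<close> below \<open>x\<close>, the right because this
  is what forcing membership in the canonical name means.\<close>

lemma forces_recovers_names:
  assumes p: "p \<in> Field P"
  shows "forces_recovers P p Q H_name G_name"
  unfolding forces_recovers_def
proof (intro ballI allI impI)
  fix x r assume x: "x \<in> Field P" and r: "(r, p) \<in> P"
  have rF: "r \<in> Field P" using r by (auto intro: FieldI1)
  have "forces_ex P r (\<lambda>s y. (x, y) \<in> G_name \<and> forces_mem P s y H_name) \<longleftrightarrow> (r, x) \<in> sep_le P"
  proof
    assume F: "forces_ex P r (\<lambda>s y. (x, y) \<in> G_name \<and> forces_mem P s y H_name)"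
    show "(r, x) \<in> sep_le P"
    proof (rule sep_le_dense[OF P rF x])
      fix q assume "(q, r) \<in> P"
      then obtain s t where s: "(s, q) \<in> P" "t \<in> Field T" "(i t, x) \<in> sep_le P" "forces_mem P s (j t) H_name"
        using F unfolding forces_ex_def G_name_def by blast
      then have "(s, i t) \<in> sep_le P" using forces_mem_j_iff by (metis FieldI1)
      then show "\<exists>y. (y, q) \<in> sep_le P \<and> (y, x) \<in> sep_le P"
        using tr(3)[OF _ s(3)] le_sep(1)[OF s(1)] by blast
    qed
  next
    assume rx: "(r, x) \<in> sep_le P"
    show "forces_ex P r (\<lambda>s y. (x, y) \<in> G_name \<and> forces_mem P s y H_name)"
      unfolding forces_ex_def
    proof (intro allI impI)
      fix q assume q: "(q, r) \<in> P"
      then obtain t where t: "t \<in> Field T" "(i t, q) \<in> sep_le P" using i_dense by (metis FieldI1)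
      moreover obtain s where s: "(s, i t) \<in> P" "(s, q) \<in> P" using sep_le_common[OF P t(2)] .
      moreover have "forces_mem P s (j t) H_name" using forces_mem_j_iff t(1) s le_sep by (metis FieldI1)
      moreover have "(i t, x) \<in> sep_le P"
        using tr(3)[OF t(2) tr(3)[OF le_sep(1)[OF q] rx]] .
      ultimately show "\<exists>s y. (s, q) \<in> P \<and> (x, y) \<in> G_name \<and> forces_mem P s y H_name"
        using x unfolding G_name_def by blast
    qed
  qed
  also have "\<dots> \<longleftrightarrow> forces_mem P r x (Id_on (Field P))"
    using x rF unfolding forces_mem_def forces_ex_def sep_le_def by (auto simp: Id_on_def)
  finally show "forces_ex P r (\<lambda>s y. (x, y) \<in> G_name \<and> forces_mem P s y H_name) \<longleftrightarrow>
    forces_mem P r x (Id_on (Field P))" .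
qed

lemma ge_subset: "ge_subset P Q"
  unfolding ge_subset_def
proof
  fix p assume "p \<in> Field P"
  have names: "H_name \<subseteq> Field Q \<times> Field P" "G_name \<subseteq> Field P \<times> Field Q"
    using i_Field j_Field by (auto simp: H_name_def G_name_def)
  show "forces_ex P p (\<lambda>s (\<tau>, \<pi>). \<tau> \<subseteq> Field Q \<times> Field P \<and> \<pi> \<subseteq> Field P \<times> Field Q \<and>
      forces_generic P s Q \<tau> \<and> forces_recovers P s Q \<tau> \<pi>)"
    unfolding forces_ex_def
  proof (intro allI impI exI conjI)
    fix q assume "(q, p) \<in> P"
    then have q: "q \<in> Field P" by (rule FieldI1)
    show "(q, q) \<in> P" using Preorder_refl[OF P q] .
    show "case (H_name, G_name) of (\<tau>, \<pi>) \<Rightarrow>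
        \<tau> \<subseteq> Field Q \<times> Field P \<and> \<pi> \<subseteq> Field P \<times> Field Q \<and>
        forces_generic P q Q \<tau> \<and> forces_recovers P q Q \<tau> \<pi>"
      using names forces_generic_H_name[OF q] forces_recovers_names[OF q] by simp
  qed
qed

theorem forcing_equivalent: "forcing_equivalent P Q"
  using ge_subset common_dense.ge_subset[OF swap] by (simp add: forcing_equivalent_def)

end

section \<open>Dense trees\<close>

text \<open>Zorn's lemma for an arbitrary reflexive symmetric \<open>C\<close>. It is used both with
  compatibility of conditions and with large intersection of sets.\<close>

lemma extend_to_maximal:
  assumes M0: "M0 \<subseteq> D" "pairwise (\<lambda>x y. \<not> C x y) M0"
    and refl: "\<And>x. x \<in> D \<Longrightarrow> C x x" and sym: "\<And>x y. C x y \<Longrightarrow> C y x"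
  obtains M where "M0 \<subseteq> M" "M \<subseteq> D" "pairwise (\<lambda>x y. \<not> C x y) M" "\<forall>x\<in>D. \<exists>m\<in>M. C m x"
proof -
  let ?\<A> = "{M. M0 \<subseteq> M \<and> M \<subseteq> D \<and> pairwise (\<lambda>x y. \<not> C x y) M}"
  have "\<exists>M\<in>?\<A>. \<forall>X\<in>?\<A>. M \<subseteq> X \<longrightarrow> X = M"
  proof (rule subset_Zorn_nonempty)
    show "?\<A> \<noteq> {}" using M0 by blast
  next
    fix \<C> assume ne: "\<C> \<noteq> {}" and ch: "subset.chain ?\<A> \<C>"
    have sub: "\<C> \<subseteq> ?\<A>" and lin: "\<And>X Y. X \<in> \<C> \<Longrightarrow> Y \<in> \<C> \<Longrightarrow> X \<subseteq> Y \<or> Y \<subseteq> X"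
      using ch unfolding subset_chain_def by blast+
    have "pairwise (\<lambda>x y. \<not> C x y) (\<Union>\<C>)"
    proof (rule pairwiseI)
      fix x y assume "x \<in> \<Union>\<C>" "y \<in> \<Union>\<C>" "x \<noteq> y"
      then obtain X Y where "x \<in> X" "X \<in> \<C>" "y \<in> Y" "Y \<in> \<C>" by blast
      then obtain Z where "Z \<in> \<C>" "x \<in> Z" "y \<in> Z" using lin[of X Y] by blast
      moreover have "pairwise (\<lambda>x y. \<not> C x y) Z" using sub \<open>Z \<in> \<C>\<close> by auto
      ultimately show "\<not> C x y" using \<open>x \<noteq> y\<close> by (simp add: pairwise_def)
    qed
    moreover have "M0 \<subseteq> \<Union>\<C>" using sub ne by auto
    moreover have "\<Union>\<C> \<subseteq> D" using sub by auto
    ultimately show "\<Union>\<C> \<in> ?\<A>" by simp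
  qed
  then obtain M where M: "M0 \<subseteq> M" "M \<subseteq> D" "pairwise (\<lambda>x y. \<not> C x y) M"
    and max: "\<And>X. X \<in> ?\<A> \<Longrightarrow> M \<subseteq> X \<Longrightarrow> X = M" by auto
  have "\<exists>m\<in>M. C m x" if x: "x \<in> D" for x
  proof (rule ccontr)
    assume no: "\<not> (\<exists>m\<in>M. C m x)"
    then have "pairwise (\<lambda>x y. \<not> C x y) (insert x M)"
      using M(3) sym by (auto simp: pairwise_insert)
    then have "insert x M = M" using M x by (intro max) auto
    then show False using no refl[OF x] by blast
  qed
  then show thesis using that M by blast
qed

section \<open>Maximal antichains and compatibility\<close>

definition maximal_antichain :: "'p rel \<Rightarrow> 'p set \<Rightarrow> bool" where
  "maximal_antichain R M \<longleftrightarrow> M \<subseteq> Field R \<and> pairwise (\<lambda>x y. \<not> compatible R x y) M \<and>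
    (\<forall>p\<in>Field R. \<exists>m\<in>M. compatible R m p)"

lemma compatible_sym: "compatible R p q \<Longrightarrow> compatible R q p"
  unfolding compatible_def by blast

lemma compatible_refl: "Preorder R \<Longrightarrow> p \<in> Field R \<Longrightarrow> compatible R p p"
  unfolding compatible_def using Preorder_refl by fast

lemma compatible_mono:
  assumes R: "Preorder R" and "compatible R p q" and pp: "(p, p') \<in> R" and qq: "(q, q') \<in> R"
  shows "compatible R p' q'"
proof -
  obtain x where "(x, p) \<in> R" "(x, q) \<in> R" using assms(2) unfolding compatible_def by blast
  then show ?thesis
    using Preorder_trans[OF R _ pp] Preorder_trans[OF R _ qq] unfolding compatible_def by blast
qed

text \<open>The node \<open>(\<alpha>, s)\<close> stands for the restriction of \<open>s\<close> to \<open>under r \<alpha>\<close>, a sequence of successor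
  length, so the tree is only a preorder. Longer sequences are smaller.\<close>

definition tree :: "'w rel \<Rightarrow> 'l set \<Rightarrow> ('w \<times> ('w \<Rightarrow> 'l)) rel" where
  "tree r \<Lambda> = {((\<alpha>, s), (\<beta>, t)). (\<beta>, \<alpha>) \<in> r \<and> (\<forall>\<gamma>\<in>under r \<beta>. s \<gamma> = t \<gamma>) \<and> range s \<subseteq> \<Lambda> \<and> range t \<subseteq> \<Lambda>}"

context
  fixes r :: "'w rel" assumes r: "Well_order r"
begin

lemma r_refl: "\<alpha> \<in> Field r \<Longrightarrow> (\<alpha>, \<alpha>) \<in> r"
  using r by (auto simp: order_on_defs refl_on_def)

lemma r_trans: "(\<alpha>, \<beta>) \<in> r \<Longrightarrow> (\<beta>, \<gamma>) \<in> r \<Longrightarrow> (\<alpha>, \<gamma>) \<in> r"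
  using r by (auto simp: order_on_defs dest: transD)

lemma r_wf: "wf (r - Id)"
  using r by (auto simp: well_order_on_def)

lemma r_total: "\<alpha> \<in> Field r \<Longrightarrow> \<beta> \<in> Field r \<Longrightarrow> (\<alpha>, \<beta>) \<in> r \<or> (\<beta>, \<alpha>) \<in> r"
  using r r_refl unfolding order_on_defs total_on_def by metis

lemma r_antisym: "(\<alpha>, \<beta>) \<in> r \<Longrightarrow> (\<beta>, \<alpha>) \<in> r \<Longrightarrow> \<alpha> = \<beta>"
  using r by (auto simp: order_on_defs dest: antisymD)

lemma underS_iff: "\<beta> \<in> underS r \<alpha> \<longleftrightarrow> (\<beta>, \<alpha>) \<in> r - Id"
  by (auto simp: underS_def)

lemma underS_Field: "\<beta> \<in> underS r \<alpha> \<Longrightarrow> \<beta> \<in> Field r"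
  unfolding underS_def by (auto intro: FieldI1)

lemma underS_induct [consumes 1, case_names step]:
  assumes "\<alpha> \<in> Field r"
    and "\<And>\<alpha>. \<alpha> \<in> Field r \<Longrightarrow> (\<And>\<beta>. \<beta> \<in> underS r \<alpha> \<Longrightarrow> Q \<beta>) \<Longrightarrow> Q \<alpha>"
  shows "Q \<alpha>"
  using assms(1)
proof (induction \<alpha> rule: wf_induct_rule[OF r_wf])
  case (1 \<alpha>)
  then show ?case using assms(2)[of \<alpha>] underS_iff underS_Field by blast
qed

lemma Field_tree: "Field (tree r \<Lambda>) = {(\<alpha>, s). \<alpha> \<in> Field r \<and> range s \<subseteq> \<Lambda>}" (is "_ = ?B")
proof (intro equalityI subsetI)
  fix x assume "x \<in> Field (tree r \<Lambda>)"
  then show "x \<in> ?B"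
    unfolding Field_def tree_def by blast
next
  fix x assume "x \<in> ?B"
  then have "(x, x) \<in> tree r \<Lambda>" unfolding tree_def by (auto intro: r_refl)
  then show "x \<in> Field (tree r \<Lambda>)" by (rule FieldI1)
qed

lemma Preorder_tree: "Preorder (tree r \<Lambda>)"
  unfolding order_on_defs refl_on_def
proof (intro conjI ballI)
  show "tree r \<Lambda> \<subseteq> Field (tree r \<Lambda>) \<times> Field (tree r \<Lambda>)" by (auto intro: FieldI1 FieldI2)
  show "(x, x) \<in> tree r \<Lambda>" if "x \<in> Field (tree r \<Lambda>)" for x
    using that r_refl unfolding Field_tree by (auto simp: tree_def)
  show "trans (tree r \<Lambda>)"
  proof (rule transI)
    fix x y z assume "(x, y) \<in> tree r \<Lambda>" "(y, z) \<in> tree r \<Lambda>"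
    then show "(x, z) \<in> tree r \<Lambda>"
      unfolding tree_def under_def by (auto intro: r_trans)
  qed
qed

end

text \<open>Labels number the successors of a branch: \<open>L\<close> will be the set of lower
  bounds of the branch so far, and \<open>A\<close> the antichain that the current level of the tree
  must refine.\<close>

definition enumerates :: "'p rel \<Rightarrow> 'l set \<Rightarrow> 'p set \<Rightarrow> 'p set \<Rightarrow> ('l \<Rightarrow> 'p) \<Rightarrow> bool" where
  "enumerates R \<Lambda> A L e \<longleftrightarrow> inj_on e \<Lambda> \<and> pairwise (\<lambda>x y. \<not> compatible R x y) (e ` \<Lambda>) \<and>
    (\<forall>x\<in>\<Lambda>. e x \<in> L \<and> (\<exists>a\<in>A. (e x, a) \<in> R)) \<and> (\<forall>q\<in>L. \<exists>x\<in>\<Lambda>. compatible R (e x) q)"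

lemma enumeratesD:
  assumes "enumerates R \<Lambda> A L e"
  shows "x \<in> \<Lambda> \<Longrightarrow> y \<in> \<Lambda> \<Longrightarrow> x \<noteq> y \<Longrightarrow> \<not> compatible R (e x) (e y)"
    and "x \<in> \<Lambda> \<Longrightarrow> e x \<in> L"
    and "x \<in> \<Lambda> \<Longrightarrow> \<exists>a\<in>A. (e x, a) \<in> R"
    and "q \<in> L \<Longrightarrow> \<exists>x\<in>\<Lambda>. compatible R (e x) q"
  using assms unfolding enumerates_def pairwise_def inj_on_def by (metis imageI, simp_all)

text \<open>The conditions of \<open>L\<close> below members of \<open>A\<close> are dense in
  \<open>L\<close>. An antichain among them, chosen of size at least \<Lambda> and then made
  maximal, has size exactly \<Lambda> since \<open>Field R\<close> is no larger, so \<Lambda> can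
  index it.\<close>

lemma antichain_enumeration:
  assumes R: "Preorder R" and card: "|Field R| \<le>o |\<Lambda>|"
    and large: "\<And>p. p \<in> Field R \<Longrightarrow>
      \<exists>M. (\<forall>m\<in>M. (m, p) \<in> R) \<and> pairwise (\<lambda>x y. \<not> compatible R x y) M \<and> |\<Lambda>| \<le>o |M|"
    and A: "maximal_antichain R A"
    and L: "L \<subseteq> Field R" "L \<noteq> {}" "\<And>p q. q \<in> L \<Longrightarrow> (p, q) \<in> R \<Longrightarrow> p \<in> L"
  shows "\<exists>e. enumerates R \<Lambda> A L e"
proof -
  define D where "D = {q\<in>L. \<exists>a\<in>A. (q, a) \<in> R}"
  have into: "\<exists>d\<in>D. (d, q) \<in> R" if q: "q \<in> L" for q
  proof -
    obtain a d where "a \<in> A" "(d, a) \<in> R" "(d, q) \<in> R"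
      using A q L(1) unfolding maximal_antichain_def compatible_def by blast
    then show ?thesis using L(3)[OF q] unfolding D_def by blast
  qed
  then obtain q where q: "q \<in> D" using L(2) by blast
  have down: "p \<in> D" if "(p, q) \<in> R" "q \<in> D" for p q
    using that L(3) Preorder_trans[OF R that(1)] unfolding D_def by blast
  have DF: "D \<subseteq> Field R" using L(1) D_def by blast
  obtain M0 where M0: "\<forall>m\<in>M0. (m, q) \<in> R" "pairwise (\<lambda>x y. \<not> compatible R x y) M0" "|\<Lambda>| \<le>o |M0|"
    using large[of q] q DF by blast
  have sub: "M0 \<subseteq> D" using M0(1) down q by blast
  have crefl: "compatible R x x" if "x \<in> D" for x using compatible_refl[OF R] that DF by blast
  obtain M where M: "M0 \<subseteq> M" "M \<subseteq> D" "pairwise (\<lambda>x y. \<not> compatible R x y) M"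
    "\<forall>x\<in>D. \<exists>m\<in>M. compatible R m x"
    by (rule extend_to_maximal[OF sub M0(2) crefl compatible_sym])
  have "|M| \<le>o |\<Lambda>|" using card_of_mono1[of M "Field R"] M(2) DF card ordLeq_transitive by blast
  moreover have "|\<Lambda>| \<le>o |M|" using M0(3) card_of_mono1[OF M(1)] ordLeq_transitive by blast
  ultimately have "|\<Lambda>| =o |M|" by (simp add: ordIso_iff_ordLeq)
  then obtain e where e: "bij_betw e \<Lambda> M" using card_of_ordIso by blast
  have im: "e ` \<Lambda> = M" using e by (simp add: bij_betw_def)
  have "\<exists>x\<in>\<Lambda>. compatible R (e x) q" if q: "q \<in> L" for q
  proof -
    obtain d where "d \<in> D" "(d, q) \<in> R" using into[OF q] by blast
    then obtain m where "m \<in> M" "compatible R m d" using M(4) by blast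
    then have "compatible R m q"
      using \<open>(d, q) \<in> R\<close> compatible_mono[OF R] Preorder_refl[OF R] M(2) DF by blast
    then show ?thesis using \<open>m \<in> M\<close> im by blast
  qed
  moreover have "e x \<in> L \<and> (\<exists>a\<in>A. (e x, a) \<in> R)" if "x \<in> \<Lambda>" for x
    using that im M(2) unfolding D_def by blast
  ultimately show ?thesis using e M(3) im unfolding enumerates_def bij_betw_def by metis
qed

text \<open>Each branch is continued by a maximal antichain of its lower bounds, which
  \<open>closed\<close> provides even at limits. Different labels give incompatible conditions, and
  density comes from level \<alpha> refining \<open>A \<alpha>\<close>.\<close>

theorem tree_dense_embedding:
  fixes R :: "'p rel" and r :: "'w rel" and \<Lambda> :: "'l set"
  assumes R: "Preorder R" and r: "Well_order r" and card: "|Field R| \<le>o |\<Lambda>|"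
    and large: "\<And>p. p \<in> Field R \<Longrightarrow>
      \<exists>M. (\<forall>m\<in>M. (m, p) \<in> R) \<and> pairwise (\<lambda>x y. \<not> compatible R x y) M \<and> |\<Lambda>| \<le>o |M|"
    and closed: "\<And>\<alpha> x. \<alpha> \<in> Field r \<Longrightarrow> (\<And>\<beta>. \<beta> \<in> underS r \<alpha> \<Longrightarrow> x \<beta> \<in> Field R) \<Longrightarrow>
      (\<And>\<beta> \<gamma>. \<beta> \<in> underS r \<alpha> \<Longrightarrow> \<gamma> \<in> underS r \<beta> \<Longrightarrow> (x \<beta>, x \<gamma>) \<in> R) \<Longrightarrow>
      \<exists>p\<in>Field R. \<forall>\<beta>\<in>underS r \<alpha>. (p, x \<beta>) \<in> R"
    and A: "\<And>\<alpha>. \<alpha> \<in> Field r \<Longrightarrow> maximal_antichain R (A \<alpha>)"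
    and A_dense: "\<And>p. p \<in> Field R \<Longrightarrow> \<exists>\<alpha>\<in>Field r. \<exists>a\<in>A \<alpha>. (a, p) \<in> R"
  shows "\<exists>i. dense_embedding (tree r \<Lambda>) R i"
proof -
  note wf = r_wf[OF r]
  define good where "good L \<longleftrightarrow> L \<subseteq> Field R \<and> L \<noteq> {} \<and> (\<forall>p q. q \<in> L \<longrightarrow> (p, q) \<in> R \<longrightarrow> p \<in> L)" for L
  have "\<exists>e. \<alpha> \<in> Field r \<and> good L \<longrightarrow> enumerates R \<Lambda> (A \<alpha>) L e" for \<alpha> L
    using antichain_enumeration[OF R card large A, of \<alpha> L] unfolding good_def by metis
  \<comment> \<open>The enumeration is fixed once for each level and each set of lower bounds, so
    branches with the same initial part are continued by the same antichain.\<close>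
  then obtain E where E: "\<And>\<alpha> L. \<alpha> \<in> Field r \<Longrightarrow> good L \<Longrightarrow> enumerates R \<Lambda> (A \<alpha>) L (E \<alpha> L)"
    by metis
  \<comment> \<open>Recursion along \<open>r\<close>: the value at \<alpha> is the member labelled
    \<open>s \<alpha>\<close> of the antichain chosen among the lower bounds of the earlier
    values.\<close>
  define step where "step s f \<alpha> = E \<alpha> {q\<in>Field R. \<forall>\<beta>\<in>underS r \<alpha>. (q, f \<beta>) \<in> R} (s \<alpha>)"
    for s :: "'w \<Rightarrow> 'l" and f \<alpha>
  define F where "F s = wfrec (r - Id) (step s)" for s
  define L where "L s \<alpha> = {q\<in>Field R. \<forall>\<beta>\<in>underS r \<alpha>. (q, F s \<beta>) \<in> R}" for s \<alpha>
  have F: "F s \<alpha> = E \<alpha> (L s \<alpha>) (s \<alpha>)" for s \<alpha>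
  proof -
    have "F s \<alpha> = step s (cut (F s) (r - Id) \<alpha>) \<alpha>"
      unfolding F_def by (rule wfrec[OF wf])
    moreover have "cut (F s) (r - Id) \<alpha> \<beta> = F s \<beta>" if "\<beta> \<in> underS r \<alpha>" for \<beta>
      using that cut_apply[of \<beta> \<alpha> "r - Id" "F s"] unfolding underS_iff[OF r] by blast
    then have "{q\<in>Field R. \<forall>\<beta>\<in>underS r \<alpha>. (q, cut (F s) (r - Id) \<alpha> \<beta>) \<in> R} = L s \<alpha>"
      unfolding L_def by simp
    ultimately show ?thesis unfolding step_def by simp
  qed
  have L_sub: "L s \<alpha> \<subseteq> Field R" for s \<alpha> unfolding L_def by blast
  have L_cong: "L s \<alpha> = L t \<alpha>" if "\<And>\<beta>. \<beta> \<in> underS r \<alpha> \<Longrightarrow> F s \<beta> = F t \<beta>" for s t \<alpha>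
    using that unfolding L_def by simp
  \<comment> \<open>Values depend only on the labels up to \<alpha>, so the map respects the tree
    preorder, which ignores the later ones.\<close>
  have F_cong: "F s \<alpha> = F t \<alpha>" if "\<alpha> \<in> Field r" "\<And>\<beta>. \<beta> \<in> under r \<alpha> \<Longrightarrow> s \<beta> = t \<beta>" for s t \<alpha>
    using that
  proof (induction \<alpha> rule: underS_induct[OF r, consumes 1])
    case (1 \<alpha>)
    have "F s \<beta> = F t \<beta>" if "\<beta> \<in> underS r \<alpha>" for \<beta>
    proof (rule 1(2)[OF that])
      fix \<gamma> assume "\<gamma> \<in> under r \<beta>"
      then show "s \<gamma> = t \<gamma>" using that 1(3) r_trans[OF r] unfolding under_def underS_def by blast
    qed
    then have "L s \<alpha> = L t \<alpha>" by (rule L_cong)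
    moreover have "s \<alpha> = t \<alpha>" using 1 r_refl[OF r] unfolding under_def by blast
    ultimately show ?case unfolding F[of s] F[of t] by simp
  qed
  have good_F: "good (L s \<alpha>) \<and> F s \<alpha> \<in> L s \<alpha>" if "\<alpha> \<in> Field r" and s: "range s \<subseteq> \<Lambda>" for s \<alpha>
    using that(1)
  proof (induction \<alpha> rule: underS_induct[OF r, consumes 1])
    case (1 \<alpha>)
    have "\<exists>p\<in>Field R. \<forall>\<beta>\<in>underS r \<alpha>. (p, F s \<beta>) \<in> R"
    proof (rule closed[OF 1(1)])
      show "F s \<beta> \<in> Field R" if "\<beta> \<in> underS r \<alpha>" for \<beta> using 1(2)[OF that] L_sub by blast
      show "(F s \<beta>, F s \<gamma>) \<in> R" if "\<beta> \<in> underS r \<alpha>" "\<gamma> \<in> underS r \<beta>" for \<beta> \<gamma>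
        using 1(2)[OF that(1)] that(2) unfolding L_def by blast
    qed
    then have "L s \<alpha> \<noteq> {}" unfolding L_def by blast
    moreover have "p \<in> L s \<alpha>" if "q \<in> L s \<alpha>" "(p, q) \<in> R" for p q
      using that Preorder_trans[OF R that(2)] FieldI1[OF that(2)] unfolding L_def by blast
    ultimately have "good (L s \<alpha>)" unfolding good_def using L_sub by blast
    moreover have "s \<alpha> \<in> \<Lambda>" using s by blast
    ultimately show ?case using enumeratesD(2)[OF E[OF 1(1)]] unfolding F[of s \<alpha>] by blast
  qed
  have F_mono: "(F s \<alpha>, F s \<beta>) \<in> R" if "(\<beta>, \<alpha>) \<in> r" "range s \<subseteq> \<Lambda>" for s \<alpha> \<beta>
  proof (cases "\<alpha> = \<beta>")
    case True
    then show ?thesis using good_F[OF FieldI2[OF that(1)] that(2)] L_sub Preorder_refl[OF R] by blast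
  next
    case False
    then have "\<beta> \<in> underS r \<alpha>" using that unfolding underS_def by blast
    then show ?thesis using good_F[OF FieldI2[OF that(1)] that(2)] unfolding L_def by blast
  qed
  \<comment> \<open>At the first place where two sequences differ, the sets of lower bounds still
    coincide, so the two values are distinct members of one antichain.\<close>
  have F_incomp: "\<not> compatible R (F s \<gamma>) (F t \<gamma>)"
    if "\<gamma> \<in> Field r" "range s \<subseteq> \<Lambda>" "range t \<subseteq> \<Lambda>" "s \<gamma> \<noteq> t \<gamma>"
      "\<And>\<delta>. \<delta> \<in> underS r \<gamma> \<Longrightarrow> s \<delta> = t \<delta>" for s t \<gamma>
  proof -
    have L: "L s \<gamma> = L t \<gamma>"
    proof (rule L_cong, rule F_cong)
      fix \<beta> \<delta> assume "\<beta> \<in> underS r \<gamma>" "\<delta> \<in> under r \<beta>"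
      then have "\<delta> \<in> underS r \<gamma>"
        using r_trans[OF r] r_antisym[OF r] unfolding under_def underS_def by blast
      then show "s \<delta> = t \<delta>" using that(5) by blast
    qed (rule underS_Field[OF r])
    have g: "good (L t \<gamma>)" using good_F that by blast
    have "s \<gamma> \<in> \<Lambda>" "t \<gamma> \<in> \<Lambda>" using that by blast+
    then show ?thesis
      using enumeratesD(1)[OF E[OF that(1) g]] that(4) unfolding F[of s] F[of t] L by blast
  qed
  define i where "i = (\<lambda>(\<alpha>, s). F s \<alpha>)"
  have "dense_embedding (tree r \<Lambda>) R i"
    unfolding dense_embedding_def
  proof (intro conjI allI impI ballI)
    show "i ` Field (tree r \<Lambda>) \<subseteq> Field R"
    proof
      fix p assume "p \<in> i ` Field (tree r \<Lambda>)"
      then obtain \<alpha> s where p: "p = F s \<alpha>" "\<alpha> \<in> Field r" "range s \<subseteq> \<Lambda>"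
        unfolding i_def Field_tree[OF r] by auto
      then show "p \<in> Field R" using good_F[OF p(2,3)] L_sub by blast
    qed
  next
    fix x y assume "(x, y) \<in> tree r \<Lambda>"
    moreover obtain \<alpha> s \<beta> t where eq: "x = (\<alpha>, s)" "y = (\<beta>, t)" by (metis surj_pair)
    ultimately have xy: "x = (\<alpha>, s)" "y = (\<beta>, t)" "(\<beta>, \<alpha>) \<in> r"
      "\<And>\<gamma>. \<gamma> \<in> under r \<beta> \<Longrightarrow> s \<gamma> = t \<gamma>" "range s \<subseteq> \<Lambda>" unfolding tree_def by simp_all
    show "(i x, i y) \<in> R"
      using F_mono[OF xy(3,5)] F_cong[OF FieldI1[OF xy(3)], of s t] xy(4) unfolding i_def xy(1,2) by simp
  next
    fix x y assume x: "x \<in> Field (tree r \<Lambda>)" and y: "y \<in> Field (tree r \<Lambda>)"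
      and c: "compatible R (i x) (i y)"
    obtain \<alpha> s \<beta> t where xy: "x = (\<alpha>, s)" "y = (\<beta>, t)" "\<alpha> \<in> Field r" "\<beta> \<in> Field r"
      "range s \<subseteq> \<Lambda>" "range t \<subseteq> \<Lambda>" using x y unfolding Field_tree[OF r] by auto
    have agree: "s \<gamma> = t \<gamma>" if "(\<gamma>, \<alpha>) \<in> r" "(\<gamma>, \<beta>) \<in> r" for \<gamma>
    proof (rule ccontr)
      assume "s \<gamma> \<noteq> t \<gamma>"
      define D where "D = {\<gamma>. (\<gamma>, \<alpha>) \<in> r \<and> (\<gamma>, \<beta>) \<in> r \<and> s \<gamma> \<noteq> t \<gamma>}"
      have "\<gamma> \<in> D" using that \<open>s \<gamma> \<noteq> t \<gamma>\<close> unfolding D_def by blast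
      then obtain \<delta> where "\<delta> \<in> D" and min: "\<And>\<epsilon>. (\<epsilon>, \<delta>) \<in> r - Id \<Longrightarrow> \<epsilon> \<notin> D"
        using wfE_min[OF wf] by metis
      then have \<delta>: "(\<delta>, \<alpha>) \<in> r" "(\<delta>, \<beta>) \<in> r" "s \<delta> \<noteq> t \<delta>" unfolding D_def by simp_all
      have "s \<epsilon> = t \<epsilon>" if "\<epsilon> \<in> underS r \<delta>" for \<epsilon>
        using min[of \<epsilon>] that r_trans[OF r _ \<delta>(1)] r_trans[OF r _ \<delta>(2)]
        unfolding underS_iff[OF r] D_def by blast
      then have "\<not> compatible R (F s \<delta>) (F t \<delta>)" using F_incomp[OF FieldI1[OF \<delta>(1)] xy(5,6) \<delta>(3)] by blast
      moreover have "compatible R (F s \<delta>) (F t \<delta>)"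
        using compatible_mono[OF R _ F_mono[OF \<delta>(1) xy(5)] F_mono[OF \<delta>(2) xy(6)]] c xy
        unfolding i_def by simp
      ultimately show False by blast
    qed
    show "compatible (tree r \<Lambda>) x y"
    proof (cases "(\<alpha>, \<beta>) \<in> r")
      case True
      then have "(y, x) \<in> tree r \<Lambda>" "(y, y) \<in> tree r \<Lambda>"
        using agree r_trans[OF r] r_refl[OF r] xy unfolding tree_def under_def by auto
      then show ?thesis unfolding compatible_def by blast
    next
      case False
      then have "(\<beta>, \<alpha>) \<in> r" using r_total[OF r] xy by blast
      then have "(x, x) \<in> tree r \<Lambda>" "(x, y) \<in> tree r \<Lambda>"
        using agree r_trans[OF r] r_refl[OF r] xy unfolding tree_def under_def by auto
      then show ?thesis unfolding compatible_def by blast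
    qed
  next
    \<comment> \<open>For density, choose \<open>a\<close> in some \<open>A \<alpha>\<close> below
      \<open>q\<close> and build a branch whose values up to level \<alpha> stay compatible with
      \<open>a\<close>.\<close>
    fix q assume q: "q \<in> Field R"
    then obtain \<alpha> a where a: "\<alpha> \<in> Field r" "a \<in> A \<alpha>" "(a, q) \<in> R" using A_dense by blast
    have aF: "a \<in> Field R" using a(3) by (rule FieldI1)
    have "\<Lambda> \<noteq> {}" using card q by (metis card_of_empty3 empty_iff)
    then obtain l0 where l0: "l0 \<in> \<Lambda>" by blast
    \<comment> \<open>The default label \<open>l0\<close> turns any sequence of choices into a total
      function into \<Lambda>, as the nodes of the tree require.\<close>
    define lab where "lab f = (\<lambda>\<delta>. if snd (f \<delta>) \<in> \<Lambda> then snd (f \<delta>) else l0)" for f :: "'w \<Rightarrow> 'p \<times> 'l"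
    have lab: "range (lab f) \<subseteq> \<Lambda>" for f using l0 unfolding lab_def by auto
    \<comment> \<open>A choice consists of a condition and a label. The conditions decrease below
      \<open>a\<close>, and each lies under the value of the branch at its level, which witnesses
      compatibility with \<open>a\<close>.\<close>
    define \<Phi> where "\<Phi> f \<beta> y \<longleftrightarrow> (\<beta> \<in> Field r \<longrightarrow> snd y \<in> \<Lambda> \<and> (fst y, a) \<in> R \<and>
      (\<forall>\<gamma>\<in>underS r \<beta>. (fst y, fst (f \<gamma>)) \<in> R) \<and> (fst y, E \<beta> (L (lab f) \<beta>) (snd y)) \<in> R)"
      for f \<beta> y
    have "\<exists>f. \<forall>\<beta>. \<Phi> f \<beta> (f \<beta>)"
    proof (rule dependent_wf_choice[OF wf])
      fix f g :: "'w \<Rightarrow> 'p \<times> 'l" and \<beta> y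
      assume eq: "\<And>z. (z, \<beta>) \<in> r - Id \<Longrightarrow> f z = g z"
      have "L (lab f) \<beta> = L (lab g) \<beta>"
      proof (rule L_cong, rule F_cong)
        fix \<gamma> \<delta> assume "\<gamma> \<in> underS r \<beta>" "\<delta> \<in> under r \<gamma>"
        then have "\<delta> \<in> underS r \<beta>"
          using r_trans[OF r] r_antisym[OF r] unfolding under_def underS_def by blast
        then show "lab f \<delta> = lab g \<delta>" using eq unfolding lab_def underS_iff[OF r] by simp
      qed (rule underS_Field[OF r])
      moreover have "f \<gamma> = g \<gamma>" if "\<gamma> \<in> underS r \<beta>" for \<gamma> using eq that underS_iff[OF r] by blast
      ultimately show "\<Phi> f \<beta> y = \<Phi> g \<beta> y" unfolding \<Phi>_def by simp
    next
      fix \<beta> and f :: "'w \<Rightarrow> 'p \<times> 'l"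
      assume "\<And>\<gamma>. (\<gamma>, \<beta>) \<in> r - Id \<Longrightarrow> \<Phi> f \<gamma> (f \<gamma>)"
      then have \<Phi>: "\<Phi> f \<gamma> (f \<gamma>)" if "\<gamma> \<in> underS r \<beta>" for \<gamma> using that underS_iff[OF r] by blast
      have IH: "snd (f \<gamma>) \<in> \<Lambda>" "(fst (f \<gamma>), a) \<in> R" "\<And>\<delta>. \<delta> \<in> underS r \<gamma> \<Longrightarrow> (fst (f \<gamma>), fst (f \<delta>)) \<in> R"
        "(fst (f \<gamma>), F (lab f) \<gamma>) \<in> R" if "\<gamma> \<in> underS r \<beta>" for \<gamma>
        using \<Phi>[OF that] underS_Field[OF r that] unfolding \<Phi>_def F[of _ \<gamma>] by (auto simp: lab_def)
      show "\<exists>y. \<Phi> f \<beta> y"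
      proof (cases "\<beta> \<in> Field r")
        case True
        obtain p where p: "p \<in> Field R" "(p, a) \<in> R" "\<And>\<gamma>. \<gamma> \<in> underS r \<beta> \<Longrightarrow> (p, fst (f \<gamma>)) \<in> R"
        \<comment> \<open>With no predecessors \<open>closed\<close> says nothing about
          \<open>a\<close>, so \<open>a\<close> itself starts the sequence; otherwise a bound of the
          earlier conditions is below \<open>a\<close> already.\<close>
        proof (cases "underS r \<beta> = {}")
          case True
          then show thesis using that[of a] aF Preorder_refl[OF R aF] by blast
        next
          case False
          have "\<exists>p\<in>Field R. \<forall>\<gamma>\<in>underS r \<beta>. (p, fst (f \<gamma>)) \<in> R"
            using IH FieldI1[OF IH(2)] by (intro closed[OF True]) blast+
          then show thesis using that False IH(2) Preorder_trans[OF R] by (metis equals0I)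
        qed
        have "p \<in> L (lab f) \<beta>"
          using p(1) Preorder_trans[OF R p(3) IH(4)] unfolding L_def by blast
        then obtain x where x: "x \<in> \<Lambda>" "compatible R (E \<beta> (L (lab f) \<beta>) x) p"
          using enumeratesD(4)[OF E[OF True]] good_F[OF True lab] by blast
        then obtain p' where p': "(p', E \<beta> (L (lab f) \<beta>) x) \<in> R" "(p', p) \<in> R"
          unfolding compatible_def by blast
        then have "\<Phi> f \<beta> (p', x)"
          using x(1) Preorder_trans[OF R p'(2)] p(2,3) unfolding \<Phi>_def by simp
        then show ?thesis ..
      qed (simp add: \<Phi>_def)
    qed
    then obtain f where f: "\<Phi> f \<alpha> (f \<alpha>)" by blast
    define s where "s = lab f"
    have s: "range s \<subseteq> \<Lambda>" unfolding s_def by (rule lab)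
    have le: "(fst (f \<alpha>), a) \<in> R" "(fst (f \<alpha>), F s \<alpha>) \<in> R"
      using f a(1) unfolding \<Phi>_def s_def F[of _ \<alpha>] by (auto simp: lab_def)
    have "s \<alpha> \<in> \<Lambda>" using s by blast
    \<comment> \<open>The value at level \<alpha> lies below some \<open>a'\<close> in
      \<open>A \<alpha>\<close> and is compatible with \<open>a\<close>; in an antichain this forces
      \<open>a' = a\<close>.\<close>
    then obtain a' where a': "a' \<in> A \<alpha>" "(F s \<alpha>, a') \<in> R"
      using enumeratesD(3)[OF E[OF a(1)]] good_F[OF a(1) s] unfolding F[of s \<alpha>] by blast
    have "compatible R a a'" using le Preorder_trans[OF R le(2) a'(2)] unfolding compatible_def by blast
    then have "a = a'" using A[OF a(1)] a(2) a'(1) unfolding maximal_antichain_def pairwise_def by blast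
    then have "(F s \<alpha>, q) \<in> R" using Preorder_trans[OF R a'(2)] a(3) by blast
    then show "\<exists>t\<in>Field (tree r \<Lambda>). (i t, q) \<in> R"
      using s a(1) unfolding Field_tree[OF r] i_def by (intro bexI[of _ "(\<alpha>, s)"]) auto
  qed
  then show ?thesis by blast
qed

section \<open>Small sets\<close>

definition small :: "'k rel \<Rightarrow> 'b set \<Rightarrow> bool" where
  "small \<kappa> A \<longleftrightarrow> |A| <o \<kappa>"

text \<open>\<open>Q\<close> is placed inside \<open>Field \<kappa>\<close> by \<open>g\<close> and
  treated in that order: before each step fewer than \<kappa> values have been used, so
  \<open>S q\<close> still offers a new one.\<close>

lemma injective_choice:
  fixes \<kappa> :: "'k rel" and S :: "'q \<Rightarrow> 's set"
  assumes \<kappa>: "Card_order \<kappa>" and Q: "|Q| \<le>o \<kappa>" and S: "\<And>q. q \<in> Q \<Longrightarrow> \<kappa> \<le>o |S q|"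
  obtains c where "inj_on c Q" "\<And>q. q \<in> Q \<Longrightarrow> c q \<in> S q"
proof -
  have wo: "Well_order \<kappa>" using \<kappa> by (simp add: card_order_on_def)
  have "|Q| \<le>o |Field \<kappa>|"
    using Q card_of_Field_ordIso[OF \<kappa>] ordIso_symmetric ordLeq_ordIso_trans by blast
  then obtain g where g: "inj_on g Q" "g ` Q \<subseteq> Field \<kappa>" using card_of_ordLeq by metis
  define \<Phi> where "\<Phi> f \<xi> y \<longleftrightarrow> (\<forall>q\<in>Q. g q = \<xi> \<longrightarrow> y \<in> S q \<and> y \<notin> f ` underS \<kappa> \<xi>)"
    for f :: "'k \<Rightarrow> 's" and \<xi> y
  have "\<exists>f. \<forall>\<xi>. \<Phi> f \<xi> (f \<xi>)"
  proof (rule dependent_wf_choice[OF r_wf[OF wo]])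
    fix f f' :: "'k \<Rightarrow> 's" and \<xi> y assume eq: "\<And>z. (z, \<xi>) \<in> \<kappa> - Id \<Longrightarrow> f z = f' z"
    have "f ` underS \<kappa> \<xi> = f' ` underS \<kappa> \<xi>"
      using eq underS_iff[OF wo] by (intro image_cong) auto
    then show "\<Phi> f \<xi> y = \<Phi> f' \<xi> y" unfolding \<Phi>_def by simp
  next
    fix \<xi> and f :: "'k \<Rightarrow> 's"
    show "\<exists>y. \<Phi> f \<xi> y"
    proof (cases "\<xi> \<in> g ` Q")
      case True
      then obtain q where q: "q \<in> Q" "\<xi> = g q" by blast
      have "|f ` underS \<kappa> \<xi>| <o |S q|"
        using card_of_image[of f "underS \<kappa> \<xi>"] card_of_underS[OF \<kappa>, of \<xi>] S[OF q(1)] q g(2)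
        by (meson image_eqI ordLeq_ordLess_trans ordLess_ordLeq_trans subsetD)
      then have "\<not> S q \<subseteq> f ` underS \<kappa> \<xi>" using card_of_mono1 not_ordLess_ordLeq by blast
      then obtain y where "y \<in> S q" "y \<notin> f ` underS \<kappa> \<xi>" by blast
      moreover have "q' = q" if "q' \<in> Q" "g q' = \<xi>" for q'
        using that q g(1) by (auto dest: inj_onD)
      ultimately show ?thesis unfolding \<Phi>_def by blast
    qed (auto simp: \<Phi>_def)
  qed
  then obtain f where f: "\<And>\<xi>. \<Phi> f \<xi> (f \<xi>)" by blast
  have neq: "f (g q) \<noteq> f (g q')" if "q' \<in> Q" "g q \<in> underS \<kappa> (g q')" for q q'
    using f[of "g q'"] that unfolding \<Phi>_def by (metis imageI)
  have "inj_on (\<lambda>q. f (g q)) Q"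
  proof (rule inj_onI, rule ccontr)
    fix q q' assume q: "q \<in> Q" "q' \<in> Q" "f (g q) = f (g q')" "q \<noteq> q'"
    then have "g q \<noteq> g q'" using g(1) by (auto dest: inj_onD)
    moreover have "g q \<in> Field \<kappa>" "g q' \<in> Field \<kappa>" using q g(2) by blast+
    ultimately have "g q \<in> underS \<kappa> (g q') \<or> g q' \<in> underS \<kappa> (g q)"
      using r_total[OF wo] unfolding underS_def by auto
    then show False using neq[of q' q] neq[of q q'] q by auto
  qed
  moreover have "f (g q) \<in> S q" if "q \<in> Q" for q using f[of "g q"] that unfolding \<Phi>_def by blast
  ultimately show thesis using that by blast
qed

text \<open>A bijection between \<open>B <+> B\<close> and \<open>B\<close> transports the two
  summands to the two halves.\<close>

lemma infinite_split:
  assumes "infinite B"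
  obtains S where "S \<subseteq> B" "|S| =o |B|" "|B - S| =o |B|"
proof -
  have "|B <+> B| =o |B|" using card_of_Plus_infinite[OF assms] card_of_refl ordIso_imp_ordLeq by blast
  then obtain h where h: "bij_betw h (B <+> B) B" using card_of_ordIso by blast
  define S where "S = h ` (Inl ` B)"
  have inj: "inj_on h (B <+> B)" and im: "h ` (B <+> B) = B" using h by (auto simp: bij_betw_def)
  have "B <+> B - Inl ` B = Inr ` B" by auto
  moreover have "h ` (B <+> B - Inl ` B) = h ` (B <+> B) - h ` Inl ` B"
    by (rule inj_on_image_set_diff[OF inj]) auto
  ultimately have "B - S = h ` (Inr ` B)" using im unfolding S_def by simp
  moreover have "bij_betw (h \<circ> Inl) B S" "bij_betw (h \<circ> Inr) B (h ` (Inr ` B))"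
    using inj unfolding bij_betw_def S_def by (auto simp: inj_on_def)
  ultimately have "|S| =o |B|" "|B - S| =o |B|"
    using card_of_ordIso[of B S] card_of_ordIso[of B "B - S"] ordIso_symmetric by auto
  moreover have "S \<subseteq> B" using im unfolding S_def by auto
  ultimately show thesis using that by blast
qed

section \<open>Smallness relative to an infinite cardinal\<close>

locale infinite_cardinal =
  fixes \<kappa> :: "'a rel"
  assumes Cinf: "Cinfinite \<kappa>"
begin

lemma card: "Card_order \<kappa>" and wo: "Well_order \<kappa>"
  using Cinf by (auto simp: card_order_on_def)

lemma small_subset: "small \<kappa> B \<Longrightarrow> A \<subseteq> B \<Longrightarrow> small \<kappa> A"
  unfolding small_def using card_of_mono1 ordLeq_ordLess_trans by blast

lemma small_Un: "small \<kappa> A \<Longrightarrow> small \<kappa> B \<Longrightarrow> small \<kappa> (A \<union> B)"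
  unfolding small_def using Un_Cinfinite_bound_strict Cinf by blast

lemma small_image: "small \<kappa> A \<Longrightarrow> small \<kappa> (f ` A)"
  unfolding small_def using card_of_image ordLeq_ordLess_trans by blast

lemma small_finite: "finite A \<Longrightarrow> small \<kappa> A"
  unfolding small_def using natLeq_ordLeq_cinfinite[OF Cinf] finite_iff_ordLess_natLeq
    ordLess_ordLeq_trans by blast

lemma not_small_iff: "\<not> small \<kappa> A \<longleftrightarrow> \<kappa> \<le>o |A|"
  unfolding small_def using not_ordLess_iff_ordLeq[OF wo card_of_Well_order, of A] by blast

lemma not_small_Field: "\<not> small \<kappa> (Field \<kappa>)"
  unfolding not_small_iff using card_of_Field_ordIso[OF card] ordIso_symmetric ordIso_ordLeq_trans
    ordIso_imp_ordLeq by blast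

lemma small_inj: "inj_on f A \<Longrightarrow> small \<kappa> (f ` A) \<longleftrightarrow> small \<kappa> A"
  using small_image[of A f] small_image[of "f ` A" "inv_into A f"] by (auto simp: inv_into_image_cancel)

lemma small_under: "\<eta> \<in> Field \<kappa> \<Longrightarrow> small \<kappa> (under \<kappa> \<eta>)"
proof -
  assume \<eta>: "\<eta> \<in> Field \<kappa>"
  have "under \<kappa> \<eta> \<subseteq> underS \<kappa> \<eta> \<union> {\<eta>}" by (auto simp: under_def underS_def)
  moreover have "small \<kappa> (underS \<kappa> \<eta>)" using card_of_underS[OF card \<eta>] by (simp add: small_def)
  ultimately show ?thesis using small_subset small_Un small_finite[of "{\<eta>}"] by blast
qed

text \<open>Take distinct points, one from each \<open>S \<xi>\<close>. If the sets after \<eta>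
  avoid \<open>T\<close>, only points chosen at stages up to \<eta> can lie in \<open>T\<close>, and
  these are fewer than \<kappa>.\<close>

lemma diagonal:
  assumes S: "\<And>\<xi>. \<xi> \<in> Field \<kappa> \<Longrightarrow> \<not> small \<kappa> (S \<xi>)"
  obtains b where "\<not> small \<kappa> b" "b \<subseteq> (\<Union>\<xi>\<in>Field \<kappa>. S \<xi>)"
    "\<And>\<eta> T. \<eta> \<in> Field \<kappa> \<Longrightarrow> (\<And>\<xi>. \<xi> \<in> Field \<kappa> \<Longrightarrow> \<xi> \<notin> under \<kappa> \<eta> \<Longrightarrow> S \<xi> \<inter> T = {}) \<Longrightarrow> small \<kappa> (b \<inter> T)"
proof -
  have "|Field \<kappa>| \<le>o \<kappa>" using card_of_Field_ordIso[OF card] ordIso_imp_ordLeq by blast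
  then obtain c where c: "inj_on c (Field \<kappa>)" "\<And>\<xi>. \<xi> \<in> Field \<kappa> \<Longrightarrow> c \<xi> \<in> S \<xi>"
    using injective_choice[OF card, of "Field \<kappa>" S] S unfolding not_small_iff by blast
  have "small \<kappa> (c ` Field \<kappa> \<inter> T)"
    if "\<eta> \<in> Field \<kappa>" "\<And>\<xi>. \<xi> \<in> Field \<kappa> \<Longrightarrow> \<xi> \<notin> under \<kappa> \<eta> \<Longrightarrow> S \<xi> \<inter> T = {}" for \<eta> T
  proof -
    have "c ` Field \<kappa> \<inter> T \<subseteq> c ` under \<kappa> \<eta>" using that(2) c(2) by blast
    then show ?thesis using small_image[OF small_under[OF that(1)]] small_subset by blast
  qed
  moreover have "\<not> small \<kappa> (c ` Field \<kappa>)" using small_inj[OF c(1)] not_small_Field by blast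
  moreover have "c ` Field \<kappa> \<subseteq> (\<Union>\<xi>\<in>Field \<kappa>. S \<xi>)" using c(2) by blast
  ultimately show thesis using that by blast
qed

end

section \<open>Almost disjoint families at a regular cardinal\<close>

locale regular_cardinal = infinite_cardinal +
  assumes reg: "regularCard \<kappa>"
begin

lemma small_UN: "small \<kappa> I \<Longrightarrow> (\<And>i. i \<in> I \<Longrightarrow> small \<kappa> (A i)) \<Longrightarrow> small \<kappa> (\<Union>i\<in>I. A i)"
  unfolding small_def using card_of_UNION_ordLess_infinite_Field_regularCard[OF reg Cinf] by blast

text \<open>Removing the earlier members from \<open>a \<xi> \<inter> C\<close> costs, by
  regularity, only a small set. A diagonal through the remainders meets each member only at stages
  up to its own index.\<close>

lemma almost_disjoint_not_maximal:
  assumes a: "\<And>\<xi>. \<xi> \<in> Field \<kappa> \<Longrightarrow> \<not> small \<kappa> (a \<xi> \<inter> C)"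
    and ad: "\<And>\<xi> \<eta>. \<xi> \<in> Field \<kappa> \<Longrightarrow> \<eta> \<in> Field \<kappa> \<Longrightarrow> \<xi> \<noteq> \<eta> \<Longrightarrow> small \<kappa> (a \<xi> \<inter> a \<eta>)"
  obtains c where "c \<subseteq> C" "\<not> small \<kappa> c" "\<And>\<xi>. \<xi> \<in> Field \<kappa> \<Longrightarrow> small \<kappa> (c \<inter> a \<xi>)"
proof -
  define S where "S \<xi> = a \<xi> \<inter> C - (\<Union>\<eta>\<in>underS \<kappa> \<xi>. a \<eta>)" for \<xi>
  have "\<not> small \<kappa> (S \<xi>)" if \<xi>: "\<xi> \<in> Field \<kappa>" for \<xi>
  proof
    assume "small \<kappa> (S \<xi>)"
    moreover have "small \<kappa> (\<Union>\<eta>\<in>underS \<kappa> \<xi>. a \<xi> \<inter> a \<eta>)"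
    proof (rule small_UN)
      show "small \<kappa> (underS \<kappa> \<xi>)" using card_of_underS[OF card \<xi>] by (simp add: small_def)
      show "small \<kappa> (a \<xi> \<inter> a \<eta>)" if "\<eta> \<in> underS \<kappa> \<xi>" for \<eta>
        using that ad[OF \<xi>] underS_Field[OF wo that] unfolding underS_def by blast
    qed
    ultimately have "small \<kappa> (S \<xi> \<union> (\<Union>\<eta>\<in>underS \<kappa> \<xi>. a \<xi> \<inter> a \<eta>))" by (rule small_Un)
    then have "small \<kappa> (a \<xi> \<inter> C)" by (rule small_subset) (auto simp: S_def)
    then show False using a[OF \<xi>] by blast
  qed
  then obtain c where c: "\<not> small \<kappa> c" "c \<subseteq> (\<Union>\<xi>\<in>Field \<kappa>. S \<xi>)"
    and c_small: "\<And>\<eta> T. \<eta> \<in> Field \<kappa> \<Longrightarrow>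
      (\<And>\<xi>. \<xi> \<in> Field \<kappa> \<Longrightarrow> \<xi> \<notin> under \<kappa> \<eta> \<Longrightarrow> S \<xi> \<inter> T = {}) \<Longrightarrow> small \<kappa> (c \<inter> T)"
    using diagonal[of S] by metis
  have "small \<kappa> (c \<inter> a \<eta>)" if \<eta>: "\<eta> \<in> Field \<kappa>" for \<eta>
  proof (rule c_small[OF \<eta>])
    fix \<xi> assume "\<xi> \<in> Field \<kappa>" "\<xi> \<notin> under \<kappa> \<eta>"
    then have "\<eta> \<in> underS \<kappa> \<xi>"
      using r_total[OF wo \<eta>, of \<xi>] r_refl[OF wo \<eta>] unfolding under_def underS_def by auto
    then show "S \<xi> \<inter> a \<eta> = {}" unfolding S_def by blast
  qed
  moreover have "c \<subseteq> C" using c(2) unfolding S_def by blast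
  ultimately show thesis using that c(1) by blast
qed

lemma not_cardSuc_le: "\<not> cardSuc \<kappa> \<le>o |I| \<Longrightarrow> |I| \<le>o \<kappa>"
  using cardSuc_ordLeq_ordLess[OF card card_of_Card_order, of I]
    not_ordLeq_iff_ordLess[OF card_of_Well_order cardSuc_Well_order[OF card], of I] by blast

text \<open>A maximal almost disjoint family on \<open>C\<close> cannot have size exactly \<kappa>,
  for then it could be indexed by \<open>Field \<kappa>\<close> and diagonalised.\<close>

lemma almost_disjoint_card:
  assumes a: "\<And>i. i \<in> I \<Longrightarrow> \<not> small \<kappa> (a i \<inter> C)"
    and ad: "\<And>i j. i \<in> I \<Longrightarrow> j \<in> I \<Longrightarrow> i \<noteq> j \<Longrightarrow> small \<kappa> (a i \<inter> a j)"
    and max: "\<And>c. c \<subseteq> C \<Longrightarrow> \<not> small \<kappa> c \<Longrightarrow> \<exists>i\<in>I. \<not> small \<kappa> (c \<inter> a i)"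
  shows "small \<kappa> I \<or> cardSuc \<kappa> \<le>o |I|"
proof (rule ccontr)
  assume no: "\<not> ?thesis"
  then have "|I| \<le>o \<kappa>" "\<kappa> \<le>o |I|" using not_cardSuc_le not_small_iff by blast+
  then have "|Field \<kappa>| =o |I|"
    using card_of_Field_ordIso[OF card] ordIso_iff_ordLeq ordIso_transitive by blast
  then obtain h where h: "bij_betw h (Field \<kappa>) I" using card_of_ordIso by blast
  have hI: "h \<xi> \<in> I" if "\<xi> \<in> Field \<kappa>" for \<xi> using that h by (auto simp: bij_betw_def)
  obtain c where c: "c \<subseteq> C" "\<not> small \<kappa> c" "\<And>\<xi>. \<xi> \<in> Field \<kappa> \<Longrightarrow> small \<kappa> (c \<inter> a (h \<xi>))"
  proof (rule almost_disjoint_not_maximal[of "\<lambda>\<xi>. a (h \<xi>)" C])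
    show "\<not> small \<kappa> (a (h \<xi>) \<inter> C)" if "\<xi> \<in> Field \<kappa>" for \<xi> using a[OF hI[OF that]] .
    show "small \<kappa> (a (h \<xi>) \<inter> a (h \<eta>))" if "\<xi> \<in> Field \<kappa>" "\<eta> \<in> Field \<kappa>" "\<xi> \<noteq> \<eta>" for \<xi> \<eta>
      using ad[OF hI[OF that(1)] hI[OF that(2)]] h that by (auto simp: bij_betw_def inj_on_def)
  qed blast
  obtain i where "i \<in> I" "\<not> small \<kappa> (c \<inter> a i)" using max[OF c(1,2)] by blast
  moreover then obtain \<xi> where "\<xi> \<in> Field \<kappa>" "i = h \<xi>" using h by (auto simp: bij_betw_def)
  ultimately show False using c(3) by blast
qed

lemma large_almost_disjoint_family:
  fixes B :: "'b set"
  assumes B: "\<not> small \<kappa> B"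
  obtains M where "\<And>m. m \<in> M \<Longrightarrow> m \<subseteq> B" "\<And>m. m \<in> M \<Longrightarrow> \<not> small \<kappa> m"
    "\<And>m n. m \<in> M \<Longrightarrow> n \<in> M \<Longrightarrow> m \<noteq> n \<Longrightarrow> small \<kappa> (m \<inter> n)" "cardSuc \<kappa> \<le>o |M|"
proof -
  have "infinite (Field \<kappa>)" using Cinf by (simp add: cinfinite_def)
  then have "|Field \<kappa> \<times> Field \<kappa>| =o \<kappa>"
    using card_of_Times_same_infinite card_of_Field_ordIso[OF card] ordIso_transitive by blast
  then have "|Field \<kappa> \<times> Field \<kappa>| \<le>o |B|" using B unfolding not_small_iff by (rule ordIso_ordLeq_trans)
  then obtain g where g: "inj_on g (Field \<kappa> \<times> Field \<kappa>)" "g ` (Field \<kappa> \<times> Field \<kappa>) \<subseteq> B"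
    using card_of_ordLeq by metis
  define p where "p \<xi> = g ` ({\<xi>} \<times> Field \<kappa>)" for \<xi>
  have p_B: "p \<xi> \<subseteq> B" if "\<xi> \<in> Field \<kappa>" for \<xi> using that g(2) unfolding p_def by blast
  have p_big: "\<not> small \<kappa> (p \<xi>)" if "\<xi> \<in> Field \<kappa>" for \<xi>
  proof -
    have "p \<xi> = (\<lambda>\<eta>. g (\<xi>, \<eta>)) ` Field \<kappa>" unfolding p_def by auto
    moreover have "inj_on (\<lambda>\<eta>. g (\<xi>, \<eta>)) (Field \<kappa>)" using g(1) that by (auto simp: inj_on_def)
    ultimately show ?thesis using small_inj not_small_Field by metis
  qed
  have p_disj: "p \<xi> \<inter> p \<eta> = {}" if "\<xi> \<in> Field \<kappa>" "\<eta> \<in> Field \<kappa>" "\<xi> \<noteq> \<eta>" for \<xi> \<eta>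
    using g(1) that unfolding p_def by (auto simp: inj_on_def)
  define D where "D = {m. m \<subseteq> B \<and> \<not> small \<kappa> m}"
  have M0: "p ` Field \<kappa> \<subseteq> D" using p_B p_big unfolding D_def by blast
  \<comment> \<open>Having a non-small intersection plays the part of compatibility, whence the
    double negation.\<close>
  have M0': "pairwise (\<lambda>x y. \<not> \<not> small \<kappa> (x \<inter> y)) (p ` Field \<kappa>)"
  proof (rule pairwiseI)
    fix x y assume "x \<in> p ` Field \<kappa>" "y \<in> p ` Field \<kappa>" "x \<noteq> y"
    then have "x \<inter> y = {}" using p_disj by blast
    then show "\<not> \<not> small \<kappa> (x \<inter> y)" using small_finite[of "x \<inter> y"] by simp
  qed
  obtain M where M: "p ` Field \<kappa> \<subseteq> M" "M \<subseteq> D" "pairwise (\<lambda>x y. \<not> \<not> small \<kappa> (x \<inter> y)) M"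
    "\<forall>x\<in>D. \<exists>m\<in>M. \<not> small \<kappa> (m \<inter> x)"
  proof (rule extend_to_maximal[OF M0 M0'])
    show "\<not> small \<kappa> (x \<inter> x)" if "x \<in> D" for x using that by (simp add: D_def)
    show "\<not> small \<kappa> (y \<inter> x)" if "\<not> small \<kappa> (x \<inter> y)" for x y using that by (simp add: Int_commute)
  qed blast
  have ad: "small \<kappa> (m \<inter> n)" if "m \<in> M" "n \<in> M" "m \<noteq> n" for m n
    using M(3) that by (auto simp: pairwise_def)
  have "small \<kappa> M \<or> cardSuc \<kappa> \<le>o |M|"
  proof (rule almost_disjoint_card[of M "\<lambda>m. m" B])
    show "\<not> small \<kappa> (m \<inter> B)" if "m \<in> M" for m
    proof -
      have "m \<subseteq> B" "\<not> small \<kappa> m" using that M(2) by (auto simp: D_def)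
      then show ?thesis by (simp add: Int_absorb2)
    qed
    show "\<exists>m\<in>M. \<not> small \<kappa> (c \<inter> m)" if "c \<subseteq> B" "\<not> small \<kappa> c" for c
      using M(4) that unfolding D_def Int_commute[of c] by blast
  qed (rule ad)
  moreover have "\<not> small \<kappa> M"
  proof
    assume "small \<kappa> M"
    then have "small \<kappa> (p ` Field \<kappa>)" using M(1) small_subset by blast
    moreover have "inj_on p (Field \<kappa>)"
      using p_disj p_big small_finite[of "{} :: 'b set"] by (metis Int_absorb finite.emptyI inj_onI)
    ultimately show False using small_inj not_small_Field by blast
  qed
  ultimately have "cardSuc \<kappa> \<le>o |M|" by blast
  then show thesis using that[of M] ad M(2) unfolding D_def by blast
qed

end

section \<open>Posets of large sets\<close>

definition big_sets :: "'a rel \<Rightarrow> 'a set set \<Rightarrow> 'a set set" where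
  "big_sets \<kappa> \<C> = {A. A \<subseteq> Field \<kappa> \<and> (\<forall>K\<in>\<C>. \<not> small \<kappa> (A \<inter> K))}"

definition big_poset :: "'a rel \<Rightarrow> 'a set set \<Rightarrow> 'a set rel" where
  "big_poset \<kappa> \<C> = {(A, B). A \<in> big_sets \<kappa> \<C> \<and> B \<in> big_sets \<kappa> \<C> \<and> A \<subseteq> B}"

lemma Field_big_poset: "Field (big_poset \<kappa> \<C>) = big_sets \<kappa> \<C>"
  unfolding Field_def big_poset_def by blast

lemma Preorder_big_poset: "Preorder (big_poset \<kappa> \<C>)"
  unfolding order_on_defs refl_on_def Field_big_poset
  unfolding big_poset_def by (auto intro: transI)

locale big_classes = infinite_cardinal +
  fixes \<C> :: "'a set set"
  assumes disjoint: "\<And>K K'. K \<in> \<C> \<Longrightarrow> K' \<in> \<C> \<Longrightarrow> K \<noteq> K' \<Longrightarrow> K \<inter> K' = {}"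
    and classes: "\<And>K. K \<in> \<C> \<Longrightarrow> K \<subseteq> Field \<kappa>" "\<And>K. K \<in> \<C> \<Longrightarrow> \<not> small \<kappa> K"
begin

lemma not_small_diff: "\<not> small \<kappa> A \<Longrightarrow> small \<kappa> (A - B) \<Longrightarrow> \<not> small \<kappa> (A \<inter> B)"
  using small_Un[of "A \<inter> B" "A - B"] by (auto simp: Int_Diff_Un)

text \<open>By disjointness a condition can be shrunk inside one class without affecting the
  others.\<close>

lemma replace_class:
  assumes p: "p \<in> big_sets \<kappa> \<C>" and K: "K \<in> \<C>" and m: "m \<subseteq> K" "\<not> small \<kappa> m"
  shows "m \<union> (p - K) \<in> big_sets \<kappa> \<C>"
proof -
  have "\<not> small \<kappa> ((m \<union> (p - K)) \<inter> K')" if K': "K' \<in> \<C>" for K'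
  proof (cases "K' = K")
    case True
    then have "(m \<union> (p - K)) \<inter> K' = m" using m by blast
    then show ?thesis using m by simp
  next
    case False
    then have "p \<inter> K' \<subseteq> (m \<union> (p - K)) \<inter> K'" using disjoint[OF K' K] by blast
    then show ?thesis using p K' small_subset unfolding big_sets_def by blast
  qed
  moreover have "m \<union> (p - K) \<subseteq> Field \<kappa>" using p m classes(1)[OF K] unfolding big_sets_def by blast
  ultimately show ?thesis unfolding big_sets_def by blast
qed

text \<open>If \<open>A \<inter> K - B\<close> is large, replacing the part of \<open>A\<close> in
  \<open>K\<close> by it gives a condition with no common extension with \<open>B\<close>.
  Conversely, if the differences are small, \<open>C \<inter> B\<close> is a condition for every
  \<open>C\<close> below \<open>A\<close>.\<close>

lemma sep_le_big_poset:
  "(A, B) \<in> sep_le (big_poset \<kappa> \<C>) \<longleftrightarrow>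
    A \<in> big_sets \<kappa> \<C> \<and> B \<in> big_sets \<kappa> \<C> \<and> (\<forall>K\<in>\<C>. small \<kappa> (A \<inter> K - B))"
proof (intro iffI conjI ballI)
  assume AB: "(A, B) \<in> sep_le (big_poset \<kappa> \<C>)"
  show A: "A \<in> big_sets \<kappa> \<C>" using sep_leD(1)[OF AB] unfolding Field_big_poset .
  show "B \<in> big_sets \<kappa> \<C>" using sep_leD(2)[OF AB] unfolding Field_big_poset .
  fix K assume K: "K \<in> \<C>"
  show "small \<kappa> (A \<inter> K - B)"
  proof (rule ccontr)
    assume no: "\<not> small \<kappa> (A \<inter> K - B)"
    define C where "C = (A \<inter> K - B) \<union> (A - K)"
    have "C \<in> big_sets \<kappa> \<C>" unfolding C_def using replace_class[OF A K _ no] by blast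
    then have "(C, A) \<in> big_poset \<kappa> \<C>" using A unfolding big_poset_def C_def by blast
    then obtain D where "(D, C) \<in> big_poset \<kappa> \<C>" "(D, B) \<in> big_poset \<kappa> \<C>"
      using AB unfolding sep_le_def by blast
    then have "D \<inter> K = {}" "\<not> small \<kappa> (D \<inter> K)"
      using K unfolding big_poset_def C_def big_sets_def by blast+
    then show False using small_finite[of "D \<inter> K"] by simp
  qed
next
  assume AB: "A \<in> big_sets \<kappa> \<C> \<and> B \<in> big_sets \<kappa> \<C> \<and> (\<forall>K\<in>\<C>. small \<kappa> (A \<inter> K - B))"
  have "\<exists>D. (D, C) \<in> big_poset \<kappa> \<C> \<and> (D, B) \<in> big_poset \<kappa> \<C>" if C: "(C, A) \<in> big_poset \<kappa> \<C>" for C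
  proof -
    have "\<not> small \<kappa> (C \<inter> B \<inter> K)" if K: "K \<in> \<C>" for K
    proof -
      have "small \<kappa> (C \<inter> K - B)"
        using AB K C small_subset[of "A \<inter> K - B" "C \<inter> K - B"] unfolding big_poset_def by blast
      then have "\<not> small \<kappa> (C \<inter> K \<inter> B)"
        using not_small_diff C K unfolding big_poset_def big_sets_def by blast
      then show ?thesis by (simp add: Int_ac)
    qed
    then have "C \<inter> B \<in> big_sets \<kappa> \<C>" using AB unfolding big_sets_def by blast
    then show ?thesis using C AB unfolding big_poset_def by blast
  qed
  then show "(A, B) \<in> sep_le (big_poset \<kappa> \<C>)"
    using AB unfolding sep_le_def Field_big_poset by blast
qed

lemma compatible_big_poset:
  assumes A: "A \<in> big_sets \<kappa> \<C>" and B: "B \<in> big_sets \<kappa> \<C>"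
  shows "compatible (sep_le (big_poset \<kappa> \<C>)) A B \<longleftrightarrow> (\<forall>K\<in>\<C>. \<not> small \<kappa> (A \<inter> B \<inter> K))"
proof
  assume "compatible (sep_le (big_poset \<kappa> \<C>)) A B"
  then obtain C where C: "C \<in> big_sets \<kappa> \<C>" "\<And>K. K \<in> \<C> \<Longrightarrow> small \<kappa> (C \<inter> K - A)"
    "\<And>K. K \<in> \<C> \<Longrightarrow> small \<kappa> (C \<inter> K - B)"
    unfolding compatible_def sep_le_big_poset by blast
  show "\<forall>K\<in>\<C>. \<not> small \<kappa> (A \<inter> B \<inter> K)"
  proof (intro ballI notI)
    fix K assume K: "K \<in> \<C>" "small \<kappa> (A \<inter> B \<inter> K)"
    then have "small \<kappa> (A \<inter> B \<inter> K \<union> ((C \<inter> K - A) \<union> (C \<inter> K - B)))" using C small_Un by blast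
    then have "small \<kappa> (C \<inter> K)" by (rule small_subset) blast
    then show False using C(1) K(1) unfolding big_sets_def by blast
  qed
next
  assume *: "\<forall>K\<in>\<C>. \<not> small \<kappa> (A \<inter> B \<inter> K)"
  then have "A \<inter> B \<in> big_sets \<kappa> \<C>" using A unfolding big_sets_def by blast
  then have "(A \<inter> B, A) \<in> big_poset \<kappa> \<C>" "(A \<inter> B, B) \<in> big_poset \<kappa> \<C>"
    using A B unfolding big_poset_def by blast+
  then show "compatible (sep_le (big_poset \<kappa> \<C>)) A B"
    using sep_leI[OF Preorder_big_poset] unfolding compatible_def by blast
qed

lemma Field_in_big_sets: "Field \<kappa> \<in> big_sets \<kappa> \<C>"
  using classes unfolding big_sets_def by (auto simp: Int_absorb1)

end

locale regular_classes = regular_cardinal \<kappa> + big_classes \<kappa> \<C> for \<kappa> :: "'a rel" and \<C> +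
  assumes nonempty: "\<C> \<noteq> {}" and gch: "ctwo ^c \<kappa> =o cardSuc \<kappa>"
begin

abbreviation "R \<equiv> sep_le (big_poset \<kappa> \<C>)"
abbreviation "\<Lambda> \<equiv> Field (cardSuc \<kappa>)"

lemma PR: "Preorder R"
  by (rule Preorder_sep_le[OF Preorder_big_poset])

lemma FR: "Field R = big_sets \<kappa> \<C>"
  by (simp only: Field_sep_le[OF Preorder_big_poset] Field_big_poset)

lemma card_\<Lambda>: "|\<Lambda>| =o cardSuc \<kappa>"
  using card_of_Field_ordIso[OF cardSuc_Card_order[OF card]] .

lemma card_R: "|Field R| \<le>o |\<Lambda>|"
proof -
  have "|Field R| \<le>o |Pow (Field \<kappa>)|" unfolding FR big_sets_def by (rule card_of_mono1) blast
  also have "|Pow (Field \<kappa>)| =o ctwo ^c \<kappa>"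
    unfolding cexp_def ctwo_def Field_card_of by (rule card_of_Pow_Func)
  also have "ctwo ^c \<kappa> =o |\<Lambda>|" using gch card_\<Lambda> ordIso_symmetric ordIso_transitive by blast
  finally show ?thesis .
qed

text \<open>It suffices to work in a single class \<open>K\<close>: almost disjoint large subsets of
  \<open>p \<inter> K\<close>, completed by \<open>p\<close> outside \<open>K\<close>, are
  incompatible because of \<open>K\<close> alone.\<close>

lemma large_antichain:
  assumes p: "p \<in> Field R"
  shows "\<exists>M. (\<forall>m\<in>M. (m, p) \<in> R) \<and> pairwise (\<lambda>x y. \<not> compatible R x y) M \<and> |\<Lambda>| \<le>o |M|"
proof -
  obtain K where K: "K \<in> \<C>" using nonempty by blast
  have pb: "p \<in> big_sets \<kappa> \<C>" using p FR by simp
  have "\<not> small \<kappa> (p \<inter> K)" using pb K by (simp add: big_sets_def)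
  then obtain M where M: "\<And>m. m \<in> M \<Longrightarrow> m \<subseteq> p \<inter> K" "\<And>m. m \<in> M \<Longrightarrow> \<not> small \<kappa> m"
    "\<And>m n. m \<in> M \<Longrightarrow> n \<in> M \<Longrightarrow> m \<noteq> n \<Longrightarrow> small \<kappa> (m \<inter> n)" "cardSuc \<kappa> \<le>o |M|"
    using large_almost_disjoint_family[of "p \<inter> K"] by metis
  define h where "h m = m \<union> (p - K)" for m
  have h_big: "h m \<in> big_sets \<kappa> \<C>" if "m \<in> M" for m
    unfolding h_def using replace_class[OF pb K _ M(2)[OF that]] M(1)[OF that] by blast
  have h_K: "h m \<inter> K = m" if "m \<in> M" for m using M(1)[OF that] unfolding h_def by blast
  have "(h m, p) \<in> R" if "m \<in> M" for m
  proof -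
    have "(h m, p) \<in> big_poset \<kappa> \<C>"
      using h_big[OF that] pb M(1)[OF that] unfolding big_poset_def h_def by blast
    then show ?thesis by (rule sep_leI[OF Preorder_big_poset])
  qed
  moreover have "pairwise (\<lambda>x y. \<not> compatible R x y) (h ` M)"
  proof (rule pairwiseI)
    fix x y assume "x \<in> h ` M" "y \<in> h ` M" "x \<noteq> y"
    then obtain m n where mn: "m \<in> M" "n \<in> M" "x = h m" "y = h n" "m \<noteq> n" by blast
    have "x \<inter> y \<inter> K = m \<inter> n" using h_K[OF mn(1)] h_K[OF mn(2)] mn(3,4) by blast
    then show "\<not> compatible R x y"
      using compatible_big_poset[of x y] h_big mn M(3) K by metis
  qed
  moreover have "|\<Lambda>| \<le>o |h ` M|"
  proof -
    have "inj_on h M" using h_K by (rule inj_on_inverseI)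
    then have "bij_betw h M (h ` M)" by (rule inj_on_imp_bij_betw)
    then have "|M| =o |h ` M|" using card_of_ordIso by blast
    then show ?thesis using card_\<Lambda> M(4) ordIso_ordLeq_trans ordLeq_ordIso_trans by blast
  qed
  ultimately show ?thesis by blast
qed

lemma extend_antichain:
  assumes M0: "M0 \<subseteq> Field R" "pairwise (\<lambda>x y. \<not> compatible R x y) M0"
  obtains M where "M0 \<subseteq> M" "maximal_antichain R M"
proof -
  obtain M where "M0 \<subseteq> M" "M \<subseteq> Field R" "pairwise (\<lambda>x y. \<not> compatible R x y) M"
    "\<forall>x\<in>Field R. \<exists>m\<in>M. compatible R m x"
    by (rule extend_to_maximal[OF M0 compatible_refl[OF PR] compatible_sym]) blast+
  then show thesis using that[of M] unfolding maximal_antichain_def by blast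
qed

end

section \<open>Countable cardinals\<close>

context regular_classes
begin

text \<open>Finitely many members of the decreasing sequence have a least one, so their intersection
  is large in every class. A diagonal in each class gives a set almost contained in all members, and
  the union over the classes is the bound.\<close>

lemma countable_closed:
  assumes \<omega>: "\<kappa> =o natLeq" and \<alpha>: "\<alpha> \<in> \<Lambda>"
    and xF: "\<And>\<beta>. \<beta> \<in> underS (cardSuc \<kappa>) \<alpha> \<Longrightarrow> x \<beta> \<in> Field R"
    and dec: "\<And>\<beta> \<gamma>. \<beta> \<in> underS (cardSuc \<kappa>) \<alpha> \<Longrightarrow> \<gamma> \<in> underS (cardSuc \<kappa>) \<beta> \<Longrightarrow> (x \<beta>, x \<gamma>) \<in> R"
  shows "\<exists>p\<in>Field R. \<forall>\<beta>\<in>underS (cardSuc \<kappa>) \<alpha>. (p, x \<beta>) \<in> R"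
proof -
  have wo': "Well_order (cardSuc \<kappa>)" using cardSuc_Well_order[OF card] .
  define U where "U = underS (cardSuc \<kappa>) \<alpha>"
  show ?thesis
  proof (cases "U = {}")
    case True
    then show ?thesis using FR Field_in_big_sets unfolding U_def by blast
  next
    case False
    \<comment> \<open>For countable \<kappa> small sets are finite.\<close>
    have fin: "finite A" if "small \<kappa> A" for A :: "'c set"
      using that \<omega> ordLess_ordIso_trans unfolding small_def finite_iff_ordLess_natLeq by blast
    have "|U| <o cardSuc \<kappa>" unfolding U_def by (rule card_of_underS[OF cardSuc_Card_order[OF card] \<alpha>])
    then have "|U| \<le>o \<kappa>" using cardSuc_ordLeq_ordLess[OF card card_of_Card_order] by blast
    then have "|U| \<le>o |Field \<kappa>|"
      using card_of_Field_ordIso[OF card] ordIso_symmetric ordLeq_ordIso_trans by blast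
    \<comment> \<open>The indices are listed again along \<open>Field \<kappa>\<close>. The list
      need not respect their order, which is why \<open>minimum\<close> treats arbitrary finite
      sets.\<close>
    then obtain h where h: "h ` Field \<kappa> = U" using card_of_ordLeq2[OF False] by metis
    have minimum: "\<exists>\<beta>\<in>F. \<forall>\<gamma>\<in>F. (x \<beta>, x \<gamma>) \<in> R" if "finite F" "F \<noteq> {}" "F \<subseteq> U" for F
      using that
    proof (induction F rule: finite_ne_induct)
      case (singleton \<beta>)
      then show ?case using xF Preorder_refl[OF PR] unfolding U_def by blast
    next
      case (insert \<delta> F)
      then obtain \<beta> where \<beta>: "\<beta> \<in> F" "\<forall>\<gamma>\<in>F. (x \<beta>, x \<gamma>) \<in> R" by blast
      have U: "\<beta> \<in> U" "\<delta> \<in> U" "\<beta> \<noteq> \<delta>" using insert \<beta> by blast+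
      have refl: "(x \<delta>, x \<delta>) \<in> R" using xF U Preorder_refl[OF PR] unfolding U_def by blast
      have "\<beta> \<in> underS (cardSuc \<kappa>) \<delta> \<or> \<delta> \<in> underS (cardSuc \<kappa>) \<beta>"
        using r_total[OF wo', of \<beta> \<delta>] U underS_Field[OF wo'] unfolding U_def underS_def by blast
      then show ?case
      proof
        assume "\<beta> \<in> underS (cardSuc \<kappa>) \<delta>"
        then have "(x \<delta>, x \<beta>) \<in> R" using dec U unfolding U_def by blast
        then have "\<forall>\<gamma>\<in>insert \<delta> F. (x \<delta>, x \<gamma>) \<in> R"
          using \<beta>(2) refl Preorder_trans[OF PR] by blast
        then show ?thesis by blast
      next
        assume "\<delta> \<in> underS (cardSuc \<kappa>) \<beta>"
        then have "(x \<beta>, x \<delta>) \<in> R" using dec U unfolding U_def by blast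
        then show ?thesis using \<beta> by blast
      qed
    qed
    have "\<exists>b. K \<in> \<C> \<longrightarrow> b \<subseteq> K \<and> \<not> small \<kappa> b \<and> (\<forall>\<beta>\<in>U. small \<kappa> (b - x \<beta>))" for K
    proof (cases "K \<in> \<C>")
      case K: True
      \<comment> \<open>These intersections decrease with \<xi>. Using \<open>under\<close> includes
        \<xi> itself, so \<open>S \<xi>\<close> lies in \<open>K\<close> and in
        \<open>x (h \<eta>)\<close> for every \<eta> up to \<xi>.\<close>
      define S where "S \<xi> = (\<Inter>\<eta>\<in>under \<kappa> \<xi>. x (h \<eta>) \<inter> K)" for \<xi>
      have "\<not> small \<kappa> (S \<xi>)" if \<xi>: "\<xi> \<in> Field \<kappa>" for \<xi>
      proof
        assume S: "small \<kappa> (S \<xi>)"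
        have "under \<kappa> \<xi> \<subseteq> Field \<kappa>" by (auto simp: under_def intro: FieldI1)
        moreover have "\<xi> \<in> under \<kappa> \<xi>" using r_refl[OF wo \<xi>] by (simp add: under_def)
        ultimately obtain \<eta> where \<eta>: "\<eta> \<in> under \<kappa> \<xi>" "\<And>\<zeta>. \<zeta> \<in> under \<kappa> \<xi> \<Longrightarrow> (x (h \<eta>), x (h \<zeta>)) \<in> R"
          using minimum[of "h ` under \<kappa> \<xi>"] fin[OF small_under[OF \<xi>]] h by blast
        have "small \<kappa> (\<Union>\<zeta>\<in>under \<kappa> \<xi>. x (h \<eta>) \<inter> K - x (h \<zeta>))"
        proof (rule small_UN[OF small_under[OF \<xi>]])
          show "small \<kappa> (x (h \<eta>) \<inter> K - x (h \<zeta>))" if "\<zeta> \<in> under \<kappa> \<xi>" for \<zeta>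
            using \<eta>(2)[OF that] K unfolding sep_le_big_poset by blast
        qed
        then have "small \<kappa> (S \<xi> \<union> (\<Union>\<zeta>\<in>under \<kappa> \<xi>. x (h \<eta>) \<inter> K - x (h \<zeta>)))" using small_Un S by blast
        then have "small \<kappa> (x (h \<eta>) \<inter> K)" by (rule small_subset) (auto simp: S_def)
        then show False using \<eta> K unfolding sep_le_big_poset big_sets_def by blast
      qed
      then obtain b where b: "\<not> small \<kappa> b" "b \<subseteq> (\<Union>\<xi>\<in>Field \<kappa>. S \<xi>)"
        and b_small: "\<And>\<eta> T. \<eta> \<in> Field \<kappa> \<Longrightarrow>
          (\<And>\<xi>. \<xi> \<in> Field \<kappa> \<Longrightarrow> \<xi> \<notin> under \<kappa> \<eta> \<Longrightarrow> S \<xi> \<inter> T = {}) \<Longrightarrow> small \<kappa> (b \<inter> T)"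
        using diagonal[of S] by metis
      have "small \<kappa> (b - x \<beta>)" if \<beta>: "\<beta> \<in> U" for \<beta>
      proof -
        obtain \<eta> where \<eta>: "\<eta> \<in> Field \<kappa>" "\<beta> = h \<eta>" using h \<beta> by blast
        have "small \<kappa> (b \<inter> (- x \<beta>))"
        proof (rule b_small[OF \<eta>(1)])
          fix \<xi> assume "\<xi> \<in> Field \<kappa>" "\<xi> \<notin> under \<kappa> \<eta>"
          then have "\<eta> \<in> under \<kappa> \<xi>" using r_total[OF wo \<eta>(1)] unfolding under_def by blast
          then show "S \<xi> \<inter> (- x \<beta>) = {}" unfolding S_def \<eta>(2) by blast
        qed
        then show ?thesis by (simp add: Diff_eq)
      qed
      moreover have "b \<subseteq> K"
      proof
        fix y assume "y \<in> b"
        then obtain \<xi> where "\<xi> \<in> Field \<kappa>" "y \<in> S \<xi>" using b(2) by blast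
        then show "y \<in> K" using r_refl[OF wo] unfolding S_def under_def by blast
      qed
      ultimately show ?thesis using b(1) by blast
    qed simp
    then obtain b where b: "\<And>K. K \<in> \<C> \<Longrightarrow> b K \<subseteq> K" "\<And>K. K \<in> \<C> \<Longrightarrow> \<not> small \<kappa> (b K)"
      "\<And>K \<beta>. K \<in> \<C> \<Longrightarrow> \<beta> \<in> U \<Longrightarrow> small \<kappa> (b K - x \<beta>)" by metis
    define p where "p = (\<Union>K\<in>\<C>. b K)"
    have pK: "p \<inter> K = b K" if "K \<in> \<C>" for K
      using b(1) disjoint that unfolding p_def by blast
    have p: "p \<in> big_sets \<kappa> \<C>"
      using pK b(1,2) classes(1) unfolding big_sets_def p_def by fastforce
    have "(p, x \<beta>) \<in> R" if "\<beta> \<in> U" for \<beta>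
      unfolding sep_le_big_poset using p xF that b(3) pK FR unfolding U_def by auto
    then show ?thesis using p FR unfolding U_def by blast
  qed
qed

lemma countable_dense_embedding:
  assumes \<omega>: "\<kappa> =o natLeq"
  shows "\<exists>i. dense_embedding (tree (cardSuc \<kappa>) \<Lambda>) R i"
proof -
  have "|Field R| \<le>o |\<Lambda>|" "Field R \<noteq> {}" using card_R FR Field_in_big_sets by auto
  then obtain e where e: "e ` \<Lambda> = Field R" using card_of_ordLeq2[of "Field R" \<Lambda>] by blast
  have "\<exists>M. \<alpha> \<in> \<Lambda> \<longrightarrow> e \<alpha> \<in> M \<and> maximal_antichain R M" for \<alpha>
  proof (cases "\<alpha> \<in> \<Lambda>")
    case True
    then have "{e \<alpha>} \<subseteq> Field R" using e by blast
    then obtain M where "{e \<alpha>} \<subseteq> M" "maximal_antichain R M"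
      by (rule extend_antichain) (simp add: pairwise_def)
    then show ?thesis by blast
  qed simp
  then obtain A where A: "\<And>\<alpha>. \<alpha> \<in> \<Lambda> \<Longrightarrow> e \<alpha> \<in> A \<alpha>" "\<And>\<alpha>. \<alpha> \<in> \<Lambda> \<Longrightarrow> maximal_antichain R (A \<alpha>)" by metis
  have A_dense: "\<exists>\<alpha>\<in>\<Lambda>. \<exists>a\<in>A \<alpha>. (a, p) \<in> R" if p: "p \<in> Field R" for p
  proof -
    obtain \<alpha> where "\<alpha> \<in> \<Lambda>" "p = e \<alpha>" using e p by blast
    then show ?thesis using A Preorder_refl[OF PR p] by blast
  qed
  show ?thesis
    by (rule tree_dense_embedding[OF PR cardSuc_Well_order[OF card] card_R large_antichain
          countable_closed[OF \<omega>] A(2) A_dense])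
qed

end

section \<open>Uncountable regular cardinals\<close>

context regular_cardinal
begin

text \<open>The members of the almost disjoint families carry functions with values in \<open>\<kappa>\<close> that take
  each bounded set of values only on a small set, so that such a function can always be lowered on a
  smaller set.\<close>

definition tame :: "'a set \<Rightarrow> 'a set \<times> ('a \<Rightarrow> 'a) \<Rightarrow> bool" where
  "tame K z \<longleftrightarrow> fst z \<subseteq> K \<and> \<not> small \<kappa> (fst z) \<and> snd z ` fst z \<subseteq> Field \<kappa> \<and>
    (\<forall>y\<in>Field \<kappa>. small \<kappa> {x\<in>fst z. (snd z x, y) \<in> \<kappa>})"

definition descends :: "'a set \<times> ('a \<Rightarrow> 'a) \<Rightarrow> 'a set \<times> ('a \<Rightarrow> 'a) \<Rightarrow> bool" where
  "descends z w \<longleftrightarrow> fst z \<subseteq> fst w \<and> (\<forall>x\<in>fst z. (snd z x, snd w x) \<in> \<kappa> - Id)"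

text \<open>For each \<xi>, the points of \<open>C\<close> where the old function exceeds \<xi> form
  a large set, because the old function is tame. Choosing distinct such points and giving the point
  for \<xi> the value \<xi> yields a smaller tame function.\<close>

lemma tame_descends:
  assumes w: "tame K w" and C: "C \<subseteq> fst w" "\<not> small \<kappa> C"
  obtains z where "tame K z" "descends z w" "fst z \<subseteq> C"
proof -
  define S where "S \<xi> = {x\<in>C. (\<xi>, snd w x) \<in> \<kappa> - Id}" for \<xi>
  have S: "\<kappa> \<le>o |S \<xi>|" if \<xi>: "\<xi> \<in> Field \<kappa>" for \<xi>
    unfolding not_small_iff[symmetric]
  proof
    assume "small \<kappa> (S \<xi>)"
    then have "small \<kappa> (S \<xi> \<union> {x\<in>fst w. (snd w x, \<xi>) \<in> \<kappa>})"
      using w \<xi> small_Un unfolding tame_def by blast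
    moreover have "C \<subseteq> S \<xi> \<union> {x\<in>fst w. (snd w x, \<xi>) \<in> \<kappa>}"
    proof
      fix x assume x: "x \<in> C"
      then have "snd w x \<in> Field \<kappa>" using w C unfolding tame_def by blast
      then show "x \<in> S \<xi> \<union> {x\<in>fst w. (snd w x, \<xi>) \<in> \<kappa>}"
        using x C r_total[OF wo \<xi>, of "snd w x"] r_refl[OF wo \<xi>] unfolding S_def by fastforce
    qed
    ultimately show False using C small_subset by blast
  qed
  have "|Field \<kappa>| \<le>o \<kappa>" using card_of_Field_ordIso[OF card] ordIso_imp_ordLeq by blast
  then obtain c where c: "inj_on c (Field \<kappa>)" "\<And>\<xi>. \<xi> \<in> Field \<kappa> \<Longrightarrow> c \<xi> \<in> S \<xi>"
    using injective_choice[OF card, of "Field \<kappa>" S] S by blast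
  define g where "g = inv_into (Field \<kappa>) c"
  have g: "g (c \<xi>) = \<xi>" if "\<xi> \<in> Field \<kappa>" for \<xi> using c(1) that by (simp add: g_def)
  have "small \<kappa> {x\<in>c ` Field \<kappa>. (g x, y) \<in> \<kappa>}" if y: "y \<in> Field \<kappa>" for y
  proof (rule small_subset[OF small_image[OF small_under[OF y]]])
    show "{x\<in>c ` Field \<kappa>. (g x, y) \<in> \<kappa>} \<subseteq> c ` under \<kappa> y" using g by (auto simp: under_def)
  qed
  moreover have "\<not> small \<kappa> (c ` Field \<kappa>)" using small_inj[OF c(1)] not_small_Field by blast
  moreover have sub: "c ` Field \<kappa> \<subseteq> C" using c(2) unfolding S_def by blast
  moreover have "c ` Field \<kappa> \<subseteq> K" using sub C w unfolding tame_def by blast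
  moreover have "g ` c ` Field \<kappa> \<subseteq> Field \<kappa>" using g by auto
  ultimately have "tame K (c ` Field \<kappa>, g)" unfolding tame_def by simp
  moreover have "descends (c ` Field \<kappa>, g) w"
    using sub C(1) c(2) g unfolding descends_def S_def by auto
  ultimately show thesis using that[of "(c ` Field \<kappa>, g)"] sub by simp
qed

text \<open>A maximal almost disjoint family on \<open>K\<close>. Almost disjointness is asked of
  distinct pairs, so every set of the family carries just one function.\<close>

definition level :: "'a set \<Rightarrow> ('a set \<times> ('a \<Rightarrow> 'a)) set \<Rightarrow> bool" where
  "level K N \<longleftrightarrow> (\<forall>z\<in>N. tame K z) \<and> (\<forall>z\<in>N. \<forall>w\<in>N. z \<noteq> w \<longrightarrow> small \<kappa> (fst z \<inter> fst w)) \<and>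
    (\<forall>B. B \<subseteq> K \<longrightarrow> \<not> small \<kappa> B \<longrightarrow> (\<exists>z\<in>N. \<not> small \<kappa> (fst z \<inter> B)))"

lemma levelD:
  assumes "level K N"
  shows "z \<in> N \<Longrightarrow> tame K z"
    and "z \<in> N \<Longrightarrow> w \<in> N \<Longrightarrow> z \<noteq> w \<Longrightarrow> small \<kappa> (fst z \<inter> fst w)"
    and "B \<subseteq> K \<Longrightarrow> \<not> small \<kappa> B \<Longrightarrow> \<exists>z\<in>N. \<not> small \<kappa> (fst z \<inter> B)"
  using assms unfolding level_def by blast+

lemma level_0:
  assumes "K \<subseteq> Field \<kappa>" "\<not> small \<kappa> K"
  shows "level K {(K, id)}"
proof -
  have "small \<kappa> {x\<in>K. (x, y) \<in> \<kappa>}" if "y \<in> Field \<kappa>" for y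
    using small_under[OF that] by (rule small_subset) (auto simp: under_def)
  then show ?thesis using assms unfolding level_def tame_def by (auto simp: Int_absorb1)
qed

text \<open>Take a maximal almost disjoint family of tame pairs descending from members of
  \<open>N\<close>. It stays maximal on \<open>K\<close>: a large \<open>B\<close> meets some member
  of \<open>N\<close> in a large set, inside which \<open>tame_descends\<close> produces such a
  pair.\<close>

lemma level_Suc:
  assumes N: "level K N"
  obtains N' where "level K N'" "\<And>z. z \<in> N' \<Longrightarrow> \<exists>w\<in>N. descends z w"
proof -
  define D where "D = {z. tame K z \<and> (\<exists>w\<in>N. descends z w)}"
  obtain M where M: "{} \<subseteq> M" "M \<subseteq> D" "pairwise (\<lambda>z w. \<not> \<not> small \<kappa> (fst z \<inter> fst w)) M"
    "\<forall>z\<in>D. \<exists>m\<in>M. \<not> small \<kappa> (fst m \<inter> fst z)"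
  proof (rule extend_to_maximal[of "{}" D "\<lambda>z w. \<not> small \<kappa> (fst z \<inter> fst w)"])
    show "\<not> small \<kappa> (fst x \<inter> fst x)" if "x \<in> D" for x using that by (simp add: D_def tame_def)
    show "\<not> small \<kappa> (fst y \<inter> fst x)" if "\<not> small \<kappa> (fst x \<inter> fst y)"
      for x y :: "'a set \<times> ('a \<Rightarrow> 'a)" using that by (simp add: Int_commute)
  qed (auto simp: pairwise_def)
  have "\<exists>m\<in>M. \<not> small \<kappa> (fst m \<inter> B)" if B: "B \<subseteq> K" "\<not> small \<kappa> B" for B
  proof -
    obtain w where w: "w \<in> N" "\<not> small \<kappa> (fst w \<inter> B)" using levelD(3)[OF N B] by blast
    obtain z where z: "tame K z" "descends z w" "fst z \<subseteq> fst w \<inter> B"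
      using tame_descends[OF levelD(1)[OF N w(1)] _ w(2)] by blast
    then have "z \<in> D" using w(1) unfolding D_def by blast
    then obtain m where m: "m \<in> M" "\<not> small \<kappa> (fst m \<inter> fst z)" using M(4) by blast
    have "fst m \<inter> fst z \<subseteq> fst m \<inter> B" using z(3) by blast
    then show ?thesis using m small_subset by blast
  qed
  moreover have "tame K z \<and> (\<exists>w\<in>N. descends z w)" if "z \<in> M" for z
    using M(2) that unfolding D_def by blast
  moreover have "small \<kappa> (fst z \<inter> fst w)" if "z \<in> M" "w \<in> M" "z \<noteq> w" for z w
    using M(3) that by (simp add: pairwise_def)
  ultimately show thesis using that[of M] unfolding level_def by blast
qed

lemma levels:
  assumes "K \<subseteq> Field \<kappa>" "\<not> small \<kappa> K"
  obtains N :: "nat \<Rightarrow> ('a set \<times> ('a \<Rightarrow> 'a)) set"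
  where "\<And>n. level K (N n)" "\<And>n z. z \<in> N (Suc n) \<Longrightarrow> \<exists>w\<in>N n. descends z w"
proof -
  have "\<exists>N. \<forall>n. level K (N n) \<and> (\<forall>z\<in>N (Suc n). \<exists>w\<in>N n. descends z w)"
  proof (rule dependent_nat_choice)
    show "\<exists>N. level K N" using level_0[OF assms] by blast
    show "\<exists>N'. level K N' \<and> (\<forall>z\<in>N'. \<exists>w\<in>N. descends z w)" if "level K N" for N n
      using level_Suc[OF that] by metis
  qed
  then show thesis using that by blast
qed

text \<open>If \<open>B\<close> met fewer than \<open>\<kappa>\<close> members of every level, almost every \<open>x \<in> B\<close> would lie in exactly
  one member of each level that \<open>B\<close> meets, and the values at \<open>x\<close> of the attached functions would
  descend for ever.\<close>

lemma level_splits: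
  fixes N :: "nat \<Rightarrow> ('a set \<times> ('a \<Rightarrow> 'a)) set"
  assumes unc: "natLeq <o \<kappa>" and N: "\<And>n. level K (N n)"
    and desc: "\<And>n z. z \<in> N (Suc n) \<Longrightarrow> \<exists>w\<in>N n. descends z w"
    and B: "B \<subseteq> K" "\<not> small \<kappa> B"
  shows "\<exists>n. cardSuc \<kappa> \<le>o |{z\<in>N n. \<not> small \<kappa> (fst z \<inter> B)}|"
proof (rule ccontr)
  assume no: "\<not> ?thesis"
  define M where "M n = {z\<in>N n. \<not> small \<kappa> (fst z \<inter> B)}" for n
  have meets: "\<exists>z\<in>M n. \<not> small \<kappa> (c \<inter> fst z)" if c: "c \<subseteq> B" "\<not> small \<kappa> c" for c n
  proof -
    obtain z where z: "z \<in> N n" "\<not> small \<kappa> (fst z \<inter> c)" using levelD(3)[OF N, of c n] c B by blast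
    moreover have "fst z \<inter> c \<subseteq> fst z \<inter> B" using c by blast
    ultimately have "z \<in> M n" unfolding M_def using small_subset by blast
    then show ?thesis using z by (auto simp: Int_commute)
  qed
  have ad: "small \<kappa> (fst z \<inter> fst w)" if "z \<in> M n" "w \<in> M n" "z \<noteq> w" for z w n
    using levelD(2)[OF N] that unfolding M_def by blast
  have M: "small \<kappa> (M n)" for n
  proof -
    have "small \<kappa> (M n) \<or> cardSuc \<kappa> \<le>o |M n|"
    proof (rule almost_disjoint_card[of "M n" fst B])
      show "\<not> small \<kappa> (fst z \<inter> B)" if "z \<in> M n" for z using that by (simp add: M_def)
    qed (use ad meets in blast)+
    then show ?thesis using no unfolding M_def by blast
  qed
  \<comment> \<open>The exceptional points of \<open>B\<close> at level \<open>n\<close>: those in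
    no member of \<open>M n\<close> or in two of them.\<close>
  define Z where "Z n = (B - (\<Union>z\<in>M n. fst z)) \<union>
    (\<Union>z\<in>M n. \<Union>w\<in>M n - {z}. fst z \<inter> fst w)" for n
  have "small \<kappa> (Z n)" for n
    unfolding Z_def
  proof (rule small_Un)
    show "small \<kappa> (B - (\<Union>z\<in>M n. fst z))"
    proof (rule ccontr)
      assume "\<not> small \<kappa> (B - (\<Union>z\<in>M n. fst z))"
      then obtain z where z: "z \<in> M n" "\<not> small \<kappa> ((B - (\<Union>z\<in>M n. fst z)) \<inter> fst z)"
        using meets[of "B - (\<Union>z\<in>M n. fst z)" n] by blast
      then have "(B - (\<Union>z\<in>M n. fst z)) \<inter> fst z = {}" by blast
      then show False using z(2) small_finite[of "{} :: 'a set"] by simp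
    qed
    show "small \<kappa> (\<Union>z\<in>M n. \<Union>w\<in>M n - {z}. fst z \<inter> fst w)"
    proof (intro small_UN M)
      show "small \<kappa> (M n - {z})" for z using small_subset[OF M[of n]] by blast
      show "small \<kappa> (fst z \<inter> fst w)" if "z \<in> M n" "w \<in> M n - {z}" for z w
        using ad that by blast
    qed
  qed
  \<comment> \<open>As \<kappa> is uncountable and regular, the exceptional points of all levels
    together are still small, so some \<open>x\<close> in \<open>B\<close> is never
    exceptional.\<close>
  moreover have "small \<kappa> (UNIV :: nat set)"
    using unc card_of_nat ordIso_ordLess_trans unfolding small_def by blast
  ultimately have "small \<kappa> (\<Union>n. Z n)" by (intro small_UN) auto
  then have "\<not> B \<subseteq> (\<Union>n. Z n)" using B(2) small_subset by blast
  then obtain x where x: "x \<in> B" "\<And>n. x \<notin> Z n" by blast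
  have "\<exists>z. z \<in> M n \<and> x \<in> fst z" for n using x unfolding Z_def by blast
  then obtain z where z: "\<And>n. z n \<in> M n" "\<And>n. x \<in> fst (z n)" by metis
  have unique: "w = z n" if "w \<in> M n" "x \<in> fst w" for w n
    using x(2)[of n] z[of n] that unfolding Z_def by blast
  have "(snd (z (Suc n)) x, snd (z n) x) \<in> \<kappa> - Id" for n
  proof -
    have "z (Suc n) \<in> N (Suc n)" using z(1) unfolding M_def by blast
    then obtain w where w: "w \<in> N n" "descends (z (Suc n)) w" using desc by blast
    then have sub: "fst (z (Suc n)) \<subseteq> fst w" unfolding descends_def by blast
    then have "fst (z (Suc n)) \<inter> B \<subseteq> fst w \<inter> B" by blast
    then have "w \<in> M n" using w(1) z(1)[of "Suc n"] small_subset unfolding M_def by blast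
    \<comment> \<open>The member from which \<open>z (Suc n)\<close> descends contains
      \<open>x\<close> and also meets \<open>B\<close> in a large set, hence is the unique member of
      \<open>M n\<close> at \<open>x\<close>.\<close>
    then have "w = z n" using unique sub z(2) by blast
    then show ?thesis using w(2) z(2) unfolding descends_def by blast
  qed
  then have "\<exists>f. \<forall>n. (f (Suc n), f n) \<in> \<kappa> - Id"
    by (intro exI[of _ "\<lambda>n. snd (z n) x"] allI)
  then show False using r_wf[OF wo] unfolding wf_iff_no_infinite_down_chain by blast
qed

end

context regular_classes
begin

text \<open>Choosing distinct members of a level for the conditions that meet many of them makes the
  refinements of these conditions by the chosen members an antichain.\<close>

lemma uncountable_dense_embedding:
  assumes unc: "natLeq <o \<kappa>"
  shows "\<exists>i. dense_embedding (tree natLeq \<Lambda>) R i"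
proof -
  obtain K where K: "K \<in> \<C>" using nonempty by blast
  obtain N :: "nat \<Rightarrow> ('a set \<times> ('a \<Rightarrow> 'a)) set" where N: "\<And>n. level K (N n)"
    and desc: "\<And>n z. z \<in> N (Suc n) \<Longrightarrow> \<exists>w\<in>N n. descends z w"
    using levels[OF classes(1)[OF K] classes(2)[OF K]] by blast
  define S where "S n p = {z\<in>N n. \<not> small \<kappa> (fst z \<inter> (p \<inter> K))}" for n p
  define Q where "Q n = {p\<in>Field R. cardSuc \<kappa> \<le>o |S n p|}" for n
  have Q_cover: "\<exists>n. p \<in> Q n" if p: "p \<in> Field R" for p
  proof -
    have "\<not> small \<kappa> (p \<inter> K)" using p K unfolding FR big_sets_def by blast
    then show ?thesis using level_splits[OF unc N desc, where B = "p \<inter> K"] p unfolding Q_def S_def by blast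
  qed
  have "\<exists>A. maximal_antichain R A \<and> (\<forall>p\<in>Q n. \<exists>a\<in>A. (a, p) \<in> R)" for n
  proof -
    have "|Q n| \<le>o |Field R|" unfolding Q_def by (rule card_of_mono1) blast
    then have "|Q n| \<le>o cardSuc \<kappa>"
      using card_R card_\<Lambda> ordLeq_transitive ordLeq_ordIso_trans by blast
    then obtain c where c: "inj_on c (Q n)" "\<And>p. p \<in> Q n \<Longrightarrow> c p \<in> S n p"
      using injective_choice[OF cardSuc_Card_order[OF card], of "Q n" "S n"] unfolding Q_def by blast
    define d where "d p = (fst (c p) \<inter> (p \<inter> K)) \<union> (p - K)" for p
    have d: "d p \<in> big_sets \<kappa> \<C>" if p: "p \<in> Q n" for p
    proof -
      have "p \<in> big_sets \<kappa> \<C>" using p FR unfolding Q_def by blast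
      moreover have "\<not> small \<kappa> (fst (c p) \<inter> (p \<inter> K))" using c(2)[OF p] unfolding S_def by blast
      ultimately show ?thesis unfolding d_def by (intro replace_class K) auto
    qed
    have le: "(d p, p) \<in> R" if p: "p \<in> Q n" for p
    proof -
      have "p \<in> big_sets \<kappa> \<C>" using p FR unfolding Q_def by blast
      then have "(d p, p) \<in> big_poset \<kappa> \<C>" using d[OF p] unfolding big_poset_def d_def by blast
      then show ?thesis by (rule sep_leI[OF Preorder_big_poset])
    qed
    have anti: "pairwise (\<lambda>x y. \<not> compatible R x y) (d ` Q n)"
    proof (rule pairwiseI)
      fix x y assume "x \<in> d ` Q n" "y \<in> d ` Q n" "x \<noteq> y"
      then obtain p q where pq: "p \<in> Q n" "q \<in> Q n" "x = d p" "y = d q" "p \<noteq> q" by blast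
      then have "c p \<noteq> c q" using c(1) by (auto dest: inj_onD)
      then have "small \<kappa> (fst (c p) \<inter> fst (c q))"
        using levelD(2)[OF N, of "c p" n "c q"] c(2)[OF pq(1)] c(2)[OF pq(2)] unfolding S_def by blast
      then have "small \<kappa> (x \<inter> y \<inter> K)" by (rule small_subset) (auto simp: pq d_def)
      then show "\<not> compatible R x y" using compatible_big_poset[of x y] d pq K by blast
    qed
    have "d ` Q n \<subseteq> Field R" using d FR by blast
    then obtain A where "d ` Q n \<subseteq> A" "maximal_antichain R A" using extend_antichain anti by metis
    then show ?thesis using le by blast
  qed
  then obtain A where A: "\<And>n. maximal_antichain R (A n)" "\<And>n p. p \<in> Q n \<Longrightarrow> \<exists>a\<in>A n. (a, p) \<in> R"
    by metis
  have A_dense: "\<exists>n\<in>Field natLeq. \<exists>a\<in>A n. (a, p) \<in> R" if p: "p \<in> Field R" for p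
    using Q_cover[OF p] A(2) unfolding Field_natLeq by blast
  \<comment> \<open>In a tree of height \<omega> only finitely many conditions precede a level, and
    the last of them is a lower bound.\<close>
  have closed: "\<exists>p\<in>Field R. \<forall>m\<in>underS natLeq n. (p, x m) \<in> R"
    if x: "\<And>m. m \<in> underS natLeq n \<Longrightarrow> x m \<in> Field R"
      and dec: "\<And>m l. m \<in> underS natLeq n \<Longrightarrow> l \<in> underS natLeq m \<Longrightarrow> (x m, x l) \<in> R"
    for n x
  proof (cases n)
    case 0
    then show ?thesis using FR Field_in_big_sets by (auto simp: natLeq_underS_less)
  next
    case (Suc k)
    have k: "x k \<in> Field R" using x[of k] Suc by (simp add: natLeq_underS_less)
    have "(x k, x m) \<in> R" if "m \<in> underS natLeq n" for m
    proof (cases "m = k")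
      case True
      then show ?thesis using Preorder_refl[OF PR k] by simp
    next
      case False
      then show ?thesis using dec[of k m] that Suc unfolding natLeq_underS_less by simp
    qed
    then show ?thesis using k by blast
  qed
  show ?thesis
    by (rule tree_dense_embedding[OF PR natLeq_Well_order card_R large_antichain closed A(1) A_dense])
qed

end

section \<open>Unary structures\<close>

definition symbols_at :: "'i language \<Rightarrow> ('i, 'a) interp \<Rightarrow> 'a \<Rightarrow> 'i set" where
  "symbols_at L \<rho> x = {i\<in>symbols L. [x] \<in> \<rho> i}"

lemma embedding_unary:
  assumes "unary L"
  shows "embedding L (X, \<rho>) (Y, \<sigma>) f \<longleftrightarrow>
    f ` X \<subseteq> Y \<and> inj_on f X \<and> (\<forall>x\<in>X. symbols_at L \<rho> x = symbols_at L \<sigma> (f x))"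
proof -
  have "(\<forall>i\<in>symbols L. \<forall>xs. length xs = arity L i \<and> set xs \<subseteq> X \<longrightarrow> (xs \<in> \<rho> i \<longleftrightarrow> map f xs \<in> \<sigma> i)) \<longleftrightarrow>
    (\<forall>i\<in>symbols L. \<forall>x\<in>X. [x] \<in> \<rho> i \<longleftrightarrow> [f x] \<in> \<sigma> i)"
  proof (rule ball_cong[OF refl])
    fix i assume "i \<in> symbols L"
    then have "arity L i = 1" using assms unfolding unary_def by blast
    then show "(\<forall>xs. length xs = arity L i \<and> set xs \<subseteq> X \<longrightarrow> (xs \<in> \<rho> i \<longleftrightarrow> map f xs \<in> \<sigma> i)) \<longleftrightarrow>
      (\<forall>x\<in>X. [x] \<in> \<rho> i \<longleftrightarrow> [f x] \<in> \<sigma> i)" by (auto simp: length_Suc_conv)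
  qed
  then show ?thesis unfolding embedding_def symbols_at_def by auto
qed

lemma embedding_comp:
  assumes L: "unary L" and f: "embedding L (X, \<rho>) (Y, \<sigma>) f" and g: "embedding L (Y, \<sigma>) (Z, \<theta>) g"
  shows "embedding L (X, \<rho>) (Z, \<theta>) (g \<circ> f)"
  using f g unfolding embedding_unary[OF L] by (auto intro: comp_inj_on inj_on_subset)

lemma embedding_inv:
  assumes L: "unary L" and f: "embedding L (X, \<rho>) (Y, \<sigma>) f" "f ` X = Y"
  shows "embedding L (Y, \<sigma>) (X, \<rho>) (inv_into X f)"
proof -
  have f': "inj_on f X" "\<And>x. x \<in> X \<Longrightarrow> symbols_at L \<rho> x = symbols_at L \<sigma> (f x)"
    using f(1) unfolding embedding_unary[OF L] by blast+
  have inv: "inv_into X f y \<in> X" "f (inv_into X f y) = y" if "y \<in> Y" for y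
    using that f(2) by (auto intro: inv_into_into f_inv_into_f)
  show ?thesis
    unfolding embedding_unary[OF L] using inv f'(2) f(2) inj_on_inv_into[of Y f X] by force
qed

lemma isomorphic_imp_equimorphic:
  assumes L: "unary L" and "isomorphic L (X, \<rho>) (Y, \<sigma>)"
  shows "equimorphic L (X, \<rho>) (Y, \<sigma>)"
  using assms(2) embedding_inv[OF L, of X \<rho> Y \<sigma>] unfolding isomorphic_def equimorphic_def by auto

lemma equimorphic_imp_isomorphic:
  assumes L: "unary L" and "equimorphic L (X, \<rho>) (Y, \<sigma>)"
  shows "isomorphic L (X, \<rho>) (Y, \<sigma>)"
proof -
  obtain f g where fg: "embedding L (X, \<rho>) (Y, \<sigma>) f" "embedding L (Y, \<sigma>) (X, \<rho>) g"
    using assms(2) unfolding equimorphic_def by blast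
  define XT where "XT t = {x\<in>X. symbols_at L \<rho> x = t}" for t
  define YT where "YT t = {y\<in>Y. symbols_at L \<sigma> y = t}" for t
  \<comment> \<open>Embeddings preserve the set of symbols at a point, so \<open>f\<close> and
    \<open>g\<close> restrict to injections between corresponding classes. The bijections obtained
    are glued in \<open>k\<close>.\<close>
  have "\<exists>h. bij_betw h (XT t) (YT t)" for t
  proof (rule Schroeder_Bernstein)
    show "inj_on f (XT t)" "f ` XT t \<subseteq> YT t"
      using fg(1) unfolding embedding_unary[OF L] XT_def YT_def by (auto intro: inj_on_subset)
    show "inj_on g (YT t)" "g ` YT t \<subseteq> XT t"
      using fg(2) unfolding embedding_unary[OF L] XT_def YT_def by (auto intro: inj_on_subset)
  qed
  then obtain h where h: "\<And>t. bij_betw (h t) (XT t) (YT t)" by metis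
  define k where "k x = h (symbols_at L \<rho> x) x" for x
  have kY: "k x \<in> YT (symbols_at L \<rho> x)" if "x \<in> X" for x
    using h[of "symbols_at L \<rho> x"] that unfolding bij_betw_def XT_def k_def by blast
  have "inj_on k X"
  proof (rule inj_onI)
    fix x y assume xy: "x \<in> X" "y \<in> X" "k x = k y"
    then have t: "symbols_at L \<rho> x = symbols_at L \<rho> y" using kY[of x] kY[of y] unfolding YT_def by auto
    then show "x = y"
      using h[of "symbols_at L \<rho> y"] xy unfolding bij_betw_def inj_on_def XT_def k_def by auto
  qed
  moreover have "k ` X = Y"
  proof
    show "k ` X \<subseteq> Y" using kY unfolding YT_def by blast
    show "Y \<subseteq> k ` X"
    proof
      fix y assume "y \<in> Y"
      then have "y \<in> YT (symbols_at L \<sigma> y)" unfolding YT_def by blast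
      then obtain x where "x \<in> XT (symbols_at L \<sigma> y)" "y = h (symbols_at L \<sigma> y) x"
        using h[of "symbols_at L \<sigma> y"] unfolding bij_betw_def by blast
      then have "x \<in> X" "y = k x" unfolding XT_def k_def by auto
      then show "y \<in> k ` X" by blast
    qed
  qed
  moreover have "symbols_at L \<rho> x = symbols_at L \<sigma> (k x)" if "x \<in> X" for x
    using kY[OF that] unfolding YT_def by simp
  ultimately show ?thesis
    unfolding isomorphic_def by (intro exI[of _ k]) (auto simp: embedding_unary[OF L])
qed

section \<open>Copies and isomorphisms\<close>

lemma copiesI: "embedding L (X, \<rho>) (X, \<rho>) f \<Longrightarrow> f ` X \<in> copies L (X, \<rho>)"
  unfolding copies_def by fastforce

lemma Field_copies_poset: "Field (copies_poset L A) = copies L A"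
  unfolding Field_def copies_poset_def by blast

lemma Preorder_copies_poset: "Preorder (copies_poset L A)"
  unfolding order_on_defs refl_on_def Field_copies_poset
  unfolding copies_poset_def by (auto intro: transI)

text \<open>Conjugating self-embeddings by the isomorphism \<open>f\<close> carries copies to
  copies, so taking images under \<open>f\<close> is the order isomorphism.\<close>

lemma isomorphic_imp_order_isomorphic_copies:
  assumes L: "unary L" and "isomorphic L (X, \<rho>) (Y, \<sigma>)"
  shows "order_isomorphic (copies_poset L (X, \<rho>)) (copies_poset L (Y, \<sigma>))"
proof -
  obtain f where f: "embedding L (X, \<rho>) (Y, \<sigma>) f" "f ` X = Y"
    using assms(2) unfolding isomorphic_def by auto
  note f' = embedding_inv[OF L f]
  have inj: "inj_on f X" using f(1) unfolding embedding_unary[OF L] by blast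
  have sub: "A \<subseteq> X" if "A \<in> copies L (X, \<rho>)" for A
    using that unfolding copies_def by (auto simp: embedding_unary[OF L])
  have inv: "inv_into X f ` Y = X" using f(2) inj by (auto simp: inv_into_image_cancel)
  have to: "f ` A \<in> copies L (Y, \<sigma>)" if A: "A \<in> copies L (X, \<rho>)" for A
  proof -
    obtain e where e: "embedding L (X, \<rho>) (X, \<rho>) e" "A = e ` X" using A unfolding copies_def by auto
    have "embedding L (Y, \<sigma>) (Y, \<sigma>) (f \<circ> (e \<circ> inv_into X f))"
      using embedding_comp[OF L embedding_comp[OF L f' e(1)] f(1)] .
    moreover have "f ` A = (f \<circ> (e \<circ> inv_into X f)) ` Y" unfolding e(2) image_comp[symmetric] inv ..
    ultimately show ?thesis using copiesI by metis
  qed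
  have onto: "B \<in> (`) f ` copies L (X, \<rho>)" if B: "B \<in> copies L (Y, \<sigma>)" for B
  proof -
    obtain e where e: "embedding L (Y, \<sigma>) (Y, \<sigma>) e" "B = e ` Y" using B unfolding copies_def by auto
    have "embedding L (X, \<rho>) (X, \<rho>) (inv_into X f \<circ> (e \<circ> f))"
      using embedding_comp[OF L embedding_comp[OF L f(1) e(1)] f'] .
    then have "(inv_into X f \<circ> (e \<circ> f)) ` X \<in> copies L (X, \<rho>)" by (rule copiesI)
    moreover have "f ` (inv_into X f \<circ> (e \<circ> f)) ` X = B"
    proof -
      have "B \<subseteq> Y" using e unfolding embedding_unary[OF L] by blast
      then show ?thesis
        unfolding image_comp[symmetric] f(2) e(2)[symmetric] by (rule image_inv_into_cancel[OF f(2)])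
    qed
    ultimately show ?thesis by blast
  qed
  have "bij_betw ((`) f) (copies L (X, \<rho>)) (copies L (Y, \<sigma>))"
    unfolding bij_betw_def
  proof
    show "inj_on ((`) f) (copies L (X, \<rho>))"
      by (rule inj_onI) (metis inj inj_on_image_eq_iff sub)
    show "(`) f ` copies L (X, \<rho>) = copies L (Y, \<sigma>)" using to onto by blast
  qed
  moreover have "(A, B) \<in> copies_poset L (X, \<rho>) \<longleftrightarrow> (f ` A, f ` B) \<in> copies_poset L (Y, \<sigma>)"
    if "A \<in> copies L (X, \<rho>)" "B \<in> copies L (X, \<rho>)" for A B
  proof -
    have "f ` A \<subseteq> f ` B \<longleftrightarrow> A \<subseteq> B"
      using inj_on_image_mem_iff[OF inj _ sub[OF that(2)]] sub[OF that(1)] by blast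
    then show ?thesis using that to unfolding copies_poset_def by simp
  qed
  ultimately show ?thesis
    unfolding order_isomorphic_def iso_iff2 Field_copies_poset by blast
qed

section \<open>Separative quotients\<close>

lemma sep_eq_class_mem:
  assumes "Preorder P" "p \<in> Field P"
  shows "p \<in> sep_eq P `` {p}"
  using sep_leI[OF assms(1) Preorder_refl[OF assms]] unfolding sep_eq_def by blast

lemma sq_iff:
  assumes P: "Preorder P" and p: "p \<in> Field P" and q: "q \<in> Field P"
  shows "(sep_eq P `` {p}, sep_eq P `` {q}) \<in> sq P \<longleftrightarrow> (p, q) \<in> sep_le P"
proof
  assume "(sep_eq P `` {p}, sep_eq P `` {q}) \<in> sq P"
  then obtain p' q' where eq: "sep_eq P `` {p} = sep_eq P `` {p'}" "sep_eq P `` {q} = sep_eq P `` {q'}"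
    and le: "(p', q') \<in> sep_le P" unfolding sq_def by blast
  have "(p, p') \<in> sep_le P" "(q', q) \<in> sep_le P"
    using sep_eq_class_mem[OF P p] sep_eq_class_mem[OF P q] eq unfolding sep_eq_def by blast+
  then show "(p, q) \<in> sep_le P" using sep_le_trans[OF P] le by metis
qed (auto simp: sq_def)

lemma Field_sq:
  assumes P: "Preorder P"
  shows "Field (sq P) = (\<lambda>p. sep_eq P `` {p}) ` Field P"
proof (intro equalityI subsetI)
  fix x assume "x \<in> Field (sq P)"
  then obtain y where "(x, y) \<in> sq P \<or> (y, x) \<in> sq P" by (metis DomainE Field_def RangeE Un_iff)
  then obtain p where "p \<in> Field P" "x = sep_eq P `` {p}" unfolding sq_def using sep_leD by fast
  then show "x \<in> (\<lambda>p. sep_eq P `` {p}) ` Field P" by blast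
next
  fix x assume "x \<in> (\<lambda>p. sep_eq P `` {p}) ` Field P"
  then obtain p where p: "p \<in> Field P" "x = sep_eq P `` {p}" by blast
  then have "(x, x) \<in> sq P" using sq_iff[OF P p(1) p(1)] sep_leI[OF P Preorder_refl[OF P]] by blast
  then show "x \<in> Field (sq P)" by (rule FieldI1)
qed

text \<open>Formulated for surjections, to cover order isomorphisms as well as the map onto the
  separative quotient.\<close>

lemma ex_below_transfer:
  assumes onto: "g ` Field R = Field S"
    and iff: "\<And>a b. a \<in> Field R \<Longrightarrow> b \<in> Field R \<Longrightarrow> (a, b) \<in> R \<longleftrightarrow> (g a, g b) \<in> S"
    and a: "a \<in> Field R"
  shows "(\<exists>s. (s, g a) \<in> S \<and> X s) \<longleftrightarrow> (\<exists>t. (t, a) \<in> R \<and> X (g t))"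
proof
  assume "\<exists>s. (s, g a) \<in> S \<and> X s"
  then obtain s where s: "(s, g a) \<in> S" "X s" by blast
  then have "s \<in> g ` Field R" unfolding onto by (blast intro: FieldI1)
  then obtain t where "t \<in> Field R" "s = g t" by blast
  then show "\<exists>t. (t, a) \<in> R \<and> X (g t)" using s iff a by blast
next
  assume "\<exists>t. (t, a) \<in> R \<and> X (g t)"
  then obtain t where t: "(t, a) \<in> R" "X (g t)" by blast
  then show "\<exists>s. (s, g a) \<in> S \<and> X s" using iff[OF FieldI1[OF t(1)] a] by blast
qed

text \<open>The separative order is defined from the order alone, so an isomorphism maps its
  equivalence classes to equivalence classes.\<close>

lemma order_isomorphic_sq:
  assumes P: "Preorder P" and Q: "Preorder Q" and "order_isomorphic P Q"
  shows "order_isomorphic (sq P) (sq Q)"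
proof -
  obtain f where f: "bij_betw f (Field P) (Field Q)"
    and f_iff: "\<And>a b. a \<in> Field P \<Longrightarrow> b \<in> Field P \<Longrightarrow> (a, b) \<in> P \<longleftrightarrow> (f a, f b) \<in> Q"
    using assms(3) unfolding order_isomorphic_def iso_iff2 by blast
  have inj: "inj_on f (Field P)" and im: "f ` Field P = Field Q" using f by (auto simp: bij_betw_def)
  have sep: "(p, q) \<in> sep_le P \<longleftrightarrow> (f p, f q) \<in> sep_le Q" if p: "p \<in> Field P" and q: "q \<in> Field P" for p q
  proof -
    have below: "(\<exists>s. (s, f a) \<in> Q \<and> X s) \<longleftrightarrow> (\<exists>t. (t, a) \<in> P \<and> X (f t))"
      if "a \<in> Field P" for a X
      by (rule ex_below_transfer[OF im]) (use f_iff that in blast)+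
    \<comment> \<open>The negation of the definition of \<open>sep_le\<close> is transferred, since
      \<open>below\<close> handles existential statements.\<close>
    have "(\<exists>r. (r, f p) \<in> Q \<and> \<not> (\<exists>s. (s, r) \<in> Q \<and> (s, f q) \<in> Q)) \<longleftrightarrow>
      (\<exists>r. (r, p) \<in> P \<and> \<not> (\<exists>s. (s, f r) \<in> Q \<and> (s, f q) \<in> Q))"
      using below[OF p] .
    also have "\<dots> \<longleftrightarrow> (\<exists>r. (r, p) \<in> P \<and> \<not> (\<exists>s. (s, r) \<in> P \<and> (s, q) \<in> P))"
    proof -
      have "(\<exists>s. (s, f r) \<in> Q \<and> (s, f q) \<in> Q) \<longleftrightarrow> (\<exists>s. (s, r) \<in> P \<and> (s, q) \<in> P)"
        if "(r, p) \<in> P" for r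
        using below[OF FieldI1[OF that], of "\<lambda>s. (s, f q) \<in> Q"] f_iff[OF _ q] by (metis FieldI1)
      then show ?thesis by blast
    qed
    finally have "(\<forall>r. (r, f p) \<in> Q \<longrightarrow> (\<exists>s. (s, r) \<in> Q \<and> (s, f q) \<in> Q)) \<longleftrightarrow>
      (\<forall>r. (r, p) \<in> P \<longrightarrow> (\<exists>s. (s, r) \<in> P \<and> (s, q) \<in> P))" by blast
    then show ?thesis using p q im unfolding sep_le_def by blast
  qed
  have cls: "f ` (sep_eq P `` {p}) = sep_eq Q `` {f p}" if p: "p \<in> Field P" for p
  proof (intro equalityI subsetI)
    fix y assume "y \<in> f ` (sep_eq P `` {p})"
    then obtain q where q: "y = f q" "(p, q) \<in> sep_le P" "(q, p) \<in> sep_le P" unfolding sep_eq_def by blast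
    note qF = sep_leD(2)[OF q(2)]
    show "y \<in> sep_eq Q `` {f p}"
      using q(2,3) sep[OF p qF] sep[OF qF p] unfolding sep_eq_def q(1) by simp
  next
    fix y assume "y \<in> sep_eq Q `` {f p}"
    then have y: "(f p, y) \<in> sep_le Q" "(y, f p) \<in> sep_le Q" unfolding sep_eq_def by blast+
    then obtain q where q: "q \<in> Field P" "y = f q" using sep_leD(2)[OF y(1)] im by blast
    then have "q \<in> sep_eq P `` {p}" using y sep[OF p q(1)] sep[OF q(1) p] unfolding sep_eq_def by simp
    then show "y \<in> f ` (sep_eq P `` {p})" using q(2) by blast
  qed
  have sub: "S \<subseteq> Field P" if "S \<in> Field (sq P)" for S
    using that sep_leD(2)[of _ _ P] unfolding Field_sq[OF P] sep_eq_def by auto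
  have "bij_betw ((`) f) (Field (sq P)) (Field (sq Q))"
    unfolding bij_betw_def
  proof
    show "inj_on ((`) f) (Field (sq P))" by (rule inj_onI) (metis inj inj_on_image_eq_iff sub)
    have "(`) f ` (\<lambda>p. sep_eq P `` {p}) ` Field P = (\<lambda>p. sep_eq Q `` {f p}) ` Field P"
      unfolding image_image using cls by (rule image_cong[OF refl])
    also have "\<dots> = (\<lambda>q. sep_eq Q `` {q}) ` Field Q" unfolding im[symmetric] image_image ..
    finally show "(`) f ` Field (sq P) = Field (sq Q)" unfolding Field_sq[OF P] Field_sq[OF Q] .
  qed
  moreover have "(S, T) \<in> sq P \<longleftrightarrow> (f ` S, f ` T) \<in> sq Q"
    if "S \<in> Field (sq P)" "T \<in> Field (sq P)" for S T
  proof -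
    obtain p q where pq: "p \<in> Field P" "q \<in> Field P" "S = sep_eq P `` {p}" "T = sep_eq P `` {q}"
      using \<open>S \<in> _\<close> \<open>T \<in> _\<close> unfolding Field_sq[OF P] by blast
    have "f p \<in> Field Q" "f q \<in> Field Q" using pq im by blast+
    then show ?thesis
      using sq_iff[OF P pq(1,2)] sq_iff[OF Q] sep[OF pq(1,2)] cls pq by simp
  qed
  ultimately show ?thesis unfolding order_isomorphic_def iso_iff2 by blast
qed

text \<open>The order invariant that tells the separative quotients apart. Conditions compatible
  with every condition are exempted, as nothing is incompatible with them.\<close>

definition pseudocomplemented :: "'p rel \<Rightarrow> bool" where
  "pseudocomplemented R \<longleftrightarrow>
    (\<forall>p\<in>Field R. (\<exists>q\<in>Field R. \<not> compatible R p q) \<longrightarrow>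
      (\<exists>q\<in>Field R. \<not> compatible R p q \<and> (\<forall>q'\<in>Field R. \<not> compatible R p q' \<longrightarrow> (q', q) \<in> R)))"

lemma pseudocomplemented_transfer:
  assumes onto: "g ` Field R = Field S"
    and iff: "\<And>a b. a \<in> Field R \<Longrightarrow> b \<in> Field R \<Longrightarrow> (a, b) \<in> R \<longleftrightarrow> (g a, g b) \<in> S"
  shows "pseudocomplemented R \<longleftrightarrow> pseudocomplemented S"
proof -
  have comp: "compatible R a b \<longleftrightarrow> compatible S (g a) (g b)" if "a \<in> Field R" "b \<in> Field R" for a b
  proof -
    have "compatible S (g a) (g b) \<longleftrightarrow> (\<exists>t. (t, a) \<in> R \<and> (g t, g b) \<in> S)"
      unfolding compatible_def by (rule ex_below_transfer[OF onto]) (use iff that in blast)+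
    then show ?thesis using iff[OF _ that(2)] unfolding compatible_def by (metis FieldI1)
  qed
  show ?thesis
    unfolding pseudocomplemented_def onto[symmetric] using comp iff by simp
qed

lemma pseudocomplemented_sq:
  assumes P: "Preorder P"
  shows "pseudocomplemented (sq P) \<longleftrightarrow> pseudocomplemented (sep_le P)"
proof -
  have "pseudocomplemented (sep_le P) \<longleftrightarrow> pseudocomplemented (sq P)"
  proof (rule pseudocomplemented_transfer)
    show "(\<lambda>p. sep_eq P `` {p}) ` Field (sep_le P) = Field (sq P)"
      unfolding Field_sep_le[OF P] Field_sq[OF P] ..
    show "(a, b) \<in> sep_le P \<longleftrightarrow> (sep_eq P `` {a}, sep_eq P `` {b}) \<in> sq P"
      if "a \<in> Field (sep_le P)" "b \<in> Field (sep_le P)" for a b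
      using sq_iff[OF P] that unfolding Field_sep_le[OF P] by blast
  qed
  then show ?thesis ..
qed

lemma order_isomorphic_pseudocomplemented:
  assumes "order_isomorphic R S"
  shows "pseudocomplemented R \<longleftrightarrow> pseudocomplemented S"
proof -
  obtain f where "bij_betw f (Field R) (Field S)"
    "\<And>a b. a \<in> Field R \<Longrightarrow> b \<in> Field R \<Longrightarrow> (a, b) \<in> R \<longleftrightarrow> (f a, f b) \<in> S"
    using assms unfolding order_isomorphic_def iso_iff2 by blast
  then show ?thesis by (intro pseudocomplemented_transfer[of f]) (auto simp: bij_betw_def)
qed

section \<open>One class against two\<close>

lemma (in infinite_cardinal) pseudocomplemented_one_class:
  "pseudocomplemented (sep_le (big_poset \<kappa> {Field \<kappa>}))"
proof -
  interpret big_classes \<kappa> "{Field \<kappa>}"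
    by unfold_locales (use not_small_Field in auto)
  have F: "Field (sep_le (big_poset \<kappa> {Field \<kappa>})) = big_sets \<kappa> {Field \<kappa>}"
    by (simp only: Field_sep_le[OF Preorder_big_poset] Field_big_poset)
  have big: "A \<in> big_sets \<kappa> {Field \<kappa>} \<longleftrightarrow> A \<subseteq> Field \<kappa> \<and> \<not> small \<kappa> A" for A
    unfolding big_sets_def by (auto simp: Int_absorb2)
  have comp: "compatible (sep_le (big_poset \<kappa> {Field \<kappa>})) p q \<longleftrightarrow> \<not> small \<kappa> (p \<inter> q)"
    if "p \<in> big_sets \<kappa> {Field \<kappa>}" "q \<in> big_sets \<kappa> {Field \<kappa>}" for p q
  proof -
    have "p \<inter> q \<inter> Field \<kappa> = p \<inter> q" using that unfolding big by blast
    then show ?thesis using compatible_big_poset[OF that] by simp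
  qed
  show ?thesis
    unfolding pseudocomplemented_def F
  proof (intro ballI impI)
    fix p assume p: "p \<in> big_sets \<kappa> {Field \<kappa>}"
      and "\<exists>q\<in>big_sets \<kappa> {Field \<kappa>}. \<not> compatible (sep_le (big_poset \<kappa> {Field \<kappa>})) p q"
    then obtain q where q: "q \<in> big_sets \<kappa> {Field \<kappa>}" "small \<kappa> (p \<inter> q)" using comp by blast
    define c where "c = Field \<kappa> - p"
    \<comment> \<open>The complement is a condition because it contains \<open>q\<close> up to a
      small set.\<close>
    have "\<not> small \<kappa> c"
    proof
      assume "small \<kappa> c"
      then have "small \<kappa> (c \<union> (p \<inter> q))" using small_Un q(2) by blast
      moreover have "q \<subseteq> c \<union> (p \<inter> q)" using q(1) unfolding big c_def by blast
      ultimately show False using q(1) small_subset unfolding big by blast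
    qed
    then have c: "c \<in> big_sets \<kappa> {Field \<kappa>}" unfolding big c_def by blast
    have "p \<inter> c = {}" unfolding c_def by blast
    then have "\<not> compatible (sep_le (big_poset \<kappa> {Field \<kappa>})) p c"
      using comp[OF p c] small_finite[of "{} :: 'a set"] by simp
    moreover have "(q', c) \<in> sep_le (big_poset \<kappa> {Field \<kappa>})"
      if q': "q' \<in> big_sets \<kappa> {Field \<kappa>}" "\<not> compatible (sep_le (big_poset \<kappa> {Field \<kappa>})) p q'" for q'
    proof -
      have "q' \<inter> Field \<kappa> - c \<subseteq> p \<inter> q'" unfolding c_def by blast
      moreover have "small \<kappa> (p \<inter> q')" using comp[OF p q'(1)] q'(2) by blast
      ultimately have "small \<kappa> (q' \<inter> Field \<kappa> - c)" using small_subset by blast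
      then show ?thesis unfolding sep_le_big_poset using q'(1) c by simp
    qed
    ultimately show "\<exists>q\<in>big_sets \<kappa> {Field \<kappa>}. \<not> compatible (sep_le (big_poset \<kappa> {Field \<kappa>})) p q \<and>
        (\<forall>q'\<in>big_sets \<kappa> {Field \<kappa>}. \<not> compatible (sep_le (big_poset \<kappa> {Field \<kappa>})) p q' \<longrightarrow>
          (q', q) \<in> sep_le (big_poset \<kappa> {Field \<kappa>}))"
      using c by blast
  qed
qed

text \<open>Incompatibility needs only one class. The condition \<open>p\<close> takes half of
  \<open>K\<close> and half of \<open>K'\<close>; \<open>q\<close> avoids it in \<open>K\<close>
  alone and \<open>q'\<close> in \<open>K'\<close> alone, yet \<open>q\<close> and \<open>q'\<close>
  cover \<open>Field \<kappa>\<close>, so a bound of both is compatible with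
  \<open>p\<close>.\<close>

lemma (in big_classes) not_pseudocomplemented_two_classes:
  assumes K: "K \<in> \<C>" "K' \<in> \<C>" "K \<noteq> K'"
  shows "\<not> pseudocomplemented (sep_le (big_poset \<kappa> \<C>))"
proof
  assume pc: "pseudocomplemented (sep_le (big_poset \<kappa> \<C>))"
  have F: "Field (sep_le (big_poset \<kappa> \<C>)) = big_sets \<kappa> \<C>"
    by (simp only: Field_sep_le[OF Preorder_big_poset] Field_big_poset)
  have split: "\<exists>S. S \<subseteq> C \<and> \<not> small \<kappa> S \<and> \<not> small \<kappa> (C - S)" if C: "C \<in> \<C>" for C
  proof -
    have big: "\<not> small \<kappa> C" using classes(2)[OF C] .
    then have "infinite C" using small_finite by blast
    then obtain S where S: "S \<subseteq> C" "|S| =o |C|" "|C - S| =o |C|" using infinite_split by blast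
    have "\<kappa> \<le>o |C|" using big not_small_iff by blast
    then have "\<kappa> \<le>o |S|" "\<kappa> \<le>o |C - S|"
      using S(2,3) ordIso_symmetric ordLeq_ordIso_trans by blast+
    then show ?thesis using S(1) not_small_iff by blast
  qed
  obtain S S' where S: "S \<subseteq> K" "\<not> small \<kappa> S" "\<not> small \<kappa> (K - S)"
    and S': "S' \<subseteq> K'" "\<not> small \<kappa> S'" "\<not> small \<kappa> (K' - S')" using split K by meson
  have disj: "K \<inter> K' = {}" using disjoint K by blast
  define p where "p = S \<union> (S' \<union> (Field \<kappa> - K') - K)"
  define q where "q = (K - S) \<union> (Field \<kappa> - K)"
  define q' where "q' = (K' - S') \<union> (Field \<kappa> - K')"
  have p: "p \<in> big_sets \<kappa> \<C>"
    unfolding p_def by (intro replace_class Field_in_big_sets K S S')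
  have q: "q \<in> big_sets \<kappa> \<C>" "q' \<in> big_sets \<kappa> \<C>"
    unfolding q_def q'_def by (intro replace_class Field_in_big_sets K S S' Diff_subset)+
  have empty: "small \<kappa> ({} :: 'a set)" using small_finite by blast
  have "p \<inter> q \<inter> K = {}" unfolding p_def q_def by blast
  then have pq: "\<not> compatible (sep_le (big_poset \<kappa> \<C>)) p q"
    using compatible_big_poset[OF p q(1)] empty K(1) by metis
  have "p \<inter> q' \<inter> K' = {}" unfolding p_def q'_def using disj S(1) by blast
  then have pq': "\<not> compatible (sep_le (big_poset \<kappa> \<C>)) p q'"
    using compatible_big_poset[OF p q(2)] empty K(2) by metis
  obtain c where c: "c \<in> big_sets \<kappa> \<C>" "\<not> compatible (sep_le (big_poset \<kappa> \<C>)) p c"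
    and le: "(q, c) \<in> sep_le (big_poset \<kappa> \<C>)" "(q', c) \<in> sep_le (big_poset \<kappa> \<C>)"
    using pc p q pq pq' unfolding pseudocomplemented_def F by meson
  have "\<not> small \<kappa> (p \<inter> c \<inter> C)" if C: "C \<in> \<C>" for C
  proof
    assume sm: "small \<kappa> (p \<inter> c \<inter> C)"
    have "small \<kappa> (q \<inter> C - c)" "small \<kappa> (q' \<inter> C - c)"
      using le C unfolding sep_le_big_poset by blast+
    then have "small \<kappa> (p \<inter> c \<inter> C \<union> ((q \<inter> C - c) \<union> (q' \<inter> C - c)))" using sm small_Un by blast
    moreover have "p \<inter> C \<subseteq> p \<inter> c \<inter> C \<union> ((q \<inter> C - c) \<union> (q' \<inter> C - c))"
      using p disj unfolding q_def q'_def big_sets_def by blast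
    ultimately show False using small_subset p C unfolding big_sets_def by blast
  qed
  then show False using c compatible_big_poset[OF p c(1)] by blast
qed

section \<open>Structures in which at most one relation is non-empty\<close>

definition single :: "'i \<Rightarrow> 'a set \<Rightarrow> ('i, 'a) interp" where
  "single i\<^sub>0 S = (\<lambda>i. if i = i\<^sub>0 then (\<lambda>x. [x]) ` S else {})"

lemma single_Int_L: "unary L \<Longrightarrow> i\<^sub>0 \<in> symbols L \<Longrightarrow> S \<subseteq> X \<Longrightarrow> single i\<^sub>0 S \<in> Int_L L X"
  unfolding Int_L_def single_def unary_def by auto

lemma symbols_at_single:
  "i\<^sub>0 \<in> symbols L \<Longrightarrow> symbols_at L (single i\<^sub>0 S) x = (if x \<in> S then {i\<^sub>0} else {})"
  unfolding symbols_at_def single_def by auto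

lemma embedding_single:
  assumes "unary L" and "i\<^sub>0 \<in> symbols L"
  shows "embedding L (X, single i\<^sub>0 S) (Y, single i\<^sub>0 T) f \<longleftrightarrow>
    f ` X \<subseteq> Y \<and> inj_on f X \<and> (\<forall>x\<in>X. x \<in> S \<longleftrightarrow> f x \<in> T)"
  unfolding embedding_unary[OF assms(1)] symbols_at_single[OF assms(2)] by (auto split: if_splits)

lemma bij_betw_pieces:
  assumes S: "S \<subseteq> X" and h: "bij_betw h S T" "bij_betw h' (X - S) U" and disj: "T \<inter> U = {}"
  obtains f where "inj_on f X" "f ` X = T \<union> U" "\<And>x. x \<in> X \<Longrightarrow> x \<in> S \<longleftrightarrow> f x \<in> T"
proof -
  define f where "f x = (if x \<in> S then h x else h' x)" for x
  have "bij_betw f S T" using h(1) by (rule bij_betw_cong[THEN iffD1, rotated]) (simp add: f_def)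
  moreover have "bij_betw f (X - S) U"
    using h(2) by (rule bij_betw_cong[THEN iffD1, rotated]) (simp add: f_def)
  ultimately have "bij_betw f (S \<union> (X - S)) (T \<union> U)" using disj by (rule bij_betw_combine)
  then have f: "bij_betw f X (T \<union> U)" using S by (simp add: Un_absorb1)
  have "x \<in> S \<longleftrightarrow> f x \<in> T" if "x \<in> X" for x
    using that h disj unfolding f_def bij_betw_def by auto
  then show thesis using that f unfolding bij_betw_def by blast
qed

lemma isomorphic_single:
  assumes L: "unary L" "i\<^sub>0 \<in> symbols L" and S: "S \<subseteq> X" "T \<subseteq> X"
    and card: "|S| =o |T|" "|X - S| =o |X - T|"
  shows "isomorphic L (X, single i\<^sub>0 S) (X, single i\<^sub>0 T)"
proof -
  obtain h h' where h: "bij_betw h S T" "bij_betw h' (X - S) (X - T)"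
    using card card_of_ordIso by metis
  obtain f where f: "inj_on f X" "f ` X = T \<union> (X - T)" "\<And>x. x \<in> X \<Longrightarrow> x \<in> S \<longleftrightarrow> f x \<in> T"
    using bij_betw_pieces[OF S(1) h] by blast
  then have "f ` X = X" using S by blast
  then show ?thesis
    unfolding isomorphic_def using f by (auto simp: embedding_single[OF L] intro!: exI[of _ f])
qed

text \<open>A self-embedding maps \<open>S\<close> and \<open>X - S\<close> into themselves, so its
  range has full size in both; conversely, bijections onto the two parts of \<open>A\<close> are
  glued to one embedding.\<close>

lemma copies_single:
  assumes L: "unary L" "i\<^sub>0 \<in> symbols L" and S: "S \<subseteq> X"
  shows "copies L (X, single i\<^sub>0 S) = {A. A \<subseteq> X \<and> |A \<inter> S| =o |S| \<and> |A - S| =o |X - S|}"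
proof (intro equalityI subsetI)
  fix A assume "A \<in> copies L (X, single i\<^sub>0 S)"
  then obtain f where f: "A = f ` X" "f ` X \<subseteq> X" "inj_on f X" "\<forall>x\<in>X. x \<in> S \<longleftrightarrow> f x \<in> S"
    unfolding copies_def by (auto simp: embedding_single[OF L])
  have "A \<inter> S = f ` S" "A - S = f ` (X - S)" using f S by auto
  moreover have "|f ` S| =o |S|" "|f ` (X - S)| =o |X - S|"
    using f(3) S inj_on_subset[OF f(3)] card_of_ordIso inj_on_imp_bij_betw ordIso_symmetric
    by (metis Diff_subset)+
  ultimately show "A \<in> {A. A \<subseteq> X \<and> |A \<inter> S| =o |S| \<and> |A - S| =o |X - S|}" using f by simp
next
  fix A assume A: "A \<in> {A. A \<subseteq> X \<and> |A \<inter> S| =o |S| \<and> |A - S| =o |X - S|}"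
  then obtain h h' where h: "bij_betw h S (A \<inter> S)" "bij_betw h' (X - S) (A - S)"
    using card_of_ordIso ordIso_symmetric by (metis (lifting) mem_Collect_eq)
  obtain f where f: "inj_on f X" "f ` X = A \<inter> S \<union> (A - S)" "\<And>x. x \<in> X \<Longrightarrow> x \<in> S \<longleftrightarrow> f x \<in> A \<inter> S"
    using bij_betw_pieces[OF S h] by blast
  have "f ` X = A" using f(2) by blast
  moreover then have "embedding L (X, single i\<^sub>0 S) (X, single i\<^sub>0 S) f"
    unfolding embedding_single[OF L] using f A by auto
  ultimately show "A \<in> copies L (X, single i\<^sub>0 S)" using copiesI by metis
qed

text \<open>Complementing \<open>S\<close> exchanges the labels of the two classes but leaves the
  self-embeddings the same.\<close>

lemma copies_single_compl:
  assumes L: "unary L" "i\<^sub>0 \<in> symbols L"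
  shows "copies L (X, single i\<^sub>0 (X - S)) = copies L (X, single i\<^sub>0 S)"
proof -
  have "embedding L (X, single i\<^sub>0 (X - S)) (X, single i\<^sub>0 (X - S)) f \<longleftrightarrow>
    embedding L (X, single i\<^sub>0 S) (X, single i\<^sub>0 S) f" for f
    unfolding embedding_single[OF L] by blast
  then show ?thesis unfolding copies_def by simp
qed

text \<open>A non-small subset of \<open>Field \<kappa>\<close> has size exactly \<kappa>. This
  translates copies into big sets.\<close>

lemma (in infinite_cardinal) card_inter_iff:
  assumes K: "\<not> small \<kappa> K" "K \<subseteq> Field \<kappa>"
  shows "|A \<inter> K| =o |K| \<longleftrightarrow> \<not> small \<kappa> (A \<inter> K)"
proof -
  have "|K| \<le>o |Field \<kappa>|" using K(2) by (rule card_of_mono1)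
  then have "|K| \<le>o \<kappa>" using card_of_Field_ordIso[OF card] ordLeq_ordIso_trans by blast
  moreover have "\<kappa> \<le>o |K|" using K(1) not_small_iff by blast
  moreover have "|A \<inter> K| \<le>o |K|" by (rule card_of_mono1) blast
  ultimately show ?thesis
    unfolding not_small_iff ordIso_iff_ordLeq using ordLeq_transitive by blast
qed

lemma (in infinite_cardinal) copies_poset_empty:
  assumes L: "unary L" "i\<^sub>0 \<in> symbols L"
  shows "copies_poset L (Field \<kappa>, single i\<^sub>0 {}) = big_poset \<kappa> {Field \<kappa>}"
proof -
  have "|A| =o |Field \<kappa>| \<longleftrightarrow> \<not> small \<kappa> (A \<inter> Field \<kappa>)" if "A \<subseteq> Field \<kappa>" for A
    using card_inter_iff[OF not_small_Field subset_refl, of A] that by (simp add: Int_absorb2)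
  moreover have "|{} :: 'a set| =o |{} :: 'a set|" by (rule card_of_refl)
  ultimately have "copies L (Field \<kappa>, single i\<^sub>0 {}) = big_sets \<kappa> {Field \<kappa>}"
    unfolding copies_single[OF L empty_subsetI] big_sets_def by auto
  then show ?thesis unfolding copies_poset_def big_poset_def by simp
qed

lemma (in infinite_cardinal) copies_poset_split:
  assumes L: "unary L" "i\<^sub>0 \<in> symbols L"
    and S: "S \<subseteq> Field \<kappa>" "\<not> small \<kappa> S" "\<not> small \<kappa> (Field \<kappa> - S)"
  shows "copies_poset L (Field \<kappa>, single i\<^sub>0 S) = big_poset \<kappa> {S, Field \<kappa> - S}"
proof -
  have "|A - S| =o |Field \<kappa> - S| \<longleftrightarrow> \<not> small \<kappa> (A \<inter> (Field \<kappa> - S))" if "A \<subseteq> Field \<kappa>" for A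
  proof -
    have "A - S = A \<inter> (Field \<kappa> - S)" using that by blast
    then show ?thesis using card_inter_iff[OF S(3) Diff_subset, of A] by simp
  qed
  then have "copies L (Field \<kappa>, single i\<^sub>0 S) = big_sets \<kappa> {S, Field \<kappa> - S}"
    unfolding copies_single[OF L S(1)] big_sets_def using card_inter_iff[OF S(2,1)] by auto
  then show ?thesis unfolding copies_poset_def big_poset_def by simp
qed

text \<open>The trees depend on \<kappa> only and not on the classes, so one tree embeds densely
  into both separative orders.\<close>

lemma forcing_equivalent_big_posets:
  assumes "regular_classes \<kappa> \<C>" and "regular_classes \<kappa> \<D>"
  shows "forcing_equivalent (big_poset \<kappa> \<C>) (big_poset \<kappa> \<D>)"
proof -
  interpret C: regular_classes \<kappa> \<C> by fact
  interpret D: regular_classes \<kappa> \<D> by fact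
  have "natLeq \<le>o \<kappa>" using C.Cinf natLeq_ordLeq_cinfinite by blast
  then consider "natLeq <o \<kappa>" | "\<kappa> =o natLeq"
    using ordLeq_iff_ordLess_or_ordIso ordIso_symmetric by blast
  then show ?thesis
  proof cases
    case 1
    obtain i j where "dense_embedding (tree natLeq C.\<Lambda>) C.R i" "dense_embedding (tree natLeq C.\<Lambda>) D.R j"
      using C.uncountable_dense_embedding[OF 1] D.uncountable_dense_embedding[OF 1] by blast
    then have "common_dense (big_poset \<kappa> \<C>) (big_poset \<kappa> \<D>) (tree natLeq C.\<Lambda>) i j"
      by (intro common_dense.intro Preorder_big_poset Preorder_tree natLeq_Well_order)
    then show ?thesis by (rule common_dense.forcing_equivalent)
  next
    case 2
    obtain i j where "dense_embedding (tree (cardSuc \<kappa>) C.\<Lambda>) C.R i"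
      "dense_embedding (tree (cardSuc \<kappa>) C.\<Lambda>) D.R j"
      using C.countable_dense_embedding[OF 2] D.countable_dense_embedding[OF 2] by blast
    then have "common_dense (big_poset \<kappa> \<C>) (big_poset \<kappa> \<D>) (tree (cardSuc \<kappa>) C.\<Lambda>) i j"
      by (intro common_dense.intro Preorder_big_poset Preorder_tree cardSuc_Well_order C.card)
    then show ?thesis by (rule common_dense.forcing_equivalent)
  qed
qed

section \<open>The hierarchy of the similarity relations\<close>

theorem theorem3p5:
  fixes L :: "'i language" and \<kappa> :: "'a rel"
  assumes "relational_language L" and "unary L" and "Cinfinite \<kappa>"
  shows
    "(\<forall>A\<in>Mod_L L (Field \<kappa>). \<forall>B\<in>Mod_L L (Field \<kappa>).
        equimorphic L A B \<longrightarrow> isomorphic L A B) \<and>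
     (sim1 L (Field \<kappa>) = sim2 L (Field \<kappa>) \<and>
      sim3 L (Field \<kappa>) = sim5 L (Field \<kappa>) \<and>
      sim5 L (Field \<kappa>) = sim7 L (Field \<kappa>) \<and>
      sim7 L (Field \<kappa>) = sim9 L (Field \<kappa>) \<and>
      sim0 L (Field \<kappa>) \<subset> sim1 L (Field \<kappa>) \<and>
      sim1 L (Field \<kappa>) \<subset> sim3 L (Field \<kappa>) \<and>
      sim1 L (Field \<kappa>) \<subset> sim4 L (Field \<kappa>) \<and>
      sim3 L (Field \<kappa>) \<subset> sim6 L (Field \<kappa>) \<and>
      sim4 L (Field \<kappa>) \<subset> sim6 L (Field \<kappa>) \<and>
      sim6 L (Field \<kappa>) \<subset> sim11 L (Field \<kappa>) \<and>
      \<not> sim3 L (Field \<kappa>) \<subseteq> sim4 L (Field \<kappa>) \<and>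
      \<not> sim4 L (Field \<kappa>) \<subseteq> sim3 L (Field \<kappa>) \<and>
      sim8 L (Field \<kappa>) \<noteq> sim11 L (Field \<kappa>)) \<and>
     (regularCard \<kappa> \<and> ctwo ^c \<kappa> =o cardSuc \<kappa> \<longrightarrow>
      sim8 L (Field \<kappa>) \<noteq> sim10 L (Field \<kappa>))"
proof -
  interpret infinite_cardinal \<kappa> by unfold_locales fact
  note unary = \<open>unary L\<close>
  define X where "X = Field \<kappa>"
  obtain i\<^sub>0 where i: "i\<^sub>0 \<in> symbols L" using assms(1) unfolding relational_language_def by blast
  note L = unary i
  have Int: "single i\<^sub>0 S \<in> Int_L L X" if "S \<subseteq> X" for S using single_Int_L[OF L that] .
  note sims = sim0_def sim1_def sim2_def sim3_def sim4_def sim5_def sim6_def sim7_def sim8_def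
    sim9_def sim10_def sim11_def on_Int_def
  have inf: "infinite X" using Cinf unfolding X_def by (simp add: cinfinite_def)
  obtain S where S: "S \<subseteq> X" "|S| =o |X|" "|X - S| =o |X|"
    using infinite_split[OF inf] by blast
  have "\<kappa> \<le>o |X|" using not_small_Field not_small_iff unfolding X_def by blast
  then have S_big: "\<not> small \<kappa> S" "\<not> small \<kappa> (X - S)"
    using S(2,3) ordIso_symmetric ordLeq_ordIso_trans unfolding not_small_iff by blast+
  then have S_ne: "S \<noteq> {}" "X - S \<noteq> {}" using small_finite[OF finite.emptyI] by metis+
  obtain a b where ab: "a \<in> X" "b \<in> X" "a \<noteq> b" using S(1) S_ne by blast

  have equi: "equimorphic L (X, \<rho>) (X, \<sigma>) \<longleftrightarrow> isomorphic L (X, \<rho>) (X, \<sigma>)" for \<rho> \<sigma> :: "('i, 'a) interp"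
    using isomorphic_imp_equimorphic[OF unary] equimorphic_imp_isomorphic[OF unary] by blast
  have iso_copies: "order_isomorphic (copies_poset L (X, \<rho>)) (copies_poset L (X, \<sigma>))"
    if "isomorphic L (X, \<rho>) (X, \<sigma>)" for \<rho> \<sigma> :: "('i, 'a) interp"
    using isomorphic_imp_order_isomorphic_copies[OF unary that] .
  have iso_sq: "order_isomorphic (sq (copies_poset L (X, \<rho>))) (sq (copies_poset L (X, \<sigma>)))"
    if "order_isomorphic (copies_poset L (X, \<rho>)) (copies_poset L (X, \<sigma>))" for \<rho> \<sigma> :: "('i, 'a) interp"
    using order_isomorphic_sq[OF Preorder_copies_poset Preorder_copies_poset that] .
  have iso_refl: "isomorphic L (X, \<rho>) (X, \<rho>)" for \<rho> :: "('i, 'a) interp"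
    unfolding isomorphic_def by (intro exI[of _ id]) (simp add: embedding_unary[OF unary])
  have copies_iso: "order_isomorphic (copies_poset L (X, \<rho>)) (copies_poset L (X, \<sigma>))"
    if "copies L (X, \<rho>) = copies L (X, \<sigma>)" for \<rho> \<sigma> :: "('i, 'a) interp"
  proof -
    have eq: "copies_poset L (X, \<rho>) = copies_poset L (X, \<sigma>)" using that by (simp add: copies_poset_def)
    show ?thesis unfolding eq order_isomorphic_def iso_iff2 by (intro exI[of _ id]) simp
  qed

  \<comment> \<open>Halves of size \<kappa>: exchanging them changes the relation but neither the
    isomorphism type nor the copies.\<close>
  have swap: "(single i\<^sub>0 (X - S), single i\<^sub>0 S) \<in> sim1 L X" "(single i\<^sub>0 (X - S), single i\<^sub>0 S) \<notin> sim0 L X"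
  proof -
    have "X - (X - S) = S" using S(1) by blast
    moreover have "|X - S| =o |S|" using S ordIso_symmetric ordIso_transitive by blast
    ultimately have "isomorphic L (X, single i\<^sub>0 (X - S)) (X, single i\<^sub>0 S)"
      using ordIso_symmetric S(1) by (intro isomorphic_single[OF L]) auto
    then show "(single i\<^sub>0 (X - S), single i\<^sub>0 S) \<in> sim1 L X"
      using Int S(1) copies_single_compl[OF L] unfolding sims by simp
    obtain s where "s \<in> S" using S_ne by blast
    then have "[s] \<in> single i\<^sub>0 S i\<^sub>0" "[s] \<notin> single i\<^sub>0 (X - S) i\<^sub>0" unfolding single_def by auto
    then show "(single i\<^sub>0 (X - S), single i\<^sub>0 S) \<notin> sim0 L X" unfolding sims by auto
  qed
  \<comment> \<open>Isomorphic structures with different copies: \<open>X - {a}\<close> loses the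
    only marked point of the first structure but not that of the second.\<close>
  have point: "(single i\<^sub>0 {a}, single i\<^sub>0 {b}) \<in> sim3 L X" "(single i\<^sub>0 {a}, single i\<^sub>0 {b}) \<notin> sim4 L X"
  proof -
    have remove: "|Y - {c}| =o |Y|" if "infinite Y" for Y :: "'a set" and c
      using infinite_imp_bij_betw[OF that, of c] card_of_ordIso ordIso_symmetric by blast
    then have "|X - {a}| =o |X - {b}|" using inf ordIso_symmetric ordIso_transitive by blast
    moreover have "|{a}| =o |{b}|" using card_of_ordIso[of "{a}" "{b}"] by (auto simp: bij_betw_def)
    ultimately show "(single i\<^sub>0 {a}, single i\<^sub>0 {b}) \<in> sim3 L X"
      using Int ab unfolding sims by (simp add: isomorphic_single[OF L])
    have "(X - {a}) \<inter> {b} = {b}" using ab by blast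
    moreover have "|X - {a} - {b}| =o |X - {b}|"
      using remove[of "X - {b}" a] inf by (simp add: Diff_insert2[symmetric] insert_commute)
    ultimately have "X - {a} \<in> copies L (X, single i\<^sub>0 {b})"
      using ab by (simp add: copies_single[OF L] card_of_refl)
    moreover have "X - {a} \<notin> copies L (X, single i\<^sub>0 {a})"
      using ab card_of_ordIso[of "{}" "{a}"] by (auto simp: copies_single[OF L] bij_betw_def)
    ultimately show "(single i\<^sub>0 {a}, single i\<^sub>0 {b}) \<notin> sim4 L X" unfolding sims by auto
  qed
  \<comment> \<open>Here the self-embeddings are all injections in both cases, but a marked point
    cannot go to an unmarked one.\<close>
  have full: "(single i\<^sub>0 X, single i\<^sub>0 {}) \<in> sim4 L X" "(single i\<^sub>0 X, single i\<^sub>0 {}) \<notin> sim3 L X"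
  proof -
    show "(single i\<^sub>0 X, single i\<^sub>0 {}) \<in> sim4 L X"
      using Int copies_single_compl[OF L, of X "{}"] unfolding sims by simp
    show "(single i\<^sub>0 X, single i\<^sub>0 {}) \<notin> sim3 L X"
      using ab(1) unfolding sims isomorphic_def by (auto simp: embedding_single[OF L])
  qed

  have S': "S \<subseteq> Field \<kappa>" "\<not> small \<kappa> (Field \<kappa> - S)" using S S_big by (simp_all add: X_def)
  interpret two: big_classes \<kappa> "{S, Field \<kappa> - S}"
    by unfold_locales (use S S_big in \<open>auto simp: X_def\<close>)
  interpret one: big_classes \<kappa> "{Field \<kappa>}"
    by unfold_locales (use not_small_Field in auto)
  note posets = copies_poset_empty[OF L] copies_poset_split[OF L S'(1) S_big(1) S'(2)]
  have "S \<noteq> Field \<kappa> - S" using S_ne by blast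
  then have "\<not> pseudocomplemented (sep_le (big_poset \<kappa> {S, Field \<kappa> - S}))"
    by (intro two.not_pseudocomplemented_two_classes[of S "Field \<kappa> - S"]) auto
  \<comment> \<open>One class against two halves of size \<kappa>: this pair separates
    \<open>sim6\<close> and \<open>sim8\<close> from \<open>sim11\<close>, and under the cardinal
    assumptions also \<open>sim8\<close> from \<open>sim10\<close>.\<close>
  then have not_sq: "\<not> order_isomorphic (sq (copies_poset L (X, single i\<^sub>0 {}))) (sq (copies_poset L (X, single i\<^sub>0 S)))"
    using order_isomorphic_pseudocomplemented pseudocomplemented_sq[OF Preorder_big_poset]
      pseudocomplemented_one_class unfolding X_def posets by blast
  have not8: "(single i\<^sub>0 {}, single i\<^sub>0 S) \<notin> sim8 L X" using not_sq unfolding sims by blast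
  have not6: "(single i\<^sub>0 {}, single i\<^sub>0 S) \<notin> sim6 L X" using not_sq iso_sq unfolding sims by blast
  have in11: "(single i\<^sub>0 {}, single i\<^sub>0 S) \<in> sim11 L X" using Int S(1) unfolding sims by simp

  have c: "sim8 L X \<noteq> sim10 L X" if reg: "regularCard \<kappa>" and gch: "ctwo ^c \<kappa> =o cardSuc \<kappa>"
  proof -
    have "regular_classes \<kappa> {Field \<kappa>}" "regular_classes \<kappa> {S, Field \<kappa> - S}"
      using reg gch by unfold_locales auto
    then have "forcing_equivalent (copies_poset L (X, single i\<^sub>0 {})) (copies_poset L (X, single i\<^sub>0 S))"
      unfolding X_def posets by (rule forcing_equivalent_big_posets)
    then have "(single i\<^sub>0 {}, single i\<^sub>0 S) \<in> sim10 L X" using Int S(1) unfolding sims by simp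
    then show ?thesis using not8 by blast
  qed

  have a: "\<forall>A\<in>Mod_L L X. \<forall>B\<in>Mod_L L X. equimorphic L A B \<longrightarrow> isomorphic L A B"
    unfolding Mod_L_def using equi by blast
  have e12: "sim1 L X = sim2 L X" unfolding sims using equi by simp
  \<comment> \<open>Equimorphism is isomorphism here, and it already implies isomorphic posets of
    copies and isomorphic separative quotients, so the extra conjuncts of \<open>sim5\<close> and
    \<open>sim7\<close> are automatic.\<close>
  have e35: "sim3 L X = sim5 L X" unfolding sims using equi iso_copies by blast
  have e57: "sim5 L X = sim7 L X" unfolding sims using equi iso_copies iso_sq by blast
  have e79: "sim7 L X = sim9 L X" unfolding sims using equi iso_copies iso_sq by blast
  have s01: "sim0 L X \<subseteq> sim1 L X" unfolding sims using iso_refl by auto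
  have s13: "sim1 L X \<subseteq> sim3 L X" and s14: "sim1 L X \<subseteq> sim4 L X" unfolding sims by blast+
  have s36: "sim3 L X \<subseteq> sim6 L X" unfolding sims using iso_copies by blast
  have s46: "sim4 L X \<subseteq> sim6 L X" unfolding sims using copies_iso by blast
  have s611: "sim6 L X \<subseteq> sim11 L X" unfolding sims by blast
  have "sim0 L X \<subset> sim1 L X" using s01 swap by blast
  moreover have "sim1 L X \<subset> sim3 L X" using s13 s14 point by blast
  moreover have "sim1 L X \<subset> sim4 L X" using s13 s14 full by blast
  moreover have "sim3 L X \<subset> sim6 L X" using s36 s46 full by blast
  moreover have "sim4 L X \<subset> sim6 L X" using s36 s46 point by blast
  moreover have "sim6 L X \<subset> sim11 L X" using s611 not6 in11 by blast
  moreover have "\<not> sim3 L X \<subseteq> sim4 L X" using point by blast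
  moreover have "\<not> sim4 L X \<subseteq> sim3 L X" using full by blast
  moreover have "sim8 L X \<noteq> sim11 L X" using not8 in11 by blast
  ultimately show ?thesis using a e12 e35 e57 e79 c unfolding X_def by blast
qed

end
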